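(* Consider the $(2g+1)$-dimensional commutative semisimple $K_0$-algebra $L=K_0[x]/f(x)K_0[x]$. A $K_0$-point $P=(a,b)$ on $\mathcal{C}$ is divisible by $2$ in $J(K_0)$ if and only if $$(a-x)+f(x)K_0[x]\in K_0[x]/f(x)K_0[x]=L$$ is a square in $L$.
   Context: $K$ is an algebraically closed field of characteristic different from $2$, $g\ge 1$ is an integer, $\alpha_1,\dots,\alpha_{2g+1}$ are distinct elements of $K$, and $f(x)=\prod_{i=1}^{2g+1}(x-\alpha_i)$. $K_0$ is a subfield of $K$ such that $f(x)\in K_0[x]$ (the roots $\alpha_i$ need not lie in $K_0$). $\mathcal{C}$ is the smooth projective model of $y^2=f(x)$, a genus $g$ hyperelliptic curve with exactly one infinite point $\infty$. A $K_0$-point $P=(a,b)$ means $a,b\in K_0$ with $b^2=f(a)$. $J$ is the jacobian of $\mathcal{C}$; both $\mathcal{C}$ and $J$ are defined over $K_0$, and $\infty\in\mathcal{C}(K_0)$. $\mathcal{C}$ is identified with its image in $J$ under the embedding $P\mapsto\mathrm{cl}((P)-(\infty))$ (defined over $K_0$), where $\mathrm{cl}$ denotes linear equivalence class. *)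

theory Defs
  imports "HOL-Algebra.Algebraic_Closure_Type" "HOL-Algebra.QuotRing"
begin

text \<open>
  Throughout, \<open>f\<close> is a polynomial over an algebraically closed field \<open>K\<close> of characteristic
  different from 2 (\<open>K\<close> is the type \<^typ>\<open>'k\<close>); \<open>f\<close> has odd degree and no repeated roots.
  The smooth projective model of \<open>y\<^sup>2 = f(x)\<close> consists of the points of this affine curve and a
  single point at infinity.
\<close>

datatype 'k curve_point = Infinite_Point | Affine_Point 'k 'k

definition affine_points :: "'k::field poly \<Rightarrow> 'k curve_point set" where
  "affine_points f = {Affine_Point a b | a b. b\<^sup>2 = poly f a}"

definition curve_points :: "'k::field poly \<Rightarrow> 'k curve_point set" where
  "curve_points f = insert Infinite_Point (affine_points f)"

text \<open>
  \<open>K(C) = K(x)[y]/(y\<^sup>2 - f(x))\<close>. The pair \<open>(r, s)\<close> with \<open>r, s \<in> K(x)\<close> stands for \<open>r + s y\<close>, so that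
  addition is componentwise and multiplication depends on \<open>f\<close>.
\<close>

type_synonym 'k rat_fun = "'k poly fract \<times> 'k poly fract"

definition ff_zero :: "'k::field rat_fun" where
  "ff_zero = (0, 0)"

definition ff_add :: "'k::field rat_fun \<Rightarrow> 'k rat_fun \<Rightarrow> 'k rat_fun" where
  "ff_add \<phi> \<psi> = (fst \<phi> + fst \<psi>, snd \<phi> + snd \<psi>)"

definition ff_mult :: "'k::field poly \<Rightarrow> 'k rat_fun \<Rightarrow> 'k rat_fun \<Rightarrow> 'k rat_fun" where
  "ff_mult f \<phi> \<psi> =
     (fst \<phi> * fst \<psi> + Fract f 1 * snd \<phi> * snd \<psi>, fst \<phi> * snd \<psi> + snd \<phi> * fst \<psi>)"

definition ff_poly :: "'k::field poly \<Rightarrow> 'k poly \<Rightarrow> 'k rat_fun"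
  \<comment> \<open>the function \<open>A(x) + B(x) y\<close>\<close>
  where "ff_poly A B = (Fract A 1, Fract B 1)"

definition poly_over :: "'k::field set \<Rightarrow> 'k poly set" where
  "poly_over K0 = {p. \<forall>i. Polynomial.coeff p i \<in> K0}"

definition rat_fun_over :: "'k::field set \<Rightarrow> 'k rat_fun set"
  \<comment> \<open>the subfield \<open>K\<^sub>0(C) = K\<^sub>0(x) + K\<^sub>0(x) y\<close> of \<open>K(C)\<close>\<close>
  where "rat_fun_over K0 =
    {(Fract A C, Fract B D) | A B C D.
       A \<in> poly_over K0 \<and> B \<in> poly_over K0 \<and> C \<in> poly_over K0 \<and> D \<in> poly_over K0 \<and> C \<noteq> 0 \<and> D \<noteq> 0}"

text \<open>
  Points of a smooth projective curve correspond to the normalised discrete valuations of its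
  function field that are trivial on \<open>K\<close>; the valuation of a point is the order of vanishing there.
  The value at the zero function is irrelevant and fixed to be 0, which makes the valuation
  belonging to a point unique as a total function.
\<close>

definition normalised_valuation :: "'k::field poly \<Rightarrow> ('k rat_fun \<Rightarrow> int) \<Rightarrow> bool" where
  "normalised_valuation f v \<longleftrightarrow>
     (\<forall>\<phi> \<psi>. \<phi> \<noteq> ff_zero \<longrightarrow> \<psi> \<noteq> ff_zero \<longrightarrow> v (ff_mult f \<phi> \<psi>) = v \<phi> + v \<psi>) \<and>
     (\<forall>\<phi> \<psi>. \<phi> \<noteq> ff_zero \<longrightarrow> \<psi> \<noteq> ff_zero \<longrightarrow> ff_add \<phi> \<psi> \<noteq> ff_zero \<longrightarrow>
        min (v \<phi>) (v \<psi>) \<le> v (ff_add \<phi> \<psi>)) \<and>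
     (\<forall>c. c \<noteq> 0 \<longrightarrow> v (ff_poly [:c:] 0) = 0) \<and>
     (\<exists>\<phi>. \<phi> \<noteq> ff_zero \<and> v \<phi> = 1) \<and>
     v ff_zero = 0"

text \<open>
  The valuation of \<open>(a, b)\<close> is the one for which \<open>x - a\<close> and \<open>y - b\<close> vanish; that of the point at
  infinity is the one for which \<open>x\<close> has a pole.
\<close>

fun centred_at :: "('k::field rat_fun \<Rightarrow> int) \<Rightarrow> 'k curve_point \<Rightarrow> bool" where
  "centred_at v (Affine_Point a b) \<longleftrightarrow> v (ff_poly [:-a, 1:] 0) > 0 \<and> v (ff_poly [:-b:] 1) > 0"
| "centred_at v Infinite_Point \<longleftrightarrow> v (ff_poly [:0, 1:] 0) < 0"

definition ord_at :: "'k::field poly \<Rightarrow> 'k curve_point \<Rightarrow> 'k rat_fun \<Rightarrow> int" where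
  "ord_at f P = (THE v. normalised_valuation f v \<and> centred_at v P)"

type_synonym 'k divisor = "'k curve_point \<Rightarrow> int"

definition divisor_degree :: "'k divisor \<Rightarrow> int" where
  "divisor_degree D = (\<Sum>P | D P \<noteq> 0. D P)"

definition degree_zero_divisors :: "'k::field poly \<Rightarrow> 'k divisor monoid" where
  "degree_zero_divisors f =
     \<lparr>carrier = {D. finite {P. D P \<noteq> 0} \<and> {P. D P \<noteq> 0} \<subseteq> curve_points f \<and> divisor_degree D = 0},
      monoid.mult = (\<lambda>D E P. D P + E P), monoid.one = (\<lambda>P. 0)\<rparr>"

definition principal_divisor :: "'k::field poly \<Rightarrow> 'k rat_fun \<Rightarrow> 'k divisor" where
  "principal_divisor f \<phi> = (\<lambda>P. if P \<in> curve_points f then ord_at f P \<phi> else 0)"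

definition principal_divisors :: "'k::field poly \<Rightarrow> 'k divisor set" where
  "principal_divisors f = {principal_divisor f \<phi> | \<phi>. \<phi> \<noteq> ff_zero}"

definition jacobian :: "'k::field poly \<Rightarrow> 'k divisor set monoid"
  \<comment> \<open>the group \<open>J(K) = Pic\<^sup>0(C)\<close>, written multiplicatively\<close>
  where "jacobian f = degree_zero_divisors f Mod principal_divisors f"

definition divisor_class :: "'k::field poly \<Rightarrow> 'k divisor \<Rightarrow> 'k divisor set" where
  "divisor_class f D = principal_divisors f #>\<^bsub>degree_zero_divisors f\<^esub> D"

definition point_divisor :: "'k curve_point \<Rightarrow> 'k divisor" where
  "point_divisor P = (\<lambda>Q. if Q = P then 1 else 0)"

definition jacobian_embedding :: "'k::field poly \<Rightarrow> 'k curve_point \<Rightarrow> 'k divisor set" where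
  "jacobian_embedding f P =
     divisor_class f (\<lambda>Q. point_divisor P Q - point_divisor Infinite_Point Q)"

text \<open>
  A divisor \<open>D\<close> is defined over \<open>K\<^sub>0\<close> if it is the pull-back of a divisor on the curve
  \<open>y\<^sup>2 = f(x)\<close> over \<open>K\<^sub>0\<close>, i.e. if the sheaf \<open>O(-D)\<close> is generated locally by elements of \<open>K\<^sub>0(C)\<close>.
  Since the point at infinity is \<open>K\<^sub>0\<close>-rational, its coefficient is unrestricted, and on the affine
  part of \<open>C\<close> generation by local sections is generation by global ones: at each point \<open>P\<close> the
  stalk of \<open>O(-D)\<close> is generated by some \<open>\<phi> \<in> K\<^sub>0(C)\<close> which is a section of \<open>O(-D)\<close> on the whole
  affine curve. (Invariance under the automorphisms of \<open>K\<close> over \<open>K\<^sub>0\<close> would be weaker when \<open>K\<^sub>0\<close> is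
  not perfect.)
\<close>

definition divisor_defined_over :: "'k::field poly \<Rightarrow> 'k set \<Rightarrow> 'k divisor \<Rightarrow> bool" where
  "divisor_defined_over f K0 D \<longleftrightarrow>
     (\<forall>P \<in> affine_points f. \<exists>\<phi> \<in> rat_fun_over K0. \<phi> \<noteq> ff_zero \<and>
        ord_at f P \<phi> = D P \<and> (\<forall>Q \<in> affine_points f. ord_at f Q \<phi> \<ge> D Q))"

text \<open>
  As \<open>C\<close> has a \<open>K\<^sub>0\<close>-rational point, \<open>J(K\<^sub>0)\<close> is the degree zero divisor class group of \<open>C\<close> over
  \<open>K\<^sub>0\<close>, seen inside \<open>J(K)\<close>.
\<close>

definition jacobian_over :: "'k::field poly \<Rightarrow> 'k set \<Rightarrow> 'k divisor set monoid" where
  "jacobian_over f K0 = (jacobian f)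
     \<lparr>carrier := {divisor_class f D | D.
        D \<in> carrier (degree_zero_divisors f) \<and> divisor_defined_over f K0 D}\<rparr>"

definition poly_ring_over :: "'k::field set \<Rightarrow> 'k poly ring" where
  "poly_ring_over K0 = (ring_of_type_algebra :: 'k poly ring)\<lparr>carrier := poly_over K0\<rparr>"

definition quotient_algebra :: "'k::field set \<Rightarrow> 'k poly \<Rightarrow> 'k poly set ring" where
  "quotient_algebra K0 f = poly_ring_over K0 Quot (PIdl\<^bsub>poly_ring_over K0\<^esub> f)"

definition residue_class :: "'k::field set \<Rightarrow> 'k poly \<Rightarrow> 'k poly \<Rightarrow> 'k poly set" where
  "residue_class K0 f p = (PIdl\<^bsub>poly_ring_over K0\<^esub> f) +>\<^bsub>poly_ring_over K0\<^esub> p"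

end

theory Submission
  imports Defs "HOL-Computational_Algebra.Polynomial_FPS"
begin

text \<open>
  Both conditions of the theorem say that there are polynomials \<open>A\<close> and \<open>B\<close> over \<open>K\<^sub>0\<close> with
  \<open>f = A\<^sup>2 + (x - a) B\<^sup>2\<close>, where \<open>A\<close> has degree at most \<open>g\<close> and \<open>B\<close> is monic of degree \<open>g\<close>.

  For the algebra \<open>L\<close>: suppose that \<open>q\<^sup>2 = a - x\<close> modulo \<open>f\<close>. The Euclidean algorithm for \<open>f\<close> and \<open>q\<close>
  yields \<open>A\<close> and \<open>B \<noteq> 0\<close> of degree at most \<open>g\<close> with \<open>A = B q\<close> modulo \<open>f\<close>. Then \<open>f\<close> divides
  \<open>A\<^sup>2 + (x - a) B\<^sup>2\<close>, which has degree at most \<open>2 g + 1\<close> and is non-zero, as its two terms have degrees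
  of different parity. So it is a constant multiple of \<open>f\<close>, the constant is the square of the
  leading coefficient of \<open>B\<close>, and scaling makes it 1 (\<open>representation_of_square\<close>). Conversely
  \<open>A / B\<close> is a square root of \<open>a - x\<close> in \<open>L\<close> (\<open>square_of_representation\<close>).

  For the jacobian: the identity says that the function \<open>y - A\<close> has norm \<open>- (x - a) B\<^sup>2\<close>. With the sign
  of \<open>A\<close> chosen such that \<open>A(a) = - b\<close>, the zeros of \<open>y - A\<close> are \<open>(a, - b)\<close> and, twice, the common
  zeros \<open>E\<close> of \<open>B\<close> and \<open>y - A\<close>. Hence \<open>(y - A) / (x - a)\<close> has the divisor
  \<open>2 (E - g \<infinity>) - ((a, b) - \<infinity>)\<close>, so \<open>E - g \<infinity>\<close> is a half of the point; it is defined over \<open>K\<^sub>0\<close> because \<open>B\<close>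
  and \<open>A\<close> are (\<open>halved_divisor\<close>).

  Now let \<open>D\<close> be defined over \<open>K\<^sub>0\<close> such that \<open>2 D - ((a, b) - \<infinity>)\<close> is principal. Up to a function, the
  affine part of \<open>D\<close> consists of the common zeros of \<open>u\<close> and \<open>y - p\<close>, where \<open>u\<close> and \<open>p\<close> are polynomials
  over \<open>K\<^sub>0\<close> and \<open>u\<close> divides \<open>f - p\<^sup>2\<close> (\<open>mumford_representation\<close>), and one can achieve that \<open>u\<close> has
  degree at most \<open>g\<close> (\<open>mumford_reduction\<close>). There is then a function whose affine zeros are twice
  these common zeros and \<open>(a, - b)\<close>. It is a polynomial in \<open>x\<close> and \<open>y\<close> with norm a constant times
  \<open>(x - a) u\<^sup>2\<close>; as this has degree at most \<open>2 g + 1\<close>, the function is \<open>y - A\<close> up to a constant, and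
  \<open>f = A\<^sup>2 + (x - a) u\<^sup>2\<close>. A priori \<open>A\<close> has coefficients in \<open>K\<close>. But \<open>A\<close> and \<open>p\<close> agree modulo \<open>u\<close>, so
  that \<open>A = p + c u\<close> with a constant \<open>c\<close>, and the coefficients of \<open>(f - p\<^sup>2) / u\<close>, which lie in \<open>K\<^sub>0\<close>,
  show that \<open>c\<close> is in \<open>K\<^sub>0\<close> (\<open>descend_coefficient\<close>, \<open>square_of_halved_point\<close>).

  The order of a function at a point is given by a definite description, so all this needs that every
  point carries exactly one normalised valuation. The value of \<open>A + B y\<close> can be read off from values of
  polynomials in \<open>x\<close>, in particular of the norm \<open>A\<^sup>2 - f B\<^sup>2\<close>. These are known up to a common factor, and
  normalisation determines the factor. As to existence, at the ramification points and at
  infinity the order of the norm is itself a valuation, because the orders of its two terms differ by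
  parity; at the other points a power series for the square root of \<open>f\<close> embeds \<open>K[x, y]\<close> into a
  ring of power series.
\<close>

section \<open>The function field\<close>

lemma ff_poly_eq_iff: "ff_poly A B = ff_poly C D \<longleftrightarrow> A = C \<and> B = D"
  by (simp add: ff_poly_def eq_fract)

lemma ff_poly_eq_zero_iff: "ff_poly A B = ff_zero \<longleftrightarrow> A = 0 \<and> B = 0"
  by (simp add: ff_poly_def ff_zero_def Zero_fract_def eq_fract)

lemma ff_add_poly: "ff_add (ff_poly A B) (ff_poly C D) = ff_poly (A + C) (B + D)"
  by (simp add: ff_add_def ff_poly_def)

lemma ff_mult_poly:
  "ff_mult f (ff_poly A B) (ff_poly C D) = ff_poly (A * C + f * B * D) (A * D + B * C)"
  by (simp add: ff_mult_def ff_poly_def)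

lemma ff_mult_assoc: "ff_mult f (ff_mult f \<phi> \<psi>) \<chi> = ff_mult f \<phi> (ff_mult f \<psi> \<chi>)"
  by (simp add: ff_mult_def algebra_simps)

lemma ff_mult_commute: "ff_mult f \<phi> \<psi> = ff_mult f \<psi> \<phi>"
  by (simp add: ff_mult_def algebra_simps)

lemma ff_mult_left_commute: "ff_mult f \<phi> (ff_mult f \<psi> \<chi>) = ff_mult f \<psi> (ff_mult f \<phi> \<chi>)"
  by (simp add: ff_mult_def algebra_simps)

lemmas ff_mult_ac = ff_mult_assoc ff_mult_commute ff_mult_left_commute

lemma ff_mult_add: "ff_mult f \<phi> (ff_add \<psi> \<chi>) = ff_add (ff_mult f \<phi> \<psi>) (ff_mult f \<phi> \<chi>)"
  by (simp add: ff_mult_def ff_add_def algebra_simps)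

lemma ff_mult_one: "ff_mult f (ff_poly 1 0) \<phi> = \<phi>"
  by (simp add: ff_mult_def ff_poly_def fract_collapse)

lemma ff_mult_zero: "ff_mult f \<phi> ff_zero = ff_zero"
  by (simp add: ff_mult_def ff_zero_def)

lemma ex_denominator:
  "\<exists>A B C. C \<noteq> 0 \<and> ff_mult f (ff_poly C 0) \<phi> = ff_poly A B"
proof -
  obtain r s where \<phi>: "\<phi> = (r, s)" by force
  obtain A C where r: "r = Fract A C" "C \<noteq> 0" by (cases r) auto
  obtain B D where s: "s = Fract B D" "D \<noteq> 0" by (cases s) auto
  show ?thesis
    by (rule exI[of _ "A * D"], rule exI[of _ "B * C"], rule exI[of _ "C * D"])
       (use r s in \<open>auto simp: \<phi> ff_mult_def ff_poly_def eq_fract fract_collapse\<close>)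
qed

text \<open>The norm from \<open>K(C)\<close> to \<open>K(x)\<close>, on the functions without affine poles.\<close>

definition norm_poly :: "'k::field poly \<Rightarrow> 'k poly \<Rightarrow> 'k poly \<Rightarrow> 'k poly" where
  "norm_poly f A B = A\<^sup>2 - f * B\<^sup>2"

lemma norm_poly_mult:
  "norm_poly f (A * C + f * B * D) (A * D + B * C) = norm_poly f A B * norm_poly f C D"
  by (simp add: norm_poly_def power2_eq_square algebra_simps)

lemma ff_mult_conj:
  "ff_mult f (ff_poly A B) (ff_poly A (- B)) = ff_poly (norm_poly f A B) 0"
  by (simp add: ff_mult_poly norm_poly_def power2_eq_square mult.assoc mult.commute[of A B])

locale odd_hyperelliptic =
  fixes f :: "'k::alg_closed_field poly"
  assumes two_nonzero: "(2::'k) \<noteq> 0"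
    and odd_degree: "odd (degree f)"
    and monic: "lead_coeff f = 1"
    and simple_roots: "poly f a = 0 \<Longrightarrow> Polynomial.order a f = 1"
begin

lemma f_nonzero [simp]: "f \<noteq> 0"
  using monic by auto

text \<open>
  No cancellation is possible in \<open>A\<^sup>2 - f B\<^sup>2\<close>, since the two terms have degrees of different parity.
\<close>

lemma norm_poly_nonzero:
  assumes "A \<noteq> 0 \<or> B \<noteq> 0" shows "norm_poly f A B \<noteq> 0"
proof
  assume "norm_poly f A B = 0"
  then have eq: "A\<^sup>2 = f * B\<^sup>2" by (simp add: norm_poly_def)
  then have "A \<noteq> 0" "B \<noteq> 0" using assms f_nonzero by auto
  then have "2 * degree A = degree f + 2 * degree B"
    using arg_cong[OF eq, of degree] by (simp add: degree_power_eq degree_mult_eq)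
  then show False using odd_degree by presburger
qed

lemma degree_norm_poly:
  assumes "A \<noteq> 0 \<or> B \<noteq> 0"
  shows "degree (norm_poly f A B) =
    max (if A = 0 then 0 else 2 * degree A) (if B = 0 then 0 else degree f + 2 * degree B)"
proof (cases "A = 0 \<or> B = 0")
  case True
  then show ?thesis
    by (auto simp: norm_poly_def degree_power_eq degree_mult_eq)
next
  case False
  then have d: "degree (A\<^sup>2) = 2 * degree A" "degree (f * B\<^sup>2) = degree f + 2 * degree B"
    by (auto simp: degree_power_eq degree_mult_eq)
  have ne: "2 * degree A \<noteq> degree f + 2 * degree B" using odd_degree by presburger
  show ?thesis
  proof (cases "2 * degree A < degree f + 2 * degree B")
    case True
    then have "degree (A\<^sup>2 - f * B\<^sup>2) = degree (f * B\<^sup>2)"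
      using degree_add_eq_right[of "A\<^sup>2" "- (f * B\<^sup>2)"] d by simp
    then show ?thesis using True False d by (simp add: norm_poly_def)
  next
    case f: False
    then have "degree (A\<^sup>2 - f * B\<^sup>2) = degree (A\<^sup>2)"
      using degree_add_eq_left[of "- (f * B\<^sup>2)" "A\<^sup>2"] ne d by simp
    then show ?thesis using f False d by (simp add: norm_poly_def)
  qed
qed

lemma ff_mult_nonzero:
  assumes "\<phi> \<noteq> ff_zero" "\<psi> \<noteq> ff_zero" shows "ff_mult f \<phi> \<psi> \<noteq> ff_zero"
proof
  assume 0: "ff_mult f \<phi> \<psi> = ff_zero"
  have cancel: "\<chi> = ff_zero" if "C \<noteq> 0" "ff_mult f (ff_poly C 0) \<chi> = ff_zero" for C \<chi>
  proof -
    have "Fract C 1 \<noteq> 0" using that(1) by (simp add: Zero_fract_def eq_fract)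
    then show ?thesis
      using that(2) by (cases \<chi>) (simp add: ff_mult_def ff_poly_def ff_zero_def fract_collapse)
  qed
  obtain A B C where C: "C \<noteq> 0" "ff_mult f (ff_poly C 0) \<phi> = ff_poly A B"
    using ex_denominator by blast
  have AB: "A \<noteq> 0 \<or> B \<noteq> 0"
    using C cancel[OF C(1)] assms(1) ff_poly_eq_zero_iff by metis
  have "ff_mult f (ff_poly (norm_poly f A B) 0) \<psi>
      = ff_mult f (ff_poly A (-B)) (ff_mult f (ff_poly C 0) (ff_mult f \<phi> \<psi>))"
    unfolding ff_mult_conj[symmetric] C(2)[symmetric] by (simp add: ff_mult_ac)
  also have "\<dots> = ff_zero" by (simp add: 0 ff_mult_zero)
  finally show False using cancel norm_poly_nonzero[OF AB] assms(2) by blast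
qed

text \<open>
  The inverse is the conjugate divided by the norm.
\<close>

lemma ff_inverse:
  assumes "\<phi> \<noteq> ff_zero"
  obtains \<psi> where "\<psi> \<noteq> ff_zero" "ff_mult f \<phi> \<psi> = ff_poly 1 0"
proof -
  obtain A B C where C: "C \<noteq> 0" "ff_mult f (ff_poly C 0) \<phi> = ff_poly A B"
    using ex_denominator by blast
  have AB: "A \<noteq> 0 \<or> B \<noteq> 0"
    using C ff_mult_nonzero[OF _ assms, of "ff_poly C 0"] by (auto simp: ff_poly_eq_zero_iff)
  define N where "N = norm_poly f A B"
  have N: "N \<noteq> 0" using norm_poly_nonzero[OF AB] by (simp add: N_def)
  define i where "i = ((Fract 1 N, 0) :: 'k rat_fun)"
  define \<psi> where "\<psi> = ff_mult f i (ff_mult f (ff_poly C 0) (ff_poly A (- B)))"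
  have "ff_mult f \<phi> \<psi> = ff_mult f i (ff_mult f (ff_poly A B) (ff_poly A (- B)))"
    unfolding \<psi>_def C(2)[symmetric] by (simp add: ff_mult_ac)
  also have "\<dots> = ff_poly 1 0"
    unfolding ff_mult_conj N_def[symmetric] using N
    by (simp add: i_def ff_mult_def ff_poly_def fract_collapse) (simp add: One_fract_def eq_fract)
  finally have "ff_mult f \<phi> \<psi> = ff_poly 1 0" .
  moreover from this have "\<psi> \<noteq> ff_zero"
    by (metis ff_mult_zero ff_poly_eq_zero_iff one_neq_zero)
  ultimately show ?thesis using that by blast
qed

section \<open>Valuations of the function field\<close>

text \<open>
  Valuations will be constructed on the functions \<open>A + B y\<close> with polynomials \<open>A\<close> and \<open>B\<close>, that is on
  \<open>K[x, y]\<close>, and extended to quotients.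
\<close>

definition poly_valuation :: "('k poly \<Rightarrow> 'k poly \<Rightarrow> int) \<Rightarrow> bool" where
  "poly_valuation w \<longleftrightarrow>
     (\<forall>A B C D. (A \<noteq> 0 \<or> B \<noteq> 0) \<longrightarrow> (C \<noteq> 0 \<or> D \<noteq> 0) \<longrightarrow>
        w (A * C + f * B * D) (A * D + B * C) = w A B + w C D) \<and>
     (\<forall>A B C D. (A \<noteq> 0 \<or> B \<noteq> 0) \<longrightarrow> (C \<noteq> 0 \<or> D \<noteq> 0) \<longrightarrow> (A + C \<noteq> 0 \<or> B + D \<noteq> 0) \<longrightarrow>
        min (w A B) (w C D) \<le> w (A + C) (B + D)) \<and>
     (\<forall>c. c \<noteq> 0 \<longrightarrow> w [:c:] 0 = 0)"

definition fraction_valuation :: "('k poly \<Rightarrow> 'k poly \<Rightarrow> int) \<Rightarrow> 'k rat_fun \<Rightarrow> int" where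
  "fraction_valuation w \<phi> = (if \<phi> = ff_zero then 0 else
     (THE k. \<exists>A B C. C \<noteq> 0 \<and> ff_mult f (ff_poly C 0) \<phi> = ff_poly A B \<and> k = w A B - w C 0))"

lemma denominator_nonzero:
  assumes "\<phi> \<noteq> ff_zero" "C \<noteq> 0" "ff_mult f (ff_poly C 0) \<phi> = ff_poly A B"
  shows "A \<noteq> 0 \<or> B \<noteq> 0"
  using ff_mult_nonzero[of "ff_poly C 0" \<phi>] assms by (auto simp: ff_poly_eq_zero_iff)

lemma poly_valuation_scale:
  assumes "poly_valuation w" "C \<noteq> 0" "A \<noteq> 0 \<or> B \<noteq> 0"
  shows "w (C * A) (C * B) = w C 0 + w A B"
proof -
  have "w (C * A + f * 0 * B) (C * B + 0 * A) = w C 0 + w A B"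
    using assms unfolding poly_valuation_def by blast
  then show ?thesis by simp
qed

lemma fraction_valuation_eq:
  assumes w: "poly_valuation w" and \<phi>: "\<phi> \<noteq> ff_zero"
    and C: "C \<noteq> 0" "ff_mult f (ff_poly C 0) \<phi> = ff_poly A B"
  shows "fraction_valuation w \<phi> = w A B - w C 0"
proof -
  have "k = w A B - w C 0" if "C' \<noteq> 0" "ff_mult f (ff_poly C' 0) \<phi> = ff_poly A' B'" "k = w A' B' - w C' 0"
    for k A' B' C'
  proof -
    have "ff_mult f (ff_poly C' 0) (ff_poly A B) = ff_mult f (ff_poly C 0) (ff_poly A' B')"
      unfolding C(2)[symmetric] that(2)[symmetric] by (simp add: ff_mult_ac)
    then have "C' * A = C * A'" "C' * B = C * B'" by (simp_all add: ff_mult_poly ff_poly_eq_iff)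
    then have "w C' 0 + w A B = w C 0 + w A' B'"
      using poly_valuation_scale[OF w] denominator_nonzero[OF \<phi>] C that by metis
    then show ?thesis using that(3) by simp
  qed
  then have "(THE k. \<exists>A B C. C \<noteq> 0 \<and> ff_mult f (ff_poly C 0) \<phi> = ff_poly A B \<and> k = w A B - w C 0)
      = w A B - w C 0"
    using C by (intro the_equality) blast+
  then show ?thesis using \<phi> by (simp add: fraction_valuation_def)
qed

lemma fraction_valuation_poly:
  assumes w: "poly_valuation w" and "A \<noteq> 0 \<or> B \<noteq> 0"
  shows "fraction_valuation w (ff_poly A B) = w A B"
proof -
  have "w 1 0 = 0" using w unfolding poly_valuation_def by (metis one_neq_zero one_pCons)
  then show ?thesis
    using fraction_valuation_eq[OF w, of "ff_poly A B" 1 A B] assms(2)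
    by (simp add: ff_mult_one ff_poly_eq_zero_iff)
qed

lemma normalised_fraction_valuation:
  assumes w: "poly_valuation w" and t: "A1 \<noteq> 0 \<or> B1 \<noteq> 0" "A2 \<noteq> 0 \<or> B2 \<noteq> 0" "w A1 B1 = w A2 B2 + 1"
  shows "normalised_valuation f (fraction_valuation w)"
  unfolding normalised_valuation_def
proof (intro conjI allI impI)
  show mult: "fraction_valuation w (ff_mult f \<phi> \<psi>) = fraction_valuation w \<phi> + fraction_valuation w \<psi>"
    if nz: "\<phi> \<noteq> ff_zero" "\<psi> \<noteq> ff_zero" for \<phi> \<psi>
  proof -
    obtain A B C where C: "C \<noteq> 0" "ff_mult f (ff_poly C 0) \<phi> = ff_poly A B" using ex_denominator by blast
    obtain A' B' C' where C': "C' \<noteq> 0" "ff_mult f (ff_poly C' 0) \<psi> = ff_poly A' B'" using ex_denominator by blast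
    have "ff_mult f (ff_poly (C * C') 0) (ff_mult f \<phi> \<psi>)
        = ff_mult f (ff_mult f (ff_poly C 0) (ff_poly C' 0)) (ff_mult f \<phi> \<psi>)" by (simp add: ff_mult_poly)
    also have "\<dots> = ff_mult f (ff_poly A B) (ff_poly A' B')"
      unfolding C(2)[symmetric] C'(2)[symmetric] by (simp add: ff_mult_ac)
    finally have "ff_mult f (ff_poly (C * C') 0) (ff_mult f \<phi> \<psi>) = \<dots>" .
    then have "fraction_valuation w (ff_mult f \<phi> \<psi>) = w (A * A' + f * B * B') (A * B' + B * A') - w (C * C') 0"
      using C C' by (intro fraction_valuation_eq[OF w ff_mult_nonzero[OF nz]]) (auto simp: ff_mult_poly)
    moreover have "w (A * A' + f * B * B') (A * B' + B * A') = w A B + w A' B'"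
      using w denominator_nonzero[OF nz(1) C] denominator_nonzero[OF nz(2) C'] unfolding poly_valuation_def by blast
    moreover have "w (C * C') 0 = w C 0 + w C' 0" using poly_valuation_scale[OF w C(1), of C' 0] C'(1) by simp
    ultimately show ?thesis
      using fraction_valuation_eq[OF w nz(1) C] fraction_valuation_eq[OF w nz(2) C'] by simp
  qed
  show "min (fraction_valuation w \<phi>) (fraction_valuation w \<psi>) \<le> fraction_valuation w (ff_add \<phi> \<psi>)"
    if nz: "\<phi> \<noteq> ff_zero" "\<psi> \<noteq> ff_zero" "ff_add \<phi> \<psi> \<noteq> ff_zero" for \<phi> \<psi>
  proof -
    obtain A B C where C: "C \<noteq> 0" "ff_mult f (ff_poly C 0) \<phi> = ff_poly A B" using ex_denominator by blast
    obtain A' B' C' where C': "C' \<noteq> 0" "ff_mult f (ff_poly C' 0) \<psi> = ff_poly A' B'" using ex_denominator by blast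
    have CC: "C * C' \<noteq> 0" using C C' by simp
    have scale: "ff_poly (C * C') 0 = ff_mult f (ff_poly C 0) (ff_poly C' 0)" by (simp add: ff_mult_poly)
    have 1: "ff_mult f (ff_poly (C * C') 0) \<phi> = ff_poly (C' * A) (C' * B)"
    proof -
      have "ff_mult f (ff_poly (C * C') 0) \<phi> = ff_mult f (ff_poly C' 0) (ff_mult f (ff_poly C 0) \<phi>)"
        unfolding scale by (simp add: ff_mult_ac)
      then show ?thesis by (simp add: C(2) ff_mult_poly)
    qed
    have 2: "ff_mult f (ff_poly (C * C') 0) \<psi> = ff_poly (C * A') (C * B')"
      unfolding scale ff_mult_assoc C'(2) by (simp add: ff_mult_poly)
    have 3: "ff_mult f (ff_poly (C * C') 0) (ff_add \<phi> \<psi>) = ff_poly (C' * A + C * A') (C' * B + C * B')"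
      by (simp add: ff_mult_add 1 2 ff_add_poly)
    have "min (w (C' * A) (C' * B)) (w (C * A') (C * B')) \<le> w (C' * A + C * A') (C' * B + C * B')"
      using w denominator_nonzero[OF nz(1) CC 1] denominator_nonzero[OF nz(2) CC 2]
        denominator_nonzero[OF nz(3) CC 3] unfolding poly_valuation_def by blast
    then show ?thesis
      using fraction_valuation_eq[OF w nz(1) CC 1] fraction_valuation_eq[OF w nz(2) CC 2]
        fraction_valuation_eq[OF w nz(3) CC 3] by simp
  qed
  show "fraction_valuation w (ff_poly [:c:] 0) = 0" if "c \<noteq> 0" for c
    using fraction_valuation_poly[OF w, of "[:c:]" 0] w that unfolding poly_valuation_def by auto
  obtain \<psi> where \<psi>: "\<psi> \<noteq> ff_zero" "ff_mult f (ff_poly A2 B2) \<psi> = ff_poly 1 0"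
    using ff_inverse[of "ff_poly A2 B2"] t by (auto simp: ff_poly_eq_zero_iff)
  have nz: "ff_poly A1 B1 \<noteq> ff_zero" "ff_poly A2 B2 \<noteq> ff_zero" using t by (auto simp: ff_poly_eq_zero_iff)
  have one: "fraction_valuation w (ff_poly 1 0) = 0"
    using fraction_valuation_poly[OF w, of 1 0] w unfolding poly_valuation_def
    by (metis one_neq_zero one_pCons)
  have "fraction_valuation w (ff_mult f (ff_poly A1 B1) \<psi>) = 1"
    using mult[OF nz(1) \<psi>(1)] mult[OF nz(2) \<psi>(1)] \<psi>(2) one t
      fraction_valuation_poly[OF w t(1)] fraction_valuation_poly[OF w t(2)] by simp
  then show "\<exists>\<phi>. \<phi> \<noteq> ff_zero \<and> fraction_valuation w \<phi> = 1"
    using ff_mult_nonzero[OF nz(1) \<psi>(1)] by blast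
  show "fraction_valuation w ff_zero = 0" by (simp add: fraction_valuation_def)
qed

end

locale curve_valuation = odd_hyperelliptic f for f :: "'k::alg_closed_field poly" +
  fixes v :: "'k rat_fun \<Rightarrow> int"
  assumes normalised: "normalised_valuation f v"
begin

abbreviation w :: "'k poly \<Rightarrow> 'k poly \<Rightarrow> int" where
  "w A B \<equiv> v (ff_poly A B)"

lemma v_mult: "\<phi> \<noteq> ff_zero \<Longrightarrow> \<psi> \<noteq> ff_zero \<Longrightarrow> v (ff_mult f \<phi> \<psi>) = v \<phi> + v \<psi>"
  using normalised unfolding normalised_valuation_def by blast

lemma w_mult:
  "A \<noteq> 0 \<or> B \<noteq> 0 \<Longrightarrow> C \<noteq> 0 \<or> D \<noteq> 0 \<Longrightarrow> w (A * C + f * B * D) (A * D + B * C) = w A B + w C D"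
  using v_mult[of "ff_poly A B" "ff_poly C D"] by (auto simp: ff_mult_poly ff_poly_eq_zero_iff)

lemma w_add:
  "A \<noteq> 0 \<or> B \<noteq> 0 \<Longrightarrow> C \<noteq> 0 \<or> D \<noteq> 0 \<Longrightarrow> A + C \<noteq> 0 \<or> B + D \<noteq> 0 \<Longrightarrow>
   min (w A B) (w C D) \<le> w (A + C) (B + D)"
proof -
  assume nz: "A \<noteq> 0 \<or> B \<noteq> 0" "C \<noteq> 0 \<or> D \<noteq> 0" "A + C \<noteq> 0 \<or> B + D \<noteq> 0"
  have add: "\<forall>\<phi> \<psi>. \<phi> \<noteq> ff_zero \<longrightarrow> \<psi> \<noteq> ff_zero \<longrightarrow> ff_add \<phi> \<psi> \<noteq> ff_zero \<longrightarrow>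
      min (v \<phi>) (v \<psi>) \<le> v (ff_add \<phi> \<psi>)"
    using normalised unfolding normalised_valuation_def by blast
  show "min (w A B) (w C D) \<le> w (A + C) (B + D)"
    using add[rule_format, of "ff_poly A B" "ff_poly C D"] nz
    by (simp add: ff_add_poly ff_poly_eq_zero_iff)
qed

lemma w_const [simp]: "c \<noteq> 0 \<Longrightarrow> w [:c:] 0 = 0"
  using normalised unfolding normalised_valuation_def by blast

lemma w_zero [simp]: "w 0 0 = 0"
  using normalised ff_poly_eq_zero_iff[of 0 0] unfolding normalised_valuation_def by metis

lemma w_one [simp]: "w 1 0 = 0"
  using w_const[of 1] by (simp add: one_pCons)

lemma w_scale: "C \<noteq> 0 \<Longrightarrow> A \<noteq> 0 \<or> B \<noteq> 0 \<Longrightarrow> w (C * A) (C * B) = w C 0 + w A B"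
  using w_mult[of C 0 A B] by simp

lemma w_poly_mult: "C \<noteq> 0 \<Longrightarrow> A \<noteq> 0 \<Longrightarrow> w (C * A) 0 = w C 0 + w A 0"
  using w_scale[of C A 0] by simp

lemma w_poly_power: "C \<noteq> 0 \<Longrightarrow> w (C ^ n) 0 = int n * w C 0"
  by (induction n) (simp_all add: w_poly_mult algebra_simps)

lemma w_uminus: "w (- A) (- B) = w A B"
proof (cases "A \<noteq> 0 \<or> B \<noteq> 0")
  case True
  then show ?thesis using w_scale[of "[:-1:]" A B] by simp
qed simp

lemma w_diff:
  assumes "A \<noteq> 0 \<or> B \<noteq> 0" "C \<noteq> 0 \<or> D \<noteq> 0" "A \<noteq> C \<or> B \<noteq> D"
  shows "min (w A B) (w C D) \<le> w (A - C) (B - D)"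
  using w_add[of A B "- C" "- D"] w_uminus[of C D] assms by auto

lemma w_norm: "A \<noteq> 0 \<or> B \<noteq> 0 \<Longrightarrow> w (norm_poly f A B) 0 = w A B + w A (- B)"
  using v_mult[of "ff_poly A B" "ff_poly A (- B)"] by (auto simp: ff_mult_conj ff_poly_eq_zero_iff)

lemma v_fraction:
  "\<phi> \<noteq> ff_zero \<Longrightarrow> C \<noteq> 0 \<Longrightarrow> ff_mult f (ff_poly C 0) \<phi> = ff_poly A B \<Longrightarrow> v \<phi> = w A B - w C 0"
  using v_mult[of "ff_poly C 0" \<phi>] by (simp add: ff_poly_eq_zero_iff)

lemma w_add_eq:
  assumes "A \<noteq> 0 \<or> B \<noteq> 0" "C \<noteq> 0 \<or> D \<noteq> 0" "w A B < w C D"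
  shows "w (A + C) (B + D) = w A B" and "A + C \<noteq> 0 \<or> B + D \<noteq> 0"
proof -
  show nz: "A + C \<noteq> 0 \<or> B + D \<noteq> 0"
  proof (rule ccontr)
    assume "\<not> ?thesis"
    then have "A = - C" "B = - D" by (simp_all add: eq_neg_iff_add_eq_0)
    then show False using assms(3) w_uminus[of C D] by simp
  qed
  have "min (w (A + C) (B + D)) (w C D) \<le> w A B"
    using w_diff[of "A + C" "B + D" C D] assms nz by auto
  moreover have "w A B \<le> w (A + C) (B + D)" using w_add[OF assms(1,2) nz] assms(3) by simp
  ultimately show "w (A + C) (B + D) = w A B" using assms(3) by simp
qed

text \<open>
  Normalisation enters here: some function has value 1, and it is a quotient of two functions in
  \<open>K[x, y]\<close>.
\<close>

lemma w_multiple_dvd: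
  assumes "\<And>A B. A \<noteq> 0 \<or> B \<noteq> 0 \<Longrightarrow> e dvd c * w A B"
  shows "e dvd c"
proof -
  obtain \<phi> where \<phi>: "\<phi> \<noteq> ff_zero" "v \<phi> = 1"
    using normalised unfolding normalised_valuation_def by blast
  obtain A B C where C: "C \<noteq> 0" "ff_mult f (ff_poly C 0) \<phi> = ff_poly A B" using ex_denominator by blast
  have "e dvd c * w A B" "e dvd c * w C 0"
    using assms[of A B] assms[of C 0] denominator_nonzero[OF \<phi>(1) C] C(1) by auto
  then have "e dvd c * w A B - c * w C 0" by (rule dvd_diff)
  moreover have "c * w A B - c * w C 0 = c"
    using v_fraction[OF \<phi>(1) C] \<phi>(2) by (simp add: right_diff_distrib[symmetric])
  ultimately show ?thesis by simp
qed

lemma w_y_mult: "B \<noteq> 0 \<Longrightarrow> w 0 B = w B 0 + w 0 1"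
  using w_mult[of B 0 0 1] by simp

lemma w_f: "w f 0 = 2 * w 0 1"
  using w_mult[of 0 1 0 1] by simp

text \<open>
  When \<open>A\<close> and \<open>B y\<close> have different values, the smaller one is the value of \<open>A + B y\<close> and also of
  its conjugate \<open>A - B y\<close>. At the ramification points and at infinity the two values differ by
  parity, so there the norm determines the valuation.
\<close>

lemma w_norm_eq:
  assumes nz: "A \<noteq> 0 \<or> B \<noteq> 0" and ne: "A \<noteq> 0 \<Longrightarrow> B \<noteq> 0 \<Longrightarrow> w A 0 \<noteq> w 0 B"
  shows "w (norm_poly f A B) 0 = 2 * w A B"
proof -
  have B: "w 0 (- B) = w 0 B" using w_uminus[of 0 B] by simp
  have "w A (- B) = w A B"
  proof (cases "A = 0 \<or> B = 0")
    case True
    then show ?thesis using B by auto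
  next
    case False
    then consider "w A 0 < w 0 B" | "w 0 B < w A 0" using ne by linarith
    then show ?thesis
    proof cases
      case 1
      then show ?thesis using w_add_eq(1)[of A 0 0 B] w_add_eq(1)[of A 0 0 "- B"] B False by simp
    next
      case 2
      then show ?thesis using w_add_eq(1)[of 0 B A 0] w_add_eq(1)[of 0 "- B" A 0] B False by simp
    qed
  qed
  then show ?thesis using w_norm[OF nz] by simp
qed

end

lemma normalised_valuations_eqI:
  assumes "curve_valuation f v" "curve_valuation f v'"
    and eq: "\<And>A B. A \<noteq> 0 \<or> B \<noteq> 0 \<Longrightarrow> v (ff_poly A B) = v' (ff_poly A B)"
  shows "v = v'"
proof
  fix \<phi>
  interpret v: curve_valuation f v by fact
  interpret v': curve_valuation f v' by fact
  show "v \<phi> = v' \<phi>"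
  proof (cases "\<phi> = ff_zero")
    case True
    then show ?thesis using v.normalised v'.normalised unfolding normalised_valuation_def by metis
  next
    case False
    obtain A B C where C: "C \<noteq> 0" "ff_mult f (ff_poly C 0) \<phi> = ff_poly A B" using ex_denominator by blast
    then show ?thesis
      using v.v_fraction[OF False C] v'.v_fraction[OF False C] eq[of C 0] eq[of A B]
        v.denominator_nonzero[OF False C] by simp
  qed
qed

locale affine_valuation = curve_valuation f v for f :: "'k::alg_closed_field poly" and v +
  fixes a b :: 'k
  assumes on_curve: "b\<^sup>2 = poly f a"
    and centred: "centred_at v (Affine_Point a b)"
begin

abbreviation ev :: "'k poly \<Rightarrow> 'k poly \<Rightarrow> 'k" where
  "ev A B \<equiv> poly A a + poly B a * b"

lemma w_x_pos: "w [:- a, 1:] 0 > 0" and w_yb_pos: "w [:- b:] 1 > 0"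
  using centred by simp_all

text \<open>
  Centredness at an affine point only provides positive values for \<open>x - a\<close> and \<open>y - b\<close>. As constants
  have value 0, it follows that \<open>x\<close> and \<open>y\<close>, hence all of \<open>K[x, y]\<close>, have no poles at the point.
\<close>

lemma w_poly_nonneg: "w A 0 \<ge> 0"
proof (induction A rule: pCons_induct)
  case (pCons c A)
  have x: "w [:0, 1:] 0 \<ge> 0"
  proof (cases "a = 0")
    case False
    then show ?thesis using w_add[of "[:- a, 1:]" 0 "[:a:]" 0] w_x_pos by simp
  qed (use w_x_pos in simp)
  have xA: "pCons 0 A = [:0, 1:] * A" by simp
  have "w (pCons 0 A) 0 \<ge> 0"
  proof (cases "A = 0")
    case False
    show ?thesis unfolding xA using w_poly_mult[of "[:0, 1:]" A] False x pCons.IH by simp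
  qed simp
  then show ?case
    using w_add[of "[:c:]" 0 "pCons 0 A" 0] w_const[of c]
    by (cases "c = 0"; cases "A = 0") simp_all
qed simp

lemma w_y_nonneg: "w 0 1 \<ge> 0"
proof (cases "b = 0")
  case False
  then show ?thesis using w_add[of "[:- b:]" 1 "[:b:]" 0] w_yb_pos by simp
qed (use w_yb_pos in simp)

lemma w_nonneg: "w A B \<ge> 0"
proof (cases "A = 0 \<or> B = 0")
  case True
  then show ?thesis using w_poly_nonneg[of A] w_poly_nonneg[of B] w_y_nonneg w_y_mult[of B]
    by (cases "B = 0") auto
next
  case False
  then show ?thesis
    using w_add[of A 0 0 B] w_poly_nonneg[of A] w_poly_nonneg[of B] w_y_nonneg w_y_mult[of B] by simp
qed

text \<open>
  A function vanishing at \<open>(a, b)\<close> lies in the ideal generated by \<open>x - a\<close> and \<open>y - b\<close>.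
\<close>

lemma w_pos_of_ev:
  assumes nz: "A \<noteq> 0 \<or> B \<noteq> 0" and ev: "ev A B = 0"
  shows "w A B > 0"
proof -
  have pos_add: "A1 + A2 = 0 \<and> B1 + B2 = 0 \<or> w (A1 + A2) (B1 + B2) > 0"
    if "A1 = 0 \<and> B1 = 0 \<or> w A1 B1 > 0" "A2 = 0 \<and> B2 = 0 \<or> w A2 B2 > 0" for A1 A2 B1 B2
  proof (cases "A1 = 0 \<and> B1 = 0 \<or> A2 = 0 \<and> B2 = 0 \<or> A1 + A2 = 0 \<and> B1 + B2 = 0")
    case False
    then show ?thesis using w_add[of A1 B1 A2 B2] that by auto
  qed (use that in auto)
  obtain A' \<alpha> where A': "A = [:- a, 1:] * A' + [:\<alpha>:]"
    using synthetic_div_correct'[of a A] by metis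
  obtain B' \<beta> where B': "B = [:- a, 1:] * B' + [:\<beta>:]"
    using synthetic_div_correct'[of a B] by metis
  have \<alpha>: "\<alpha> = - (\<beta> * b)" using ev by (simp add: A' B' eq_neg_iff_add_eq_0)
  have 1: "[:- a, 1:] * A' = 0 \<and> [:- a, 1:] * B' = 0 \<or> w ([:- a, 1:] * A') ([:- a, 1:] * B') > 0"
  proof (cases "A' = 0 \<and> B' = 0")
    case False
    then have "w ([:- a, 1:] * A') ([:- a, 1:] * B') = w [:- a, 1:] 0 + w A' B'"
      by (intro w_scale) auto
    then show ?thesis using w_x_pos w_nonneg[of A' B'] by linarith
  qed simp
  have 2: "[:\<beta>:] * [:- b:] = 0 \<and> [:\<beta>:] = 0 \<or> w ([:\<beta>:] * [:- b:]) [:\<beta>:] > 0"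
    using w_scale[of "[:\<beta>:]" "[:- b:]" 1] w_yb_pos by (cases "\<beta> = 0") simp_all
  have "[:- a, 1:] * A' + [:\<beta>:] * [:- b:] = A" by (simp add: A' \<alpha>)
  then show ?thesis using pos_add[OF 1 2] nz B' by auto
qed

lemma w_pos_iff:
  assumes "A \<noteq> 0 \<or> B \<noteq> 0" shows "w A B > 0 \<longleftrightarrow> ev A B = 0"
proof
  assume pos: "w A B > 0"
  show "ev A B = 0"
  proof (rule ccontr)
    define c where "c = ev A B"
    assume "ev A B \<noteq> 0"
    then have c: "c \<noteq> 0" by (simp add: c_def)
    have "A \<noteq> [:c:] \<or> B \<noteq> 0" using pos c by auto
    then have "w (A - [:c:]) B > 0"
      using w_pos_of_ev[of "A - [:c:]" B] by (simp add: c_def)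
    moreover have "w A B = 0"
      using w_add_eq[of "[:c:]" 0 "A - [:c:]" B] \<open>A \<noteq> [:c:] \<or> B \<noteq> 0\<close> c calculation by simp
    ultimately show False using pos by simp
  qed
qed (rule w_pos_of_ev[OF assms])

lemma w_eq_0_iff: "A \<noteq> 0 \<or> B \<noteq> 0 \<Longrightarrow> w A B = 0 \<longleftrightarrow> ev A B \<noteq> 0"
  using w_pos_iff[of A B] w_nonneg[of A B] by auto

lemma w_poly:
  assumes "A \<noteq> 0" shows "w A 0 = w [:- a, 1:] 0 * int (Polynomial.order a A)"
proof -
  obtain q where q: "A = [:- a, 1:] ^ Polynomial.order a A * q" "\<not> [:- a, 1:] dvd q"
    using order_decomp[OF assms] by blast
  then have "poly q a \<noteq> 0" "q \<noteq> 0" by (auto simp: poly_eq_0_iff_dvd)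
  then have "w q 0 = 0" by (simp add: w_eq_0_iff)
  then show ?thesis
    using arg_cong[OF q(1), of "\<lambda>p. w p 0"] \<open>q \<noteq> 0\<close> w_poly_mult[of "[:- a, 1:] ^ Polynomial.order a A" q]
    by (simp add: w_poly_power)
qed

end

section \<open>Uniqueness of the valuation at a point\<close>

lemma common_root_decomp:
  fixes A B :: "'a::field poly"
  assumes "A \<noteq> 0 \<or> B \<noteq> 0"
  shows "\<exists>m A' B'. A = [:- a, 1:] ^ m * A' \<and> B = [:- a, 1:] ^ m * B' \<and> (poly A' a \<noteq> 0 \<or> poly B' a \<noteq> 0)"
  using assms
proof (induction "degree A + degree B" arbitrary: A B rule: less_induct)
  case less
  show ?case
  proof (cases "poly A a = 0 \<and> poly B a = 0")
    case True
    then obtain A1 B1 where AB: "A = [:- a, 1:] * A1" "B = [:- a, 1:] * B1"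
      by (auto simp: poly_eq_0_iff_dvd elim!: dvdE)
    have nz: "A1 \<noteq> 0 \<or> B1 \<noteq> 0" using less.prems AB by auto
    have "degree ([:- a, 1:] * p) = (if p = 0 then 0 else Suc (degree p))" for p :: "'a poly"
      by (simp add: degree_mult_eq del: mult_pCons_left)
    then have "degree A1 + degree B1 < degree A + degree B" using nz unfolding AB by auto
    from less.hyps[OF this nz] obtain m A' B'
      where "A1 = [:- a, 1:] ^ m * A'" "B1 = [:- a, 1:] ^ m * B'" "poly A' a \<noteq> 0 \<or> poly B' a \<noteq> 0" by blast
    then show ?thesis by (intro exI[of _ "Suc m"] exI[of _ A'] exI[of _ B']) (simp only: AB power_Suc mult.assoc simp_thms)
  next
    case False
    then show ?thesis by (intro exI[of _ 0] exI[of _ A] exI[of _ B]) simp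
  qed
qed

context affine_valuation
begin

text \<open>
  At a point with \<open>b \<noteq> 0\<close>, after splitting off powers of \<open>x - a\<close> the function or its conjugate does not
  vanish at the point. In the second case the function has the same value as its norm. So the value of
  \<open>x - a\<close> determines the valuation.
\<close>

lemma w_unramified:
  assumes b: "b \<noteq> 0"
    and AB: "A = [:- a, 1:] ^ m * A'" "B = [:- a, 1:] ^ m * B'" and nz: "poly A' a \<noteq> 0 \<or> poly B' a \<noteq> 0"
  shows "w A B = w [:- a, 1:] 0 *
    int (m + (if ev A' B' = 0 then Polynomial.order a (norm_poly f A' B') else 0))"
proof -
  have nz': "A' \<noteq> 0 \<or> B' \<noteq> 0" using nz by auto
  have "w A B = int m * w [:- a, 1:] 0 + w A' B'"
    unfolding AB using w_scale[of "[:- a, 1:] ^ m" A' B'] nz' by (simp add: w_poly_power)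
  moreover have "w A' B' = w [:- a, 1:] 0 * int (Polynomial.order a (norm_poly f A' B'))" if ev: "ev A' B' = 0"
  proof -
    have "ev A' (- B') \<noteq> 0"
    proof
      assume "ev A' (- B') = 0"
      then have "2 * poly A' a = 0" "2 * (poly B' a * b) = 0" using ev by (simp_all add: algebra_simps)
      then show False using nz b two_nonzero by auto
    qed
    then have "w A' (- B') = 0" using w_eq_0_iff[of A' "- B'"] nz' by auto
    then show ?thesis
      using w_norm[OF nz'] w_poly[OF norm_poly_nonzero[OF nz']] by simp
  qed
  moreover have "w A' B' = 0" if "ev A' B' \<noteq> 0" using w_eq_0_iff[OF nz'] that by simp
  ultimately show ?thesis by (simp add: algebra_simps)
qed

lemma w_x_unramified:
  assumes "b \<noteq> 0" shows "w [:- a, 1:] 0 = 1"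
proof -
  have "w [:- a, 1:] 0 dvd 1"
  proof (rule w_multiple_dvd)
    fix A B :: "'k poly" assume "A \<noteq> 0 \<or> B \<noteq> 0"
    then obtain m A' B' where "A = [:- a, 1:] ^ m * A'" "B = [:- a, 1:] ^ m * B'" "poly A' a \<noteq> 0 \<or> poly B' a \<noteq> 0"
      using common_root_decomp by blast
    from w_unramified[OF assms this] show "w [:- a, 1:] 0 dvd 1 * w A B" by simp
  qed
  then show ?thesis using w_x_pos by simp
qed

lemma w_x_ramified_y:
  assumes "b = 0" shows "w [:- a, 1:] 0 = 2 * w 0 1"
  using simple_roots[of a] on_curve assms w_poly[of f] w_f by simp

text \<open>
  At a point with \<open>b = 0\<close> the values of polynomials in \<open>x\<close> are even multiples of the value of \<open>y\<close>, so
  that \<open>A\<close> and \<open>B y\<close> never have the same value.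
\<close>

lemma w_ramified:
  assumes b: "b = 0" and nz: "A \<noteq> 0 \<or> B \<noteq> 0"
  shows "w A B = w 0 1 * int (Polynomial.order a (norm_poly f A B))"
proof -
  have "w A 0 \<noteq> w 0 B" if "A \<noteq> 0" "B \<noteq> 0"
  proof
    assume "w A 0 = w 0 B"
    then have "w 0 1 * (2 * int (Polynomial.order a A)) = w 0 1 * (2 * int (Polynomial.order a B) + 1)"
      using w_poly[OF that(1)] w_poly[OF that(2)] w_y_mult[OF that(2)] w_x_ramified_y[OF b]
      by (simp add: algebra_simps)
    moreover have "w 0 1 \<noteq> 0" using w_x_pos w_x_ramified_y[OF b] by auto
    ultimately show False by simp presburger
  qed
  then have "2 * w A B = w [:- a, 1:] 0 * int (Polynomial.order a (norm_poly f A B))"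
    using w_norm_eq[OF nz] w_poly[OF norm_poly_nonzero[OF nz]] by simp
  then show ?thesis using w_x_ramified_y[OF b] by simp
qed

lemma w_y_ramified:
  assumes "b = 0" shows "w 0 1 = 1"
proof -
  have "w 0 1 dvd 1 * w A B" if "A \<noteq> 0 \<or> B \<noteq> 0" for A B
    unfolding w_ramified[OF assms that] by simp
  then have "w 0 1 dvd 1" by (rule w_multiple_dvd)
  then show ?thesis using w_yb_pos assms by simp
qed

lemma w_x: "w [:- a, 1:] 0 = (if b = 0 then 2 else 1)"
  using w_x_unramified w_x_ramified_y w_y_ramified by simp

end

lemma affine_valuation_unique:
  assumes "affine_valuation f v a b" "affine_valuation f v' a b"
  shows "v = v'"
proof -
  interpret v: affine_valuation f v a b by fact
  interpret v': affine_valuation f v' a b by fact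
  show ?thesis
  proof (rule normalised_valuations_eqI)
    fix A B :: "'a poly" assume nz: "A \<noteq> 0 \<or> B \<noteq> 0"
    show "v (ff_poly A B) = v' (ff_poly A B)"
    proof (cases "b = 0")
      case True
      then show ?thesis
        using v.w_ramified[OF True nz] v'.w_ramified[OF True nz] v.w_y_ramified v'.w_y_ramified by simp
    next
      case False
      obtain m A' B' where "A = [:- a, 1:] ^ m * A'" "B = [:- a, 1:] ^ m * B'" "poly A' a \<noteq> 0 \<or> poly B' a \<noteq> 0"
        using common_root_decomp[OF nz] by blast
      from v.w_unramified[OF False this] v'.w_unramified[OF False this] False
      show ?thesis by (simp add: v.w_x_unramified v'.w_x_unramified)
    qed
  qed (intro_locales)
qed

locale infinite_valuation = curve_valuation f v for f :: "'k::alg_closed_field poly" and v +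
  assumes centred: "centred_at v Infinite_Point"
begin

lemma w_x_neg: "w [:0, 1:] 0 < 0"
  using centred by simp

lemma w_poly_degree:
  assumes "A \<noteq> 0" shows "w A 0 = w [:0, 1:] 0 * int (degree A)"
  using assms
proof (induction A rule: pCons_induct)
  case (pCons c A)
  show ?case
  proof (cases "A = 0")
    case True
    then show ?thesis using pCons by simp
  next
    case False
    have xA: "pCons 0 A = [:0, 1:] * A" by simp
    have x: "w (pCons 0 A) 0 = w [:0, 1:] 0 * int (Suc (degree A))"
      unfolding xA using w_poly_mult[of "[:0, 1:]" A] False pCons.IH by (simp add: algebra_simps)
    then have "w (pCons 0 A) 0 < 0" using w_x_neg by (simp add: mult_neg_pos)
    then have "w (pCons c A) 0 = w (pCons 0 A) 0"
      using w_add_eq(1)[of "pCons 0 A" 0 "[:c:]" 0] False by (cases "c = 0") simp_all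
    then show ?thesis using x False by simp
  qed
qed simp

lemma w_degree:
  assumes nz: "A \<noteq> 0 \<or> B \<noteq> 0"
  shows "2 * w A B = w [:0, 1:] 0 * int (degree (norm_poly f A B))"
proof -
  have "w A 0 \<noteq> w 0 B" if "A \<noteq> 0" "B \<noteq> 0"
  proof
    assume "w A 0 = w 0 B"
    then have "w [:0, 1:] 0 * (2 * int (degree A)) = w [:0, 1:] 0 * (2 * int (degree B) + int (degree f))"
      using w_poly_degree[OF that(1)] w_poly_degree[OF that(2)] w_y_mult[OF that(2)] w_f w_poly_degree[of f]
      by (simp add: algebra_simps)
    then have "2 * int (degree A) = 2 * int (degree B) + int (degree f)" using w_x_neg by simp
    then show False using odd_degree by presburger
  qed
  then show ?thesis
    using w_norm_eq[OF nz] w_poly_degree[OF norm_poly_nonzero[OF nz]] by simp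
qed

text \<open>
  Normalisation makes the value of \<open>x\<close> a divisor of 2, and it is even because \<open>y\<^sup>2 = f\<close> has odd degree.
\<close>

lemma w_x_infinite: "w [:0, 1:] 0 = -2"
proof -
  define e where "e = w [:0, 1:] 0"
  have "e dvd 2" unfolding e_def by (rule w_multiple_dvd) (simp only: w_degree dvd_triv_left)
  moreover have "even e"
  proof -
    have "even (e * int (degree f))" using w_f w_poly_degree[of f] by (simp add: e_def)
    then show ?thesis using odd_degree by simp
  qed
  moreover have "e < 0" using w_x_neg by (simp add: e_def)
  ultimately have "- e dvd 2" "2 dvd - e" "- e > 0" by simp_all
  then have "- e = 2" by (intro zdvd_antisym_nonneg) auto
  then show ?thesis by (simp add: e_def)
qed

lemma w_eq_degree:
  "A \<noteq> 0 \<or> B \<noteq> 0 \<Longrightarrow> w A B = - int (degree (norm_poly f A B))"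
  using w_degree[of A B] w_x_infinite by simp

end

lemma infinite_valuation_unique:
  assumes "infinite_valuation f v" "infinite_valuation f v'"
  shows "v = v'"
proof -
  interpret v: infinite_valuation f v by fact
  interpret v': infinite_valuation f v' by fact
  show ?thesis
    by (rule normalised_valuations_eqI) (intro_locales, simp add: v.w_eq_degree v'.w_eq_degree)
qed

section \<open>Existence of the valuation at a point\<close>

lemma order_add_ge:
  fixes p q :: "'a::field poly"
  assumes "p \<noteq> 0" "q \<noteq> 0" "p + q \<noteq> 0"
  shows "min (Polynomial.order a p) (Polynomial.order a q) \<le> Polynomial.order a (p + q)"
proof -
  let ?n = "min (Polynomial.order a p) (Polynomial.order a q)"
  have "[:- a, 1:] ^ ?n dvd p" "[:- a, 1:] ^ ?n dvd q" by (simp_all add: order_divides)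
  then have "[:- a, 1:] ^ ?n dvd p + q" by (rule dvd_add)
  then show ?thesis using assms(3) by (simp add: order_divides)
qed

lemma order_diff_eq_min:
  fixes p q :: "'a::field poly"
  assumes "p \<noteq> 0" "q \<noteq> 0" "Polynomial.order a p \<noteq> Polynomial.order a q"
  shows "Polynomial.order a (p - q) = min (Polynomial.order a p) (Polynomial.order a q)"
proof -
  have ne: "p - q \<noteq> 0" using assms(3) by auto
  have "min (Polynomial.order a p) (Polynomial.order a q) \<le> Polynomial.order a (p - q)"
    using order_add_ge[of p "- q" a] assms ne by simp
  moreover have "min (Polynomial.order a (p - q)) (Polynomial.order a q) \<le> Polynomial.order a p"
    using order_add_ge[of "p - q" q a] assms ne by simp
  moreover have "min (Polynomial.order a (p - q)) (Polynomial.order a p) \<le> Polynomial.order a q"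
    using order_add_ge[of "q - p" p a] assms ne order_uminus[of a "p - q"] by simp
  ultimately show ?thesis using assms(3) by (auto simp: min_def split: if_splits)
qed

lemma order_square: "p \<noteq> 0 \<Longrightarrow> Polynomial.order a (p\<^sup>2) = 2 * Polynomial.order a (p :: 'a::field poly)"
  by (simp add: power2_eq_square order_mult)

context odd_hyperelliptic
begin

text \<open>
  The orders of \<open>A\<^sup>2\<close> and \<open>f B\<^sup>2\<close> at a root of \<open>f\<close> have different parity. This turns the order of the
  norm into the minimum of two orders, which gives the ultrametric inequality below.
\<close>

lemma order_norm_ramified:
  assumes root: "poly f a = 0" and nz: "A \<noteq> 0 \<or> B \<noteq> 0"
  shows "n \<le> Polynomial.order a (norm_poly f A B) \<longleftrightarrow>
    (A \<noteq> 0 \<longrightarrow> n \<le> 2 * Polynomial.order a A) \<and> (B \<noteq> 0 \<longrightarrow> n \<le> 2 * Polynomial.order a B + 1)"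
proof -
  have fB: "Polynomial.order a (f * B\<^sup>2) = 2 * Polynomial.order a B + 1" if "B \<noteq> 0"
    using that simple_roots[OF root] by (simp add: order_mult order_square)
  consider "A = 0" | "B = 0" | "A \<noteq> 0" "B \<noteq> 0" by blast
  then show ?thesis
  proof cases
    case 3
    have "2 * Polynomial.order a A \<noteq> 2 * Polynomial.order a B + 1" by presburger
    then have "Polynomial.order a (norm_poly f A B) = min (2 * Polynomial.order a A) (2 * Polynomial.order a B + 1)"
      unfolding norm_poly_def using order_diff_eq_min[of "A\<^sup>2" "f * B\<^sup>2" a] 3 by (simp add: fB order_square)
    then show ?thesis using 3 by simp
  qed (use nz fB in \<open>simp_all add: norm_poly_def order_square\<close>)
qed

lemma poly_valuation_ramified:
  assumes root: "poly f a = 0"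
  shows "poly_valuation (\<lambda>A B. int (Polynomial.order a (norm_poly f A B)))"
  unfolding poly_valuation_def
proof (intro conjI allI impI)
  fix A B C D :: "'k poly" assume nz: "A \<noteq> 0 \<or> B \<noteq> 0" "C \<noteq> 0 \<or> D \<noteq> 0"
  show "int (Polynomial.order a (norm_poly f (A * C + f * B * D) (A * D + B * C))) =
      int (Polynomial.order a (norm_poly f A B)) + int (Polynomial.order a (norm_poly f C D))"
    using norm_poly_nonzero[OF nz(1)] norm_poly_nonzero[OF nz(2)] by (simp add: norm_poly_mult order_mult)
  assume nz': "A + C \<noteq> 0 \<or> B + D \<noteq> 0"
  define n where "n = min (Polynomial.order a (norm_poly f A B)) (Polynomial.order a (norm_poly f C D))"
  have "n \<le> Polynomial.order a (norm_poly f A B)" "n \<le> Polynomial.order a (norm_poly f C D)"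
    by (simp_all add: n_def)
  then have AB: "(A \<noteq> 0 \<longrightarrow> n \<le> 2 * Polynomial.order a A)" "(B \<noteq> 0 \<longrightarrow> n \<le> 2 * Polynomial.order a B + 1)"
    and CD: "(C \<noteq> 0 \<longrightarrow> n \<le> 2 * Polynomial.order a C)" "(D \<noteq> 0 \<longrightarrow> n \<le> 2 * Polynomial.order a D + 1)"
    unfolding order_norm_ramified[OF root nz(1)] order_norm_ramified[OF root nz(2)] by simp_all
  have "n \<le> 2 * Polynomial.order a (A + C)" if "A + C \<noteq> 0"
    using AB(1) CD(1) order_add_ge[of A C a] that by (cases "A = 0"; cases "C = 0") auto
  moreover have "n \<le> 2 * Polynomial.order a (B + D) + 1" if "B + D \<noteq> 0"
    using AB(2) CD(2) order_add_ge[of B D a] that by (cases "B = 0"; cases "D = 0") auto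
  ultimately have "n \<le> Polynomial.order a (norm_poly f (A + C) (B + D))"
    unfolding order_norm_ramified[OF root nz'] by blast
  then show "min (int (Polynomial.order a (norm_poly f A B))) (int (Polynomial.order a (norm_poly f C D)))
      \<le> int (Polynomial.order a (norm_poly f (A + C) (B + D)))"
    by (simp add: n_def)
next
  fix c :: 'k assume "c \<noteq> 0"
  then show "int (Polynomial.order a (norm_poly f [:c:] 0)) = 0"
    by (simp add: norm_poly_def order_0I)
qed

lemma affine_valuation_exists_ramified:
  assumes root: "poly f a = 0"
  shows "\<exists>v. affine_valuation f v a 0"
proof -
  let ?w = "\<lambda>A B. int (Polynomial.order a (norm_poly f A B))"
  note w = poly_valuation_ramified[OF root]
  have y: "?w 0 1 = 1" using simple_roots[OF root] by (simp add: norm_poly_def)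
  have x: "?w [:- a, 1:] 0 > 0"
    by (simp add: norm_poly_def order_gt_0_iff)
  have "?w 0 1 = ?w 1 0 + 1" using y by (simp add: norm_poly_def)
  then have "normalised_valuation f (fraction_valuation ?w)"
    by (intro normalised_fraction_valuation[OF w, of 0 1 1 0]) simp_all
  moreover have "centred_at (fraction_valuation ?w) (Affine_Point a 0)"
    using fraction_valuation_poly[OF w, of "[:- a, 1:]" 0] fraction_valuation_poly[OF w, of 0 1] x y by simp
  ultimately show ?thesis using root
    by (intro exI[of _ "fraction_valuation ?w"]) (unfold_locales; simp)
qed

lemma poly_valuation_infinite:
  "poly_valuation (\<lambda>A B. - int (degree (norm_poly f A B)))"
  unfolding poly_valuation_def
proof (intro conjI allI impI)
  fix A B C D :: "'k poly" assume nz: "A \<noteq> 0 \<or> B \<noteq> 0" "C \<noteq> 0 \<or> D \<noteq> 0"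
  show "- int (degree (norm_poly f (A * C + f * B * D) (A * D + B * C))) =
      - int (degree (norm_poly f A B)) + - int (degree (norm_poly f C D))"
    using norm_poly_nonzero[OF nz(1)] norm_poly_nonzero[OF nz(2)] by (simp add: norm_poly_mult degree_mult_eq)
  assume nz': "A + C \<noteq> 0 \<or> B + D \<noteq> 0"
  define n where "n = max (degree (norm_poly f A B)) (degree (norm_poly f C D))"
  have le_iff: "degree (norm_poly f A B) \<le> n \<longleftrightarrow>
      (A \<noteq> 0 \<longrightarrow> 2 * degree A \<le> n) \<and> (B \<noteq> 0 \<longrightarrow> degree f + 2 * degree B \<le> n)"
    if "A \<noteq> 0 \<or> B \<noteq> 0" for A B
    unfolding degree_norm_poly[OF that] by simp
  have "degree (norm_poly f A B) \<le> n" "degree (norm_poly f C D) \<le> n" by (simp_all add: n_def)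
  then have AB: "(A \<noteq> 0 \<longrightarrow> 2 * degree A \<le> n)" "(B \<noteq> 0 \<longrightarrow> degree f + 2 * degree B \<le> n)"
    and CD: "(C \<noteq> 0 \<longrightarrow> 2 * degree C \<le> n)" "(D \<noteq> 0 \<longrightarrow> degree f + 2 * degree D \<le> n)"
    unfolding le_iff[OF nz(1)] le_iff[OF nz(2)] by simp_all
  have "2 * degree (A + C) \<le> n" if "A + C \<noteq> 0"
    using AB(1) CD(1) degree_add_le_max[of A C] by (cases "A = 0"; cases "C = 0") auto
  moreover have "degree f + 2 * degree (B + D) \<le> n" if "B + D \<noteq> 0"
    using AB(2) CD(2) degree_add_le_max[of B D] that by (cases "B = 0"; cases "D = 0") auto
  ultimately have "degree (norm_poly f (A + C) (B + D)) \<le> n"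
    unfolding le_iff[OF nz'] by blast
  then have "degree (norm_poly f (A + C) (B + D)) \<le> max (degree (norm_poly f A B)) (degree (norm_poly f C D))"
    by (simp add: n_def)
  then show "min (- int (degree (norm_poly f A B))) (- int (degree (norm_poly f C D)))
      \<le> - int (degree (norm_poly f (A + C) (B + D)))" by simp
next
  fix c :: 'k assume "c \<noteq> 0"
  then show "- int (degree (norm_poly f [:c:] 0)) = 0"
    by (simp add: norm_poly_def power2_eq_square)
qed

text \<open>
  If \<open>f\<close> has degree \<open>2 g + 1\<close>, then \<open>x\<^sup>g / y\<close> is a uniformiser at infinity.
\<close>

lemma infinite_valuation_exists: "\<exists>v. infinite_valuation f v"
proof -
  let ?w = "\<lambda>A B. - int (degree (norm_poly f A B))"
  note w = poly_valuation_infinite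
  obtain g where g: "degree f = 2 * g + 1" using odd_degree by (auto elim: oddE)
  let ?t = "monom 1 g :: 'k poly"
  have t: "?t \<noteq> 0" by (simp add: monom_eq_0_iff)
  have "?w ?t 0 = ?w 0 1 + 1"
    by (simp add: norm_poly_def degree_power_eq t degree_monom_eq g)
  then have "normalised_valuation f (fraction_valuation ?w)"
    using t by (intro normalised_fraction_valuation[OF w, of ?t 0 0 1]) simp_all
  moreover have "?w [:0, 1:] 0 < 0" by (simp add: norm_poly_def degree_power_eq)
  then have "centred_at (fraction_valuation ?w) Infinite_Point"
    using fraction_valuation_poly[OF w, of "[:0, 1:]" 0] by simp
  ultimately show ?thesis
    by (intro exI[of _ "fraction_valuation ?w"]) (unfold_locales; simp)
qed

end

text \<open>
  The coefficient of index \<open>n > 0\<close> in \<open>s\<^sup>2 = F\<close> is linear in the \<open>n\<close>-th coefficient of \<open>s\<close>, with the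
  factor \<open>2 b\<close>.
\<close>

function fps_sqrt_coeff :: "'a::field fps \<Rightarrow> 'a \<Rightarrow> nat \<Rightarrow> 'a" where
  "fps_sqrt_coeff F b n = (if n = 0 then b else
     (fps_nth F n - (\<Sum>i\<in>{1..<n}. fps_sqrt_coeff F b i * fps_sqrt_coeff F b (n - i))) / (2 * b))"
  by auto
termination by (relation "Wellfounded.measure (\<lambda>(F, b, n). n)") auto

declare fps_sqrt_coeff.simps [simp del]

lemma fps_sqrt_exists:
  fixes F :: "'a::field fps"
  assumes "(2::'a) \<noteq> 0" "b \<noteq> 0" "b\<^sup>2 = fps_nth F 0"
  shows "\<exists>s. s * s = F \<and> fps_nth s 0 = b"
proof -
  define c where "c = fps_sqrt_coeff F b"
  have c0: "c 0 = b" by (simp add: c_def fps_sqrt_coeff.simps)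
  have "(\<Sum>i=0..n. c i * c (n - i)) = fps_nth F n" for n
  proof (cases "n = 0")
    case True
    then show ?thesis using assms(3) c0 by (simp add: power2_eq_square)
  next
    case False
    have "{0..n} = insert 0 (insert n {1..<n})" using False by auto
    then have "(\<Sum>i=0..n. c i * c (n - i)) = 2 * b * c n + (\<Sum>i\<in>{1..<n}. c i * c (n - i))"
      using False c0 by simp
    moreover have "2 * b * c n = fps_nth F n - (\<Sum>i\<in>{1..<n}. c i * c (n - i))"
      using False assms(1,2) by (subst c_def) (simp add: fps_sqrt_coeff.simps[of F b n] c_def)
    ultimately show ?thesis by simp
  qed
  then have "Abs_fps c * Abs_fps c = F" by (simp add: fps_eq_iff fps_mult_nth)
  then show ?thesis using c0 by (intro exI[of _ "Abs_fps c"]) simp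
qed

context odd_hyperelliptic
begin

text \<open>
  With \<open>t = x - a\<close>, the function \<open>y\<close> is mapped to the power series in \<open>t\<close> that is the square root of
  \<open>f(a + t)\<close> with constant coefficient \<open>b\<close>; the valuation is the subdegree of the image.
\<close>

lemma affine_valuation_exists_unramified:
  assumes on_curve: "b\<^sup>2 = poly f a" and b: "b \<noteq> 0"
  shows "\<exists>v. affine_valuation f v a b"
proof -
  \<comment> \<open>the polynomial \<open>p(a + t)\<close> as a power series in \<open>t\<close>\<close>
  define h where "h p = fps_of_poly (pcompose p [:a, 1:])" for p :: "'k poly"
  have h_mult: "h (p * q) = h p * h q" and h_add: "h (p + q) = h p + h q"
    and h_diff: "h (p - q) = h p - h q" for p q
    by (simp_all add: h_def pcompose_mult pcompose_add pcompose_diff fps_of_poly_mult fps_of_poly_add fps_of_poly_diff)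
  have h_0 [simp]: "h 0 = 0" and h_const: "h [:c:] = fps_const c" for c
    by (simp_all add: h_def fps_of_poly_const)
  have h_1 [simp]: "h 1 = 1" using h_const[of 1] by (simp add: one_pCons)
  have h_nth: "fps_nth (h p) 0 = poly p a" for p
  proof -
    have "fps_nth (h p) 0 = poly (pcompose p [:a, 1:]) 0" by (simp add: h_def poly_0_coeff_0)
    then show ?thesis by (simp add: poly_pcompose)
  qed
  have h_eq_0: "h p = 0 \<Longrightarrow> p = 0" for p
    using pcompose_eq_0[of p "[:a, 1:]"] by (simp add: h_def)
  obtain s where s: "s * s = h f" "fps_nth s 0 = b"
    using fps_sqrt_exists[of b "h f"] two_nonzero b on_curve by (auto simp: h_nth)
  define E where "E A B = h A + h B * s" for A B
  have E_mult: "E (A * C + f * B * D) (A * D + B * C) = E A B * E C D" for A B C D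
    by (simp add: E_def h_mult h_add s(1)[symmetric] algebra_simps)
  have E_add: "E (A + C) (B + D) = E A B + E C D" for A B C D
    by (simp add: E_def h_add algebra_simps)
  have E_nz: "E A B \<noteq> 0" if "A \<noteq> 0 \<or> B \<noteq> 0" for A B
  proof
    assume "E A B = 0"
    moreover have "h (norm_poly f A B) = E A B * (h A - h B * s)"
      by (simp add: E_def norm_poly_def h_mult h_diff power2_eq_square s(1)[symmetric] algebra_simps)
    ultimately have "h (norm_poly f A B) = 0" by simp
    then show False using h_eq_0 norm_poly_nonzero[OF that] by blast
  qed
  let ?w = "\<lambda>A B. int (subdegree (E A B))"
  have w: "poly_valuation ?w"
    unfolding poly_valuation_def
  proof (intro conjI allI impI)
    fix A B C D :: "'k poly" assume nz: "A \<noteq> 0 \<or> B \<noteq> 0" "C \<noteq> 0 \<or> D \<noteq> 0"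
    show "?w (A * C + f * B * D) (A * D + B * C) = ?w A B + ?w C D"
      using E_nz[OF nz(1)] E_nz[OF nz(2)] by (simp add: E_mult)
    assume nz': "A + C \<noteq> 0 \<or> B + D \<noteq> 0"
    have "min (subdegree (E A B)) (subdegree (E C D)) \<le> subdegree (E A B + E C D)"
      using E_nz[OF nz'] unfolding E_add by (intro subdegree_add_ge') 
    then show "min (?w A B) (?w C D) \<le> ?w (A + C) (B + D)" by (simp add: E_add)
  next
    fix c :: 'k assume "c \<noteq> 0"
    then show "?w [:c:] 0 = 0" by (simp add: E_def h_const)
  qed
  have x: "?w [:- a, 1:] 0 = 1"
  proof -
    have "E [:- a, 1:] 0 = fps_X" by (simp add: E_def h_def pcompose_pCons fps_of_poly_fps_X)
    then show ?thesis by simp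
  qed
  have y: "?w [:- b:] 1 > 0"
  proof -
    have "fps_nth (E [:- b:] 1) 0 = 0" by (simp add: E_def h_const s(2))
    moreover have "E [:- b:] 1 \<noteq> 0" by (rule E_nz) simp
    ultimately have "subdegree (E [:- b:] 1) \<noteq> 0" by (simp add: subdegree_eq_0_iff)
    then show ?thesis by simp
  qed
  have "?w [:- a, 1:] 0 = ?w 1 0 + 1" using x by (simp add: E_def)
  then have "normalised_valuation f (fraction_valuation ?w)"
    by (intro normalised_fraction_valuation[OF w, of "[:- a, 1:]" 0 1 0]) simp_all
  moreover have "centred_at (fraction_valuation ?w) (Affine_Point a b)"
    using fraction_valuation_poly[OF w, of "[:- a, 1:]" 0] fraction_valuation_poly[OF w, of "[:- b:]" 1] x y by simp
  ultimately show ?thesis using on_curve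
    by (intro exI[of _ "fraction_valuation ?w"]) (unfold_locales; simp)
qed

lemma affine_valuation_ord_at:
  assumes on_curve: "b\<^sup>2 = poly f a"
  shows "affine_valuation f (ord_at f (Affine_Point a b)) a b"
proof -
  have "\<exists>v. affine_valuation f v a b"
    using affine_valuation_exists_unramified[OF on_curve] affine_valuation_exists_ramified[of a] on_curve
    by (cases "b = 0") auto
  then obtain v where v: "affine_valuation f v a b" by blast
  have iff: "normalised_valuation f v' \<and> centred_at v' (Affine_Point a b) \<longleftrightarrow> affine_valuation f v' a b" for v'
  proof
    assume "normalised_valuation f v' \<and> centred_at v' (Affine_Point a b)"
    then show "affine_valuation f v' a b" using on_curve by unfold_locales auto
  next
    assume "affine_valuation f v' a b"
    then interpret affine_valuation f v' a b .
    show "normalised_valuation f v' \<and> centred_at v' (Affine_Point a b)" using normalised centred by blast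
  qed
  have "ord_at f (Affine_Point a b) = v"
    unfolding ord_at_def iff using v affine_valuation_unique by (intro the_equality) blast+
  then show ?thesis using v by simp
qed

lemma infinite_valuation_ord_at: "infinite_valuation f (ord_at f Infinite_Point)"
proof -
  obtain v where v: "infinite_valuation f v" using infinite_valuation_exists by blast
  have iff: "normalised_valuation f v' \<and> centred_at v' Infinite_Point \<longleftrightarrow> infinite_valuation f v'" for v'
  proof
    assume "normalised_valuation f v' \<and> centred_at v' Infinite_Point"
    then show "infinite_valuation f v'" by unfold_locales auto
  next
    assume "infinite_valuation f v'"
    then interpret infinite_valuation f v' .
    show "normalised_valuation f v' \<and> centred_at v' Infinite_Point" using normalised centred by blast
  qed
  have "ord_at f Infinite_Point = v"
    unfolding ord_at_def iff using v infinite_valuation_unique by (intro the_equality) blast+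
  then show ?thesis using v by simp
qed

lemma curve_valuation_ord_at:
  assumes "P \<in> curve_points f" shows "curve_valuation f (ord_at f P)"
  using assms affine_valuation_ord_at infinite_valuation_ord_at
  unfolding curve_points_def affine_points_def
  by (auto simp: affine_valuation_def infinite_valuation_def)

text \<open>
  The conjugation \<open>y \<mapsto> -y\<close> is an automorphism of \<open>K(C)\<close>, so composing the valuation of \<open>(a, b)\<close>
  with it gives a normalised valuation; this is centred at \<open>(a, -b)\<close>, and uniqueness identifies it.
\<close>

lemma ord_at_conj:
  assumes on_curve: "b\<^sup>2 = poly f a"
  shows "ord_at f (Affine_Point a (- b)) (ff_poly A B) = ord_at f (Affine_Point a b) (ff_poly A (- B))"
proof -
  interpret v: affine_valuation f "ord_at f (Affine_Point a b)" a b
    by (rule affine_valuation_ord_at[OF on_curve])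
  let ?c = "\<lambda>\<phi> :: 'k rat_fun. (fst \<phi>, - snd \<phi>)"
  let ?v = "\<lambda>\<phi>. ord_at f (Affine_Point a b) (?c \<phi>)"
  have c_nz: "?c \<phi> \<noteq> ff_zero" if "\<phi> \<noteq> ff_zero" for \<phi> :: "'k rat_fun"
    using that by (cases \<phi>) (auto simp: ff_zero_def)
  have c_mult: "?c (ff_mult f \<phi> \<psi>) = ff_mult f (?c \<phi>) (?c \<psi>)" for \<phi> \<psi> by (simp add: ff_mult_def)
  have c_add: "?c (ff_add \<phi> \<psi>) = ff_add (?c \<phi>) (?c \<psi>)" for \<phi> \<psi> :: "'k rat_fun" by (simp add: ff_add_def)
  have c_poly: "?c (ff_poly A B) = ff_poly A (- B)" for A B :: "'k poly" by (simp add: ff_poly_def)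
  have n: "normalised_valuation f (ord_at f (Affine_Point a b))" by (rule v.normalised)
  have "normalised_valuation f ?v"
    unfolding normalised_valuation_def
  proof (intro conjI allI impI)
    obtain \<phi> where "\<phi> \<noteq> ff_zero" "ord_at f (Affine_Point a b) \<phi> = 1"
      using n unfolding normalised_valuation_def by blast
    then show "\<exists>\<phi>. \<phi> \<noteq> ff_zero \<and> ?v \<phi> = 1" using c_nz[of \<phi>] by (intro exI[of _ "?c \<phi>"]) simp
    show "?v (ff_mult f \<phi> \<psi>) = ?v \<phi> + ?v \<psi>" if "\<phi> \<noteq> ff_zero" "\<psi> \<noteq> ff_zero" for \<phi> \<psi>
      unfolding c_mult by (rule v.v_mult[OF c_nz[OF that(1)] c_nz[OF that(2)]])
    show "min (?v \<phi>) (?v \<psi>) \<le> ?v (ff_add \<phi> \<psi>)"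
      if "\<phi> \<noteq> ff_zero" "\<psi> \<noteq> ff_zero" "ff_add \<phi> \<psi> \<noteq> ff_zero" for \<phi> \<psi>
      using n c_nz[OF that(1)] c_nz[OF that(2)] c_nz[OF that(3)]
      unfolding c_add normalised_valuation_def by blast
    show "?v (ff_poly [:c:] 0) = 0" if "c \<noteq> 0" for c
      using v.w_const[OF that] by (simp add: ff_poly_def)
    show "?v ff_zero = 0" using v.w_zero by (simp add: ff_zero_def ff_poly_def fract_collapse)
  qed
  moreover have "centred_at ?v (Affine_Point a (- b))"
    using v.w_x_pos v.w_yb_pos v.w_uminus[of "[:- b:]" 1] unfolding centred_at.simps c_poly by simp
  ultimately have "affine_valuation f ?v a (- b)" using on_curve by unfold_locales auto
  moreover have "affine_valuation f (ord_at f (Affine_Point a (- b))) a (- b)"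
    by (rule affine_valuation_ord_at) (simp add: on_curve)
  ultimately have "ord_at f (Affine_Point a (- b)) = ?v" by (rule affine_valuation_unique[symmetric])
  then show ?thesis by (simp add: c_poly)
qed

end

section \<open>Polynomials over the subfield\<close>

lemma alg_closed_dvd_by_orders:
  fixes p q :: "'a::alg_closed_field poly"
  assumes "p \<noteq> 0" "q \<noteq> 0" "\<And>a. Polynomial.order a q \<le> Polynomial.order a p"
  shows "q dvd p"
  using assms
proof (induction "degree q" arbitrary: p q)
  case 0
  then show ?case by (metis is_unit_iff_degree unit_imp_dvd)
next
  case (Suc n)
  obtain a where a: "poly q a = 0" using alg_closed_imp_poly_has_root[of q] Suc.hyps(2) by auto
  have "Polynomial.order a q > 0" using a Suc.prems(2) by (simp add: order_gt_0_iff)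
  then have "Polynomial.order a p > 0" using Suc.prems(3)[of a] by linarith
  then have "poly p a = 0" using Suc.prems(1) by (simp add: order_gt_0_iff)
  then obtain p' q' where p': "p = [:- a, 1:] * p'" and q': "q = [:- a, 1:] * q'"
    using a by (auto simp: poly_eq_0_iff_dvd elim!: dvdE)
  have nz: "p' \<noteq> 0" "q' \<noteq> 0" using Suc.prems p' q' by auto
  have "Polynomial.order c q' \<le> Polynomial.order c p'" for c
    using Suc.prems(3)[of c] Suc.prems(1,2) unfolding p' q' by (simp add: order_mult del: mult_pCons_left)
  moreover have "n = degree q'"
    using Suc.hyps(2) nz unfolding q' by (simp add: degree_mult_eq del: mult_pCons_left)
  ultimately have "q' dvd p'" using Suc.hyps(1)[of q' p'] nz by blast
  then show ?case unfolding p' q' by (rule mult_dvd_mono[OF dvd_refl])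
qed

lemma alg_closed_sum_order:
  fixes p :: "'a::alg_closed_field poly"
  assumes "p \<noteq> 0"
  shows "(\<Sum>a | poly p a = 0. Polynomial.order a p) = degree p"
proof -
  obtain A where A: "size A = degree p" "p = smult (lead_coeff p) (\<Prod>x\<in>#A. [:- x, 1:])"
    using alg_closed_imp_factorization[OF assms] by blast
  have "Polynomial.order a (\<Prod>x\<in>#A. [:- x, 1:]) = count A a" for a
  proof (induction A)
    case (add x A)
    have "(\<Prod>x\<in>#A. [:- x, 1:]) \<noteq> 0" by (auto simp: prod_mset_zero_iff)
    then have "Polynomial.order a (\<Prod>x\<in>#add_mset x A. [:- x, 1:]) = Polynomial.order a [:- x, 1:] + count A a"
      using add by (simp add: order_mult del: mult_pCons_left)
    moreover have "Polynomial.order a [:- x, 1:] = (if a = x then 1 else 0)"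
      using order_power_n_n[of x 1] by (auto simp: order_0I)
    ultimately show ?case by simp
  qed simp
  then have ord: "Polynomial.order a p = count A a" for a
    using A(2) assms order_smult[of "lead_coeff p" a] by (metis leading_coeff_0_iff)
  then have "{a. poly p a = 0} = set_mset A"
    using assms order_gt_0_iff[OF assms] by (auto simp: count_greater_zero_iff[symmetric] simp del: count_greater_zero_iff)
  then show ?thesis using A(1) by (simp add: ord size_multiset_overloaded_eq)
qed

locale coefficient_field =
  fixes K0 :: "'k::field set"
  assumes zero_in: "0 \<in> K0" and one_in: "1 \<in> K0"
    and add_in: "x \<in> K0 \<Longrightarrow> y \<in> K0 \<Longrightarrow> x + y \<in> K0"
    and uminus_in: "x \<in> K0 \<Longrightarrow> - x \<in> K0"
    and mult_in: "x \<in> K0 \<Longrightarrow> y \<in> K0 \<Longrightarrow> x * y \<in> K0"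
    and inverse_in: "x \<in> K0 \<Longrightarrow> inverse x \<in> K0"
begin

abbreviation PO :: "'k poly set" where "PO \<equiv> poly_over K0"

lemma diff_in: "x \<in> K0 \<Longrightarrow> y \<in> K0 \<Longrightarrow> x - y \<in> K0"
  using add_in[OF _ uminus_in] by fastforce

lemma divide_in: "x \<in> K0 \<Longrightarrow> y \<in> K0 \<Longrightarrow> x / y \<in> K0"
  by (simp add: divide_inverse mult_in inverse_in)

lemma sum_in: "(\<And>i. i \<in> S \<Longrightarrow> g i \<in> K0) \<Longrightarrow> sum g S \<in> K0"
  by (induction S rule: infinite_finite_induct) (auto simp: zero_in add_in)

lemma coeff_in: "p \<in> PO \<Longrightarrow> Polynomial.coeff p i \<in> K0"
  by (simp add: poly_over_def)

lemma PO_zero [simp]: "0 \<in> PO" by (simp add: poly_over_def zero_in)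

lemma PO_pCons: "pCons c p \<in> PO \<longleftrightarrow> c \<in> K0 \<and> p \<in> PO"
proof
  assume "pCons c p \<in> PO"
  then have *: "Polynomial.coeff (pCons c p) i \<in> K0" for i by (simp add: poly_over_def)
  show "c \<in> K0 \<and> p \<in> PO"
    using *[of 0] *[of "Suc _"] by (auto simp: poly_over_def)
qed (auto simp: poly_over_def coeff_pCons split: nat.splits)

lemma PO_one [simp]: "1 \<in> PO" by (simp add: one_pCons PO_pCons one_in)

lemma PO_add: "p \<in> PO \<Longrightarrow> q \<in> PO \<Longrightarrow> p + q \<in> PO" by (simp add: poly_over_def add_in)
lemma PO_uminus: "p \<in> PO \<Longrightarrow> - p \<in> PO" by (simp add: poly_over_def uminus_in)
lemma PO_diff: "p \<in> PO \<Longrightarrow> q \<in> PO \<Longrightarrow> p - q \<in> PO" by (simp add: poly_over_def diff_in)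
lemma PO_mult: "p \<in> PO \<Longrightarrow> q \<in> PO \<Longrightarrow> p * q \<in> PO" by (simp add: poly_over_def coeff_mult sum_in mult_in)
lemma PO_smult: "c \<in> K0 \<Longrightarrow> p \<in> PO \<Longrightarrow> smult c p \<in> PO" by (simp add: poly_over_def mult_in)
lemma PO_power: "p \<in> PO \<Longrightarrow> p ^ n \<in> PO" by (induction n) (simp_all add: PO_mult)

lemmas PO_closed = PO_add PO_uminus PO_diff PO_mult PO_smult PO_power

lemma PO_mod: "q \<in> PO \<Longrightarrow> p \<in> PO \<Longrightarrow> p mod q \<in> PO"
proof (induction p rule: pCons_induct)
  case (pCons c p)
  then have "c \<in> K0" "p mod q \<in> PO" by (simp_all add: PO_pCons)
  then show ?case using pCons.prems
    by (cases "q = 0") (simp_all add: mod_pCons_eq PO_diff PO_smult PO_pCons divide_in coeff_in)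
qed simp

lemma PO_div: "q \<in> PO \<Longrightarrow> p \<in> PO \<Longrightarrow> p div q \<in> PO"
proof (induction p rule: pCons_induct)
  case (pCons c p)
  then have "c \<in> K0" "p mod q \<in> PO" "p div q \<in> PO" by (simp_all add: PO_pCons PO_mod)
  then have "pCons c (p mod q) \<in> PO" by (simp add: PO_pCons)
  then have "Polynomial.coeff (pCons c (p mod q)) (degree q) / lead_coeff q \<in> K0"
    using pCons.prems by (intro divide_in coeff_in)
  then show ?case using \<open>p div q \<in> PO\<close>
    by (cases "q = 0") (simp_all add: div_pCons_eq PO_pCons)
qed simp

lemma PO_mult_cancel:
  assumes "q \<noteq> 0" "q \<in> PO" "q * r \<in> PO" shows "r \<in> PO"
  using PO_div[OF assms(2,3)] assms(1) by simp

text \<open>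
  \<open>K\<^sub>0[x]\<close> is a principal ideal domain: an element of least degree generates, by division with
  remainder.
\<close>

lemma PO_principal:
  assumes sub: "J \<subseteq> PO" and zero: "0 \<in> J"
    and add: "\<And>p q. p \<in> J \<Longrightarrow> q \<in> J \<Longrightarrow> p + q \<in> J"
    and mult: "\<And>p q. p \<in> PO \<Longrightarrow> q \<in> J \<Longrightarrow> p * q \<in> J"
  obtains d where "d \<in> J" "\<And>x. x \<in> J \<Longrightarrow> \<exists>q \<in> PO. x = q * d"
proof (cases "J = {0}")
  case True
  then show ?thesis by (intro that[of 0]) (auto intro: PO_zero)
next
  case False
  then obtain x where x: "x \<in> J \<and> x \<noteq> 0" using zero by blast
  obtain d where d: "d \<in> J" "d \<noteq> 0" and min: "\<And>y. y \<in> J \<Longrightarrow> y \<noteq> 0 \<Longrightarrow> degree d \<le> degree y"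
    using ex_has_least_nat[of "\<lambda>y. y \<in> J \<and> y \<noteq> 0" x degree] x by blast
  have "\<exists>q \<in> PO. y = q * d" if y: "y \<in> J" for y
  proof -
    have PO: "y div d \<in> PO" using y d sub by (intro PO_div) auto
    have "y + (- (y div d)) * d \<in> J" by (intro add mult PO_uminus PO y d(1))
    moreover have "y + (- (y div d)) * d = y mod d"
      using div_mult_mod_eq[of y d] by (simp add: algebra_simps)
    ultimately have "y mod d \<in> J" by simp
    then have "y mod d = 0"
      using min[of "y mod d"] degree_mod_less[OF d(2), of y] by fastforce
    then show ?thesis using PO div_mult_mod_eq[of y d] by (intro bexI[of _ "y div d"]) simp_all
  qed
  then show ?thesis using that d by blast
qed

lemma PO_bezout:
  fixes p q :: "'k poly"
  assumes pq: "p \<in> PO" "q \<in> PO" and coprime: "\<And>d. d dvd p \<Longrightarrow> d dvd q \<Longrightarrow> is_unit d"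
  obtains s t where "s \<in> PO" "t \<in> PO" "s * p + t * q = 1"
proof -
  let ?J = "{s * p + t * q | s t. s \<in> PO \<and> t \<in> PO}"
  have mem: "s * p + t * q \<in> ?J" if "s \<in> PO" "t \<in> PO" for s t using that by blast
  obtain d where d: "d \<in> ?J" "\<And>x. x \<in> ?J \<Longrightarrow> \<exists>q \<in> PO. x = q * d"
  proof (rule PO_principal[of ?J])
    show "?J \<subseteq> PO" using pq by (auto intro!: PO_closed)
    show "0 \<in> ?J" using mem[of 0 0] by simp
    fix x y
    { assume "x \<in> ?J" "y \<in> ?J"
      then obtain s t s' t' where *: "s \<in> PO" "t \<in> PO" "s' \<in> PO" "t' \<in> PO" "x = s * p + t * q" "y = s' * p + t' * q" by blast
      have "x + y = (s + s') * p + (t + t') * q" by (simp add: * algebra_simps)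
      then show "x + y \<in> ?J" using mem[of "s + s'" "t + t'"] * by (simp add: PO_add) }
    { assume x: "x \<in> PO" and "y \<in> ?J"
      then obtain s t where *: "s \<in> PO" "t \<in> PO" "y = s * p + t * q" by blast
      have "x * y = (x * s) * p + (x * t) * q" by (simp add: * algebra_simps)
      then show "x * y \<in> ?J" using mem[of "x * s" "x * t"] * x by (simp add: PO_mult) }
  qed blast
  have "d dvd p" "d dvd q"
    using d(2)[of p] d(2)[of q] mem[of 1 0] mem[of 0 1] by auto
  then have "is_unit d" by (rule coprime)
  then obtain c where c: "d = [:c:]" "c \<noteq> 0" by (auto simp: is_unit_poly_iff dvd_field_iff)
  obtain s t where st: "s \<in> PO" "t \<in> PO" "d = s * p + t * q" using d(1) by blast
  have "d \<in> PO" using st pq by (simp add: PO_closed)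
  then have "c \<in> K0" by (simp add: c PO_pCons)
  then have "inverse c \<in> K0" by (rule inverse_in)
  moreover have "smult (inverse c) s * p + smult (inverse c) t * q = 1"
  proof -
    have "smult (inverse c) s * p + smult (inverse c) t * q = smult (inverse c) d"
      unfolding st(3) by (simp add: smult_add_right)
    then show ?thesis using c by (simp add: one_pCons)
  qed
  ultimately show ?thesis using that[of "smult (inverse c) s" "smult (inverse c) t"] st PO_smult by blast
qed

text \<open>
  Rational reconstruction: the Euclidean algorithm for \<open>p\<close> and \<open>q\<close>, stopped at the first remainder of
  degree less than \<open>t\<close>, writes this remainder as \<open>B q - C p\<close>. The bound on the degree of \<open>C\<close> is what
  keeps track of the degree of the next \<open>B\<close>.
\<close>

lemma PO_reconstruction:
  assumes "p \<in> PO" "q \<in> PO" "q = 0 \<or> degree q < degree p" "0 < t" "t \<le> degree p"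
  shows "\<exists>B C. B \<in> PO \<and> C \<in> PO \<and> B \<noteq> 0 \<and> degree B \<le> degree p - t \<and> degree (B * q - C * p) < t
    \<and> degree C \<le> degree B"
  using assms
proof (induction "degree q" arbitrary: p q rule: less_induct)
  case less
  show ?case
  proof (cases "degree q < t")
    case True
    then show ?thesis by (intro exI[of _ 1] exI[of _ 0]) simp
  next
    case False
    then have q: "q \<noteq> 0" "t \<le> degree q" "degree q < degree p" using less.prems by auto
    define h p' where "h = p div q" and "p' = p mod q"
    have p: "p = h * q + p'" by (simp add: h_def p'_def)
    have hp': "h \<in> PO" "p' \<in> PO" using less.prems by (simp_all add: h_def p'_def PO_div PO_mod)
    have p'_deg: "p' = 0 \<or> degree p' < degree q" using degree_mod_less[OF q(1)] by (simp add: p'_def)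
    have p'_deg': "degree p' < degree q" using p'_deg q less.prems(4) by auto
    have h: "h \<noteq> 0" "degree h + degree q = degree p"
    proof -
      show "h \<noteq> 0" using p p'_deg q by auto
      then have "degree (h * q) = degree h + degree q" using q by (simp add: degree_mult_eq)
      then show "degree h + degree q = degree p"
        using p'_deg' degree_add_eq_left[of p' "h * q"] p by simp
    qed
    obtain B C where BC: "B \<in> PO" "C \<in> PO" "B \<noteq> 0" "degree B \<le> degree q - t"
        "degree (B * p' - C * q) < t" "degree C \<le> degree B"
      using less.hyps[OF p'_deg' less.prems(2) hp'(2) p'_deg less.prems(4) q(2)] by blast
    define B' where "B' = - (B * h + C)"
    have eq: "B' * q - (- B) * p = B * p' - C * q" by (simp add: B'_def p algebra_simps)
    have "degree h > 0" using h q by linarith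
    then have dB': "degree B' = degree B + degree h"
      using BC(6) degree_add_eq_left[of C "B * h"] degree_mult_eq[OF BC(3) h(1)]
      unfolding B'_def degree_minus by simp
    then have "B' \<noteq> 0" using \<open>degree h > 0\<close> by auto
    moreover have "degree B' \<le> degree p - t" using dB' BC(4) h q by linarith
    ultimately show ?thesis
      using BC eq hp' dB' by (intro exI[of _ B'] exI[of _ "- B"]) (auto simp: B'_def PO_closed)
  qed
qed

text \<open>
  The non-zero ideals of \<open>K\<^sub>0[x, y]\<close> are the \<open>K\<^sub>0[x]\<close>-modules of rank 2 that are stable under multiplication by
  \<open>y\<close>. In a basis \<open>e\<close>, \<open>A1 + d y\<close> in Hermite form, stability forces \<open>d\<close> to divide \<open>e\<close> and \<open>A1\<close>, and
  applying \<open>y + p\<close> to \<open>d (y - p)\<close> gives \<open>d (f - p\<^sup>2)\<close>, a multiple of \<open>e = d u\<close>.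
\<close>

lemma PO_hermite:
  fixes f :: "'k poly"
  assumes f: "f \<in> PO" and norm: "\<And>A B. A \<noteq> 0 \<or> B \<noteq> 0 \<Longrightarrow> norm_poly f A B \<noteq> 0"
    and sub: "I \<subseteq> PO \<times> PO" and ne: "(A0, B0) \<in> I" "A0 \<noteq> 0 \<or> B0 \<noteq> 0"
    and add: "\<And>A B C D. (A, B) \<in> I \<Longrightarrow> (C, D) \<in> I \<Longrightarrow> (A + C, B + D) \<in> I"
    and mult: "\<And>A B C. C \<in> PO \<Longrightarrow> (A, B) \<in> I \<Longrightarrow> (C * A, C * B) \<in> I"
    and mult_y: "\<And>A B. (A, B) \<in> I \<Longrightarrow> (f * B, A) \<in> I"
  obtains d u p where "d \<in> PO" "u \<in> PO" "p \<in> PO" "d \<noteq> 0" "u \<noteq> 0" "u dvd f - p\<^sup>2"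
    "(d * u, 0) \<in> I" "(- (d * p), d) \<in> I"
    "\<And>A B. (A, B) \<in> I \<Longrightarrow> \<exists>s t. A = s * (d * u) - t * (d * p) \<and> B = t * d"
proof -
  have zero: "(0, 0) \<in> I" using mult[OF PO_zero ne(1)] by simp
  have I_PO: "A \<in> PO \<and> B \<in> PO" if "(A, B) \<in> I" for A B using that sub by auto
  obtain d where d: "d \<in> {B. \<exists>A. (A, B) \<in> I}" "\<And>x. x \<in> {B. \<exists>A. (A, B) \<in> I} \<Longrightarrow> \<exists>q \<in> PO. x = q * d"
  proof (rule PO_principal[of "{B. \<exists>A. (A, B) \<in> I}"])
    show "{B. \<exists>A. (A, B) \<in> I} \<subseteq> PO" using I_PO by blast
    show "0 \<in> {B. \<exists>A. (A, B) \<in> I}" using zero by blast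
    show "p + q \<in> {B. \<exists>A. (A, B) \<in> I}" if "p \<in> {B. \<exists>A. (A, B) \<in> I}" "q \<in> {B. \<exists>A. (A, B) \<in> I}" for p q
      using that add by blast
    show "p * q \<in> {B. \<exists>A. (A, B) \<in> I}" if "p \<in> PO" "q \<in> {B. \<exists>A. (A, B) \<in> I}" for p q
      using that mult by blast
  qed blast
  obtain e where e: "(e, 0) \<in> I" "\<And>x. (x, 0) \<in> I \<Longrightarrow> \<exists>q \<in> PO. x = q * e"
  proof (rule PO_principal[of "{A. (A, 0) \<in> I}"])
    show "{A. (A, 0) \<in> I} \<subseteq> PO" using I_PO by blast
    show "0 \<in> {A. (A, 0) \<in> I}" using zero by blast
    show "p + q \<in> {A. (A, 0) \<in> I}" if "p \<in> {A. (A, 0) \<in> I}" "q \<in> {A. (A, 0) \<in> I}" for p q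
      using that add[of p 0 q 0] by simp
    show "p * q \<in> {A. (A, 0) \<in> I}" if "p \<in> PO" "q \<in> {A. (A, 0) \<in> I}" for p q
      using that mult[of p q 0] by simp
  qed blast
  obtain A1 where A1: "(A1, d) \<in> I" using d(1) by blast
  have "A0 \<in> {B. \<exists>A. (A, B) \<in> I}" "B0 \<in> {B. \<exists>A. (A, B) \<in> I}" using ne(1) mult_y by blast+
  then have d_nz: "d \<noteq> 0" using d(2) ne(2) by fastforce
  have "(A1 * A1 + (- d) * (f * d), A1 * d + (- d) * A1) \<in> I"
    using A1 mult_y[OF A1] I_PO[OF A1] by (intro add mult) (auto simp: PO_uminus)
  moreover have "A1 * A1 + (- d) * (f * d) = norm_poly f A1 d" "A1 * d + (- d) * A1 = 0"
    by (simp_all add: norm_poly_def power2_eq_square)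
  ultimately have "(norm_poly f A1 d, 0) \<in> I" by simp
  then have e_nz: "e \<noteq> 0" using e(2) norm[of A1 d] d_nz by fastforce
  obtain u where u: "u \<in> PO" "e = u * d" using d(2) mult_y[OF e(1)] by auto
  obtain p' where p': "p' \<in> PO" "A1 = p' * d" using d(2) mult_y[OF A1] by blast
  define p where "p = - p'"
  have p: "p \<in> PO" "A1 = - (d * p)" using p' by (simp_all add: p_def PO_uminus)
  have "(f * d + p * A1, A1 + p * d) \<in> I"
    using A1 mult_y[OF A1] p(1) by (intro add mult) auto
  then have "((f - p\<^sup>2) * d, 0) \<in> I" by (simp add: p(2) power2_eq_square algebra_simps)
  then obtain k where "(f - p\<^sup>2) * d = k * e" using e(2) by blast
  then have "f - p\<^sup>2 = u * k" using d_nz by (simp add: u(2))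
  then have "u dvd f - p\<^sup>2" by simp
  moreover have "\<exists>s t. A = s * (d * u) - t * (d * p) \<and> B = t * d" if AB: "(A, B) \<in> I" for A B
  proof -
    obtain t where t: "t \<in> PO" "B = t * d" using d(2) AB by blast
    have "(A + (- t) * A1, B + (- t) * d) \<in> I" using AB A1 t by (intro add mult) (auto simp: PO_uminus)
    then have "(A + t * (d * p), 0) \<in> I" by (simp add: t(2) p(2))
    then obtain s where "A + t * (d * p) = s * e" using e(2) by blast
    then have "A = s * (d * u) - t * (d * p)" by (simp add: u(2) algebra_simps)
    then show ?thesis using t(2) by blast
  qed
  moreover have "(d * u, 0) \<in> I" "(- (d * p), d) \<in> I" using e(1) A1 by (simp_all add: u(2) p(2) mult.commute)
  moreover have "d \<in> PO" "u \<noteq> 0" using I_PO[OF A1] e_nz u(2) by auto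
  ultimately show ?thesis using that[of d u p] p(1) u(1) d_nz by blast
qed

end

lemma subfield_coefficient_field:
  assumes "subfield K0 (ring_of_type_algebra :: 'k::field ring)"
  shows "coefficient_field K0"
proof -
  let ?R = "ring_of_type_algebra :: 'k ring"
  interpret R: ring ?R by (rule ring_from_type_algebra)
  have sub: "subring K0 ?R"
    using assms by (simp add: subfield_def subdomain_def subcring_def)
  have minus: "\<ominus>\<^bsub>?R\<^esub> x = - x" for x
    by (rule R.minus_equality) (simp_all add: ring_of_type_algebra_def)
  show ?thesis
  proof
    show "0 \<in> K0" "1 \<in> K0" using subringE(2,3)[OF sub] by (simp_all add: ring_of_type_algebra_def)
    fix x y assume x: "x \<in> K0"
    show "- x \<in> K0" using subringE(5)[OF sub x] by (simp add: minus)
    show "inverse x \<in> K0"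
    proof (cases "x = 0")
      case False
      then have "x \<in> Units (?R\<lparr>carrier := K0\<rparr>)"
        using x subfield.subfield_Units[OF assms] by (simp add: ring_of_type_algebra_def)
      then obtain z where "z \<in> K0" "x * z = 1" by (auto simp: Units_def ring_of_type_algebra_def)
      then show ?thesis by (metis inverse_unique)
    qed (use x in simp)
    assume y: "y \<in> K0"
    show "x + y \<in> K0" "x * y \<in> K0" using subringE(6,7)[OF sub x y] by (simp_all add: ring_of_type_algebra_def)
  qed
qed

section \<open>Common zeros of a polynomial and \<open>y - p\<close>\<close>

context affine_valuation
begin

lemma w_poly_eq: "A \<noteq> 0 \<Longrightarrow> w A 0 = (if b = 0 then 2 else 1) * int (Polynomial.order a A)"
  using w_poly[of A] w_x by simp

lemma w_norm_branches: "w (f - p\<^sup>2) 0 = w (- p) 1 + w p 1"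
proof -
  have "norm_poly f p 1 = - (f - p\<^sup>2)" by (simp add: norm_poly_def)
  then have "w (f - p\<^sup>2) 0 = w (norm_poly f p 1) 0" using w_uminus[of "f - p\<^sup>2" 0] by simp
  also have "\<dots> = w p 1 + w p (- 1)" by (rule w_norm) simp
  also have "w p (- 1) = w (- p) 1" using w_uminus[of p "- 1"] by simp
  finally show ?thesis by simp
qed

lemma w_ramified_branch:
  assumes b: "b = 0" and p: "poly p a = 0" shows "w p 1 = 1"
proof (cases "p = 0")
  case True
  then show ?thesis using w_y_ramified[OF b] by simp
next
  case False
  have "w p 0 > 0" using w_pos_iff[of p 0] False p by simp
  then have "w 0 1 < w p 0" using w_poly_eq[OF False] b w_y_ramified[OF b] by simp
  then show ?thesis using w_add_eq(1)[of 0 1 p 0] False w_y_ramified[OF b] by simp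
qed

text \<open>
  The graphs \<open>y = p\<close> and \<open>y = - p\<close> can only meet in a ramification point, and there both \<open>y - p\<close> and
  \<open>y + p\<close> are uniformisers.
\<close>

lemma both_branches:
  assumes "w (- p) 1 > 0" "w p 1 > 0"
  shows "b = 0" "w (- p) 1 = 1" "w p 1 = 1"
proof -
  have ev: "b - poly p a = 0" "b + poly p a = 0"
    using assms w_pos_iff[of "- p" 1] w_pos_iff[of p 1] by (simp_all add: add.commute)
  then have "2 * b = 0" by (simp add: eq_neg_iff_add_eq_0[symmetric])
  then show b: "b = 0" using two_nonzero by simp
  then have "poly p a = 0" using ev by simp
  then show "w (- p) 1 = 1" "w p 1 = 1" using w_ramified_branch[OF b, of p] w_ramified_branch[OF b, of "- p"] by simp_all
qed

lemma even_w_ramified: "b = 0 \<Longrightarrow> even (w A 0)"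
  by (cases "A = 0") (simp_all add: w_poly_eq)

text \<open>
  If only one of \<open>y - p\<close> and \<open>y + p\<close> vanishes at the point, it takes all of \<open>u u' = (y - p) (y + p)\<close>.
  If both vanish, then this product has value 2, and one of \<open>u\<close>, \<open>u'\<close> has value 2 and the other 0,
  since the values of polynomials in \<open>x\<close> are even.
\<close>

lemma branch_factor:
  assumes u: "u * u' = f - p\<^sup>2" and nz: "f - p\<^sup>2 \<noteq> 0"
  shows "min (w u 0) (w (- p) 1) + min (w u' 0) (w (- p) 1) = w (- p) 1"
    and "min (w u 0) (w (- p) 1) + min (w u 0) (w p 1) = w u 0"
proof -
  have nz': "u \<noteq> 0" "u' \<noteq> 0" using u nz by auto
  have sum: "w u 0 + w u' 0 = w (- p) 1 + w p 1"
    using w_poly_mult[OF nz'] u w_norm_branches[of p] by simp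
  have ge: "w u 0 \<ge> 0" "w u' 0 \<ge> 0" "w (- p) 1 \<ge> 0" "w p 1 \<ge> 0" by (simp_all add: w_nonneg)
  have "min (w u 0) (w (- p) 1) + min (w u' 0) (w (- p) 1) = w (- p) 1 \<and>
    min (w u 0) (w (- p) 1) + min (w u 0) (w p 1) = w u 0"
  proof (cases "w (- p) 1 > 0 \<and> w p 1 > 0")
    case True
    then have b: "b = 0" "w (- p) 1 = 1" "w p 1 = 1" using both_branches[of p] by auto
    moreover obtain k where "w u 0 = 2 * k" using even_w_ramified[OF b(1), of u] by (auto elim: evenE)
    moreover from calculation have "k = 0 \<or> k = 1" using sum ge by auto
    ultimately show ?thesis using b sum by auto
  next
    case False
    then show ?thesis using sum ge by linarith
  qed
  then show "min (w u 0) (w (- p) 1) + min (w u' 0) (w (- p) 1) = w (- p) 1"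
    and "min (w u 0) (w (- p) 1) + min (w u 0) (w p 1) = w u 0" by blast+
qed

lemma branch_shift_le:
  assumes u: "u \<noteq> 0" shows "min (w u 0) (w (- p) 1) \<le> w (- (p + u * k)) 1"
proof (cases "k = 0")
  case False
  have "w (- (u * k)) 0 = w u 0 + w k 0" using w_uminus[of "u * k" 0] w_poly_mult[OF u False] by simp
  then have "w (- (u * k)) 0 \<ge> w u 0" using w_nonneg[of k 0] by simp
  moreover have "min (w (- p) 1) (w (- (u * k)) 0) \<le> w (- (p + u * k)) 1"
    using w_add[of "- p" 1 "- (u * k)" 0] u False by simp
  ultimately show ?thesis by linarith
qed simp

lemma branch_shift:
  assumes u: "u \<noteq> 0" shows "min (w u 0) (w (- (p + u * k)) 1) = min (w u 0) (w (- p) 1)"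
  using branch_shift_le[OF u, of p k] branch_shift_le[OF u, of "p + u * k" "- k"] by simp

end

context odd_hyperelliptic
begin

text \<open>
  The multiplicities of the divisor with Mumford representation \<open>(u, p)\<close>.
\<close>

definition mumford_value :: "'k poly \<Rightarrow> 'k poly \<Rightarrow> 'k curve_point \<Rightarrow> int" where
  "mumford_value u p Q = min (ord_at f Q (ff_poly u 0)) (ord_at f Q (ff_poly (- p) 1))"

lemma f_minus_square_nonzero: "f - p\<^sup>2 \<noteq> 0"
  using norm_poly_nonzero[of p 1] by (auto simp: norm_poly_def)

lemma affine_pointE:
  assumes "Q \<in> affine_points f"
  obtains \<alpha> \<beta> where "Q = Affine_Point \<alpha> \<beta>" "\<beta>\<^sup>2 = poly f \<alpha>" "affine_valuation f (ord_at f Q) \<alpha> \<beta>"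
  using assms affine_valuation_ord_at unfolding affine_points_def by blast

lemma point_above: "\<exists>\<beta>. \<beta>\<^sup>2 = poly f \<alpha>"
  using nth_root_exists[of 2 "poly f \<alpha>"] by auto

lemma ff_quotient:
  assumes "\<phi> \<noteq> ff_zero" "\<psi> \<noteq> ff_zero"
  obtains \<chi> where "\<chi> \<noteq> ff_zero" "\<And>P. P \<in> curve_points f \<Longrightarrow> ord_at f P \<chi> = ord_at f P \<phi> - ord_at f P \<psi>"
proof -
  obtain \<psi>' where \<psi>': "\<psi>' \<noteq> ff_zero" "ff_mult f \<psi> \<psi>' = ff_poly 1 0" using ff_inverse[OF assms(2)] by blast
  show ?thesis
  proof (rule that)
    show "ff_mult f \<phi> \<psi>' \<noteq> ff_zero" by (rule ff_mult_nonzero[OF assms(1) \<psi>'(1)])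
    fix P assume "P \<in> curve_points f"
    then interpret curve_valuation f "ord_at f P" by (rule curve_valuation_ord_at)
    show "ord_at f P (ff_mult f \<phi> \<psi>') = ord_at f P \<phi> - ord_at f P \<psi>"
      using v_mult[OF assms(1) \<psi>'(1)] v_mult[OF assms(2) \<psi>'(1)] \<psi>'(2) w_one by simp
  qed
qed

lemma affine_in_curve: "Q \<in> affine_points f \<Longrightarrow> Q \<in> curve_points f"
  by (simp add: curve_points_def)

lemma poly_dvd_by_ord:
  assumes "p \<noteq> 0" "q \<noteq> 0"
    and le: "\<And>Q. Q \<in> affine_points f \<Longrightarrow> ord_at f Q (ff_poly q 0) \<le> ord_at f Q (ff_poly p 0)"
  shows "q dvd p"
proof (rule alg_closed_dvd_by_orders[OF assms(1,2)])
  fix \<alpha> :: 'k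
  obtain \<beta> where \<beta>: "\<beta>\<^sup>2 = poly f \<alpha>" using point_above by blast
  interpret affine_valuation f "ord_at f (Affine_Point \<alpha> \<beta>)" \<alpha> \<beta> by (rule affine_valuation_ord_at[OF \<beta>])
  have "Affine_Point \<alpha> \<beta> \<in> affine_points f" using \<beta> by (simp add: affine_points_def)
  from le[OF this] show "Polynomial.order \<alpha> q \<le> Polynomial.order \<alpha> p"
    using w_poly_eq[OF assms(1)] w_poly_eq[OF assms(2)] by (simp split: if_splits)
qed

lemma poly_eq_smult_by_ord:
  assumes "p \<noteq> 0" "q \<noteq> 0"
    and eq: "\<And>Q. Q \<in> affine_points f \<Longrightarrow> ord_at f Q (ff_poly p 0) = ord_at f Q (ff_poly q 0)"
  obtains c where "c \<noteq> 0" "p = smult c q"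
proof -
  have "q dvd p" "p dvd q" using poly_dvd_by_ord[OF assms(1,2)] poly_dvd_by_ord[OF assms(2,1)] eq by auto
  then obtain k l where k: "p = q * k" "q = p * l" unfolding dvd_def by blast
  then have "q * 1 = q * (k * l)" by (metis mult.assoc mult.right_neutral)
  then have "k * l = 1" using assms(2) by (metis mult_left_cancel)
  then have "is_unit k" by (metis dvd_triv_left)
  then obtain c where "k = [:c:]" "c \<noteq> 0" by (auto simp: is_unit_poly_iff dvd_field_iff)
  then show ?thesis using k(1) that[of c] by simp
qed

lemma ff_mult_cancel:
  assumes "\<phi> \<noteq> ff_zero" "ff_mult f \<phi> \<psi> = ff_mult f \<phi> \<chi>" shows "\<psi> = \<chi>"
proof -
  obtain \<phi>' where "ff_mult f \<phi> \<phi>' = ff_poly 1 0" using ff_inverse[OF assms(1)] by blast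
  then have "\<psi> = ff_mult f \<phi>' (ff_mult f \<phi> \<psi>)" "\<chi> = ff_mult f \<phi>' (ff_mult f \<phi> \<chi>)"
    using ff_mult_one ff_mult_assoc ff_mult_commute by metis+
  then show ?thesis using assms(2) by simp
qed

text \<open>
  This is the integral closedness of \<open>K[x, y]\<close>, which rests on \<open>f\<close> having no repeated roots. Let
  \<open>\<alpha>\<close> be a root of the denominator \<open>C\<close> of \<open>(A + B y) / C\<close>. The numerator vanishes at both points
  above \<open>\<alpha>\<close>; if they are different, then \<open>A\<close> and \<open>B\<close> vanish at \<open>\<alpha>\<close>. If they coincide, then \<open>C\<close>
  vanishes there to order at least 2, so \<open>B y\<close> does as well, while \<open>y\<close> has order 1. In either case
  \<open>x - \<alpha>\<close> cancels.
\<close>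

lemma regular_imp_poly:
  assumes nz: "\<phi> \<noteq> ff_zero" and reg: "\<And>Q. Q \<in> affine_points f \<Longrightarrow> ord_at f Q \<phi> \<ge> 0"
  obtains A B where "\<phi> = ff_poly A B"
proof -
  have "\<exists>A B. \<phi> = ff_poly A B" if "C \<noteq> 0" "ff_mult f (ff_poly C 0) \<phi> = ff_poly A B" for A B C
    using that
  proof (induction "degree C" arbitrary: A B C)
    case 0
    then obtain c where c: "C = [:c:]" "c \<noteq> 0" by (metis degree_eq_zeroE pCons_0_0)
    let ?c = "ff_poly [:inverse c:] 0 :: 'k rat_fun"
    have "ff_mult f ?c (ff_mult f (ff_poly C 0) \<phi>) = ff_mult f (ff_mult f ?c (ff_poly C 0)) \<phi>"
      by (simp only: ff_mult_assoc)
    also have "ff_mult f ?c (ff_poly C 0) = ff_poly 1 0" using c by (simp add: ff_mult_poly one_pCons)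
    finally have "\<phi> = ff_mult f ?c (ff_poly A B)" using 0 by (simp add: ff_mult_one)
    then show ?case by (simp add: ff_mult_poly) blast
  next
    case (Suc n)
    obtain \<alpha> where \<alpha>: "poly C \<alpha> = 0" using alg_closed_imp_poly_has_root[of C] Suc.hyps(2) by auto
    obtain \<beta> where \<beta>: "\<beta>\<^sup>2 = poly f \<alpha>" using point_above by blast
    have AB: "A \<noteq> 0 \<or> B \<noteq> 0" using denominator_nonzero[OF nz Suc.prems] .
    have pos: "ord_at f (Affine_Point \<alpha> \<gamma>) (ff_poly A B) \<ge> ord_at f (Affine_Point \<alpha> \<gamma>) (ff_poly C 0)"
      "poly A \<alpha> + poly B \<alpha> * \<gamma> = 0" if \<gamma>: "\<gamma>\<^sup>2 = poly f \<alpha>" for \<gamma>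
    proof -
      interpret affine_valuation f "ord_at f (Affine_Point \<alpha> \<gamma>)" \<alpha> \<gamma> by (rule affine_valuation_ord_at[OF \<gamma>])
      show "w A B \<ge> w C 0"
        using v_fraction[OF nz Suc.prems] reg[of "Affine_Point \<alpha> \<gamma>"] \<gamma> by (simp add: affine_points_def)
      moreover have "w C 0 > 0" using w_pos_iff[of C 0] \<alpha> Suc.prems(1) by simp
      ultimately show "ev A B = 0" using w_pos_iff[OF AB] by simp
    qed
    have sum: "poly A \<alpha> + poly B \<alpha> * \<beta> = 0" "poly A \<alpha> - poly B \<alpha> * \<beta> = 0"
      using pos(2)[OF \<beta>] pos(2)[of "- \<beta>"] \<beta> by simp_all
    then have "2 * poly A \<alpha> = 0" "2 * (poly B \<alpha> * \<beta>) = 0" by (simp_all add: algebra_simps)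
    then have A: "poly A \<alpha> = 0" and B\<beta>: "poly B \<alpha> * \<beta> = 0" using two_nonzero by simp_all
    have B: "poly B \<alpha> = 0"
    proof (cases "\<beta> = 0 \<and> B \<noteq> 0")
      case True
      then have \<beta>0: "\<beta> = 0" and B: "B \<noteq> 0" by auto
      interpret affine_valuation f "ord_at f (Affine_Point \<alpha> \<beta>)" \<alpha> \<beta> by (rule affine_valuation_ord_at[OF \<beta>])
      have two: "w p 0 \<ge> 2" if "p \<noteq> 0" "poly p \<alpha> = 0" for p
      proof -
        have "Polynomial.order \<alpha> p \<ge> 1" using order_gt_0_iff[OF that(1), of \<alpha>] that(2) by simp
        then show ?thesis using w_poly_eq[OF that(1)] \<beta>0 by simp
      qed
      have AB2: "w A B \<ge> 2" using pos(1)[OF \<beta>] two[OF Suc.prems(1) \<alpha>] by simp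
      have "w 0 B \<ge> 2"
      proof (cases "A = 0")
        case False
        then show ?thesis using w_diff[OF AB, of A 0] two[OF False A] AB2 B by simp
      qed (use AB2 in simp)
      then have "w B 0 > 0" using w_y_mult[OF B] w_y_ramified[OF \<beta>0] by simp
      then show ?thesis using w_pos_iff[of B 0] B by simp
    qed (use B\<beta> in auto)
    obtain A' B' C' where dec: "A = [:- \<alpha>, 1:] * A'" "B = [:- \<alpha>, 1:] * B'" "C = [:- \<alpha>, 1:] * C'"
      using A B \<alpha> by (auto simp: poly_eq_0_iff_dvd elim!: dvdE)
    have C': "C' \<noteq> 0" using Suc.prems(1) dec by auto
    have "ff_mult f (ff_poly [:- \<alpha>, 1:] 0) (ff_mult f (ff_poly C' 0) \<phi>) = ff_mult f (ff_poly C 0) \<phi>"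
      unfolding dec ff_mult_assoc[symmetric] by (simp only: ff_mult_poly mult_zero_left mult_zero_right add_0_right)
    also have "\<dots> = ff_mult f (ff_poly [:- \<alpha>, 1:] 0) (ff_poly A' B')"
      unfolding Suc.prems(2) unfolding dec by (simp only: ff_mult_poly mult_zero_left mult_zero_right add_0_right)
    finally have eq: "ff_mult f (ff_poly [:- \<alpha>, 1:] 0) (ff_mult f (ff_poly C' 0) \<phi>) =
      ff_mult f (ff_poly [:- \<alpha>, 1:] 0) (ff_poly A' B')" .
    have "ff_poly [:- \<alpha>, 1:] 0 \<noteq> ff_zero" by (simp add: ff_poly_eq_zero_iff)
    then have "ff_mult f (ff_poly C' 0) \<phi> = ff_poly A' B'" using eq by (rule ff_mult_cancel)
    moreover have "n = degree C'"
      using Suc.hyps(2) C' unfolding dec by (simp add: degree_mult_eq del: mult_pCons_left)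
    ultimately show ?case using Suc.hyps(1) C' by blast
  qed
  then show ?thesis using ex_denominator[of f \<phi>] that by blast
qed

lemma mumford_conj:
  assumes "\<beta>\<^sup>2 = poly f \<alpha>"
  shows "mumford_value u p (Affine_Point \<alpha> (- \<beta>)) =
    min (ord_at f (Affine_Point \<alpha> \<beta>) (ff_poly u 0)) (ord_at f (Affine_Point \<alpha> \<beta>) (ff_poly p 1))"
proof -
  interpret affine_valuation f "ord_at f (Affine_Point \<alpha> \<beta>)" \<alpha> \<beta> by (rule affine_valuation_ord_at[OF assms])
  show ?thesis using w_uminus[of p 1] by (simp add: mumford_value_def ord_at_conj[OF assms])
qed

text \<open>
  On the affine curve, the divisor of \<open>y - p\<close> is the sum of those of \<open>(u, p)\<close> and \<open>(u', p)\<close>, and the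
  divisor of \<open>u'\<close> is the sum of those of \<open>(u', p)\<close> and \<open>(u', - p)\<close>.
\<close>

lemma mumford_cantor_step:
  assumes u: "u * u' = f - p\<^sup>2" and Q: "Q \<in> affine_points f"
  shows "mumford_value u p Q + ord_at f Q (ff_poly u' 0) =
    mumford_value u' (- p) Q + ord_at f Q (ff_poly (- p) 1)"
proof -
  obtain \<alpha> \<beta> where "affine_valuation f (ord_at f Q) \<alpha> \<beta>" using affine_pointE[OF Q] by blast
  then interpret affine_valuation f "ord_at f Q" \<alpha> \<beta> .
  show ?thesis
    using branch_factor(1)[OF u f_minus_square_nonzero] branch_factor(2)[of u' u p] u f_minus_square_nonzero[of p]
    by (simp add: mumford_value_def mult.commute)
qed

lemma mumford_shift:
  assumes "u \<noteq> 0" "Q \<in> affine_points f"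
  shows "mumford_value u (p + u * k) Q = mumford_value u p Q"
proof -
  obtain \<alpha> \<beta> where "affine_valuation f (ord_at f Q) \<alpha> \<beta>" using affine_pointE[OF assms(2)] by blast
  then interpret affine_valuation f "ord_at f Q" \<alpha> \<beta> .
  show ?thesis unfolding mumford_value_def by (rule branch_shift[OF assms(1)])
qed

lemma mumford_smult:
  assumes "c \<noteq> 0" "u \<noteq> 0" "Q \<in> affine_points f"
  shows "mumford_value (smult c u) p Q = mumford_value u p Q"
proof -
  obtain \<alpha> \<beta> where "affine_valuation f (ord_at f Q) \<alpha> \<beta>" using affine_pointE[OF assms(3)] by blast
  then interpret affine_valuation f "ord_at f Q" \<alpha> \<beta> .
  show ?thesis using w_poly_mult[of "[:c:]" u] assms(1,2) by (simp add: mumford_value_def)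
qed

lemma no_common_root:
  assumes "f = A\<^sup>2 + B\<^sup>2 * C" "poly A \<alpha> = 0" "poly B \<alpha> = 0"
  shows False
proof -
  have "[:- \<alpha>, 1:]\<^sup>2 dvd A\<^sup>2" "[:- \<alpha>, 1:]\<^sup>2 dvd B\<^sup>2"
    using assms(2,3) by (auto simp: poly_eq_0_iff_dvd intro: dvd_power_same)
  then have "[:- \<alpha>, 1:]\<^sup>2 dvd f" unfolding assms(1) by (intro dvd_add dvd_mult2)
  then have "2 \<le> Polynomial.order \<alpha> f" by (simp add: order_divides)
  moreover have "poly f \<alpha> = 0" using assms by simp
  ultimately show False using simple_roots[of \<alpha>] by simp
qed

end

section \<open>Halving the point makes \<open>a - x\<close> a square\<close>

locale hyperelliptic_over = odd_hyperelliptic f + coefficient_field K0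
  for f :: "'k::alg_closed_field poly" and K0 :: "'k set" +
  assumes f_over: "f \<in> poly_over K0"
begin

text \<open>
  Cantor's reduction. Reducing \<open>p\<close> modulo \<open>u\<close> does not affect the common zeros of \<open>u\<close> and \<open>y - p\<close>.
  If then \<open>degree u > g\<close>, the cofactor \<open>u'\<close> in \<open>u u' = f - p\<^sup>2\<close> has smaller degree than \<open>u\<close>, and passing
  to \<open>(u', - p)\<close> changes the divisor by that of \<open>(y - p) / u'\<close>.
\<close>

lemma mumford_reduction:
  assumes g: "degree f = 2 * g + 1"
    and "u \<in> PO" "p \<in> PO" "u \<noteq> 0" "u dvd f - p\<^sup>2"
  shows "\<exists>u1 p1 \<phi>. u1 \<in> PO \<and> p1 \<in> PO \<and> lead_coeff u1 = 1 \<and> degree u1 \<le> g \<and>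
    (p1 = 0 \<or> degree p1 < degree u1) \<and> u1 dvd f - p1\<^sup>2 \<and> \<phi> \<noteq> ff_zero \<and>
    (\<forall>Q \<in> affine_points f. mumford_value u p Q = mumford_value u1 p1 Q + ord_at f Q \<phi>)"
  using assms(2-5)
proof (induction "degree u" arbitrary: u p rule: less_induct)
  case less
  define p' where "p' = p mod u"
  have p'_eq: "p = p' + u * (p div u)" by (simp add: p'_def)
  have p'_PO: "p' \<in> PO" using less.prems by (simp add: p'_def PO_mod)
  have p'_deg: "p' = 0 \<or> degree p' < degree u" using degree_mod_less[OF less.prems(3)] by (simp add: p'_def)
  have "f - p'\<^sup>2 = (f - p\<^sup>2) + u * ((p div u) * (p + p'))"
  proof -
    have "p\<^sup>2 - p'\<^sup>2 = (p - p') * (p + p')" by (simp add: power2_eq_square algebra_simps)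
    also have "p - p' = u * (p div u)" using p'_eq by (metis add_diff_cancel_left')
    finally show ?thesis by (simp add: algebra_simps)
  qed
  then have p'_dvd: "u dvd f - p'\<^sup>2" using less.prems(4) by (metis dvd_add dvd_triv_left)
  have val: "mumford_value u p Q = mumford_value u p' Q" if "Q \<in> affine_points f" for Q
    using mumford_shift[OF less.prems(3) that, of p' "p div u"] p'_eq by simp
  show ?case
  proof (cases "degree u \<le> g")
    case True
    define c where "c = inverse (lead_coeff u)"
    have c: "c \<noteq> 0" "c \<in> K0" using less.prems by (simp_all add: c_def inverse_in coeff_in)
    have "mumford_value u p Q = mumford_value (smult c u) p' Q + ord_at f Q (ff_poly 1 0)"
      if Q: "Q \<in> affine_points f" for Q
    proof -
      interpret curve_valuation f "ord_at f Q" by (rule curve_valuation_ord_at[OF affine_in_curve[OF Q]])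
      show ?thesis using val[OF Q] mumford_smult[OF c(1) less.prems(3) Q] w_one by simp
    qed
    moreover have "lead_coeff (smult c u) = 1" using less.prems(3) by (simp add: c_def)
    moreover have "smult c u dvd f - p'\<^sup>2" using p'_dvd c(1) by (simp add: smult_dvd)
    ultimately show ?thesis using True c p'_PO p'_deg less.prems(1)
      by (intro exI[of _ "smult c u"] exI[of _ p'] exI[of _ "ff_poly 1 0"])
         (simp add: PO_smult ff_poly_eq_zero_iff)
  next
    case False
    obtain u' where u': "f - p'\<^sup>2 = u * u'" using p'_dvd by (auto elim: dvdE)
    have nz: "u' \<noteq> 0" using u' f_minus_square_nonzero[of p'] by auto
    have u'_PO: "u' \<in> PO"
      using PO_mult_cancel[OF less.prems(3,1), of u'] u'[symmetric] f_over p'_PO by (simp add: PO_closed)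
    have "degree (p'\<^sup>2) \<le> 2 * (degree u - 1)"
    proof (cases "p' = 0")
      case False
      then have "degree p' \<le> degree u - 1" using p'_deg by simp
      then show ?thesis using False by (simp add: degree_power_eq)
    qed simp
    then have "degree (f - p'\<^sup>2) \<le> max (2 * g + 1) (2 * (degree u - 1))"
      using degree_diff_le_max[of f "p'\<^sup>2"] g by simp
    then have "degree u + degree u' \<le> max (2 * g + 1) (2 * (degree u - 1))"
      using u' less.prems(3) nz by (simp add: degree_mult_eq)
    then have deg: "degree u' < degree u" using False by auto
    have "u' dvd f - (- p')\<^sup>2" using u' by simp
    from less.hyps[OF deg u'_PO PO_uminus[OF p'_PO] nz this]
    obtain u1 p1 \<phi> where 1: "u1 \<in> PO" "p1 \<in> PO" "lead_coeff u1 = 1" "degree u1 \<le> g"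
      "p1 = 0 \<or> degree p1 < degree u1" "u1 dvd f - p1\<^sup>2" and \<phi>: "\<phi> \<noteq> ff_zero"
      "\<And>Q. Q \<in> affine_points f \<Longrightarrow> mumford_value u' (- p') Q = mumford_value u1 p1 Q + ord_at f Q \<phi>"
      by blast
    have "ff_poly (- p') 1 \<noteq> ff_zero" "ff_poly u' 0 \<noteq> ff_zero" using nz by (simp_all add: ff_poly_eq_zero_iff)
    then obtain \<chi> where \<chi>: "\<chi> \<noteq> ff_zero"
      "\<And>Q. Q \<in> curve_points f \<Longrightarrow> ord_at f Q \<chi> = ord_at f Q (ff_poly (- p') 1) - ord_at f Q (ff_poly u' 0)"
      by (rule ff_quotient) blast
    have "mumford_value u p Q = mumford_value u1 p1 Q + ord_at f Q (ff_mult f \<chi> \<phi>)"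
      if Q: "Q \<in> affine_points f" for Q
    proof -
      interpret curve_valuation f "ord_at f Q" by (rule curve_valuation_ord_at[OF affine_in_curve[OF Q]])
      show ?thesis
        using val[OF Q] mumford_cantor_step[OF u'[symmetric] Q] \<phi>(2)[OF Q] \<chi>(2)[OF affine_in_curve[OF Q]]
          v_mult[OF \<chi>(1) \<phi>(1)] by simp
    qed
    then show ?thesis using 1 ff_mult_nonzero[OF \<chi>(1) \<phi>(1)] by blast
  qed
qed

text \<open>
  The line \<open>x = a\<close> meets the curve in \<open>(a, b)\<close> and \<open>(a, - b)\<close>, and touches it if these coincide.
\<close>

lemma ord_vertical_line:
  assumes on_curve: "b\<^sup>2 = poly f a" and Q: "Q \<in> affine_points f"
  shows "ord_at f Q (ff_poly [:- a, 1:] 0) =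
    (if Q = Affine_Point a b then 1 else 0) + (if Q = Affine_Point a (- b) then 1 else 0)"
proof -
  from Q obtain \<alpha> \<beta> where \<alpha>\<beta>: "Q = Affine_Point \<alpha> \<beta>" "\<beta>\<^sup>2 = poly f \<alpha>" "affine_valuation f (ord_at f Q) \<alpha> \<beta>"
    by (rule affine_pointE)
  interpret affine_valuation f "ord_at f Q" \<alpha> \<beta> by fact
  show ?thesis
  proof (cases "\<alpha> = a")
    case True
    then have "\<beta>\<^sup>2 = b\<^sup>2" using \<alpha>\<beta>(2) assms(1) by simp
    then have b: "\<beta> = b \<or> \<beta> = - b" by (auto simp: power2_eq_iff)
    have "b = - b \<longleftrightarrow> b = 0"
    proof
      assume "b = - b"
      then have "2 * b = 0" by (simp add: eq_neg_iff_add_eq_0)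
      then show "b = 0" using two_nonzero by simp
    qed simp
    then show ?thesis using True b w_x \<alpha>\<beta>(1) by auto
  next
    case False
    then show ?thesis using w_eq_0_iff[of "[:- a, 1:]" 0] \<alpha>\<beta>(1) by simp
  qed
qed

text \<open>
  The order of the norm at a point is the sum of the orders of the function at this point and at its
  conjugate. Over conjugate points the multiplicities of \<open>(u, p)\<close> add up to the order of \<open>u\<close>, and the
  point \<open>(a, b)\<close> contributes the divisor of \<open>x - a\<close>. A polynomial is determined by its orders up to a
  constant.
\<close>

lemma norm_of_halved_function:
  assumes on_curve: "b\<^sup>2 = poly f a" and u: "u dvd f - p\<^sup>2"
    and AB: "A \<noteq> 0 \<or> B \<noteq> 0"
    and ord: "\<And>Q. Q \<in> affine_points f \<Longrightarrow>
      ord_at f Q (ff_poly A B) = 2 * mumford_value u p Q + (if Q = Affine_Point a b then 1 else 0)"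
  obtains c where "c \<noteq> 0" "norm_poly f A B = smult c (u\<^sup>2 * [:- a, 1:])"
proof (rule poly_eq_smult_by_ord)
  obtain u' where u': "u * u' = f - p\<^sup>2" using u by (metis dvdE)
  have u_nz: "u \<noteq> 0" using u' f_minus_square_nonzero[of p] by auto
  show "norm_poly f A B \<noteq> 0" by (rule norm_poly_nonzero[OF AB])
  show "u\<^sup>2 * [:- a, 1:] \<noteq> 0" using u_nz by (simp del: mult_pCons_right)
  fix Q assume Q: "Q \<in> affine_points f"
  then obtain \<alpha> \<beta> where \<alpha>\<beta>: "Q = Affine_Point \<alpha> \<beta>" "\<beta>\<^sup>2 = poly f \<alpha>" "affine_valuation f (ord_at f Q) \<alpha> \<beta>"
    by (rule affine_pointE)
  interpret affine_valuation f "ord_at f Q" \<alpha> \<beta> by fact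
  have Q': "Affine_Point \<alpha> (- \<beta>) \<in> affine_points f" using \<alpha>\<beta>(2) by (simp add: affine_points_def)
  have "w A (- B) = 2 * min (w u 0) (w p 1) + (if Affine_Point \<alpha> (- \<beta>) = Affine_Point a b then 1 else 0)"
    using ord[OF Q'] mumford_conj[OF \<alpha>\<beta>(2), of u p] ord_at_conj[OF \<alpha>\<beta>(2), of A B] by (simp add: \<alpha>\<beta>(1))
  moreover have "w A B = 2 * min (w u 0) (w (- p) 1) + (if Q = Affine_Point a b then 1 else 0)"
    using ord[OF Q] by (simp add: mumford_value_def)
  moreover have "w (norm_poly f A B) 0 = w A B + w A (- B)" by (rule w_norm[OF AB])
  moreover have "min (w u 0) (w (- p) 1) + min (w u 0) (w p 1) = w u 0"
    by (rule branch_factor(2)[OF u' f_minus_square_nonzero])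
  ultimately have "w (norm_poly f A B) 0 = 2 * w u 0 + 
      (if Q = Affine_Point a b then 1 else 0) + (if Q = Affine_Point a (- b) then 1 else 0)"
    by (simp add: \<alpha>\<beta>(1) minus_equation_iff[of \<beta>] eq_commute[of "- b"])
  moreover have "w (u\<^sup>2 * [:- a, 1:]) 0 = 2 * w u 0 + w [:- a, 1:] 0"
    using w_poly_mult[of "u\<^sup>2" "[:- a, 1:]"] w_poly_power[OF u_nz, of 2] u_nz by (simp del: mult_pCons_right)
  moreover have "w [:- a, 1:] 0 = (if Q = Affine_Point a b then 1 else 0) + (if Q = Affine_Point a (- b) then 1 else 0)"
    by (rule ord_vertical_line[OF assms(1) Q])
  ultimately show "ord_at f Q (ff_poly (norm_poly f A B) 0) = ord_at f Q (ff_poly (u\<^sup>2 * [:- a, 1:]) 0)" by simp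
qed

text \<open>
  The root is \<open>A / B\<close>. A common root of \<open>B\<close> and \<open>f\<close> would be a root of \<open>A\<close> too and hence a double
  root of \<open>f\<close>, so \<open>B\<close> is invertible modulo \<open>f\<close>, with an inverse over \<open>K\<^sub>0\<close>.
\<close>

lemma square_of_representation:
  assumes A: "A \<in> PO" and B: "B \<in> PO" "B \<noteq> 0" and a: "a \<in> K0" and rep: "f = A\<^sup>2 + B\<^sup>2 * [:- a, 1:]"
  obtains q where "q \<in> PO" "f dvd q\<^sup>2 - [:a, -1:]"
proof -
  have "is_unit d" if d: "d dvd B" "d dvd f" for d
  proof (rule ccontr)
    assume "\<not> is_unit d"
    moreover have "d \<noteq> 0" using d(1) B(2) by auto
    ultimately obtain \<alpha> where "poly d \<alpha> = 0" using alg_closed_imp_poly_has_root[of d] is_unit_iff_degree[of d] by auto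
    then have "poly B \<alpha> = 0" "poly f \<alpha> = 0" using d by auto
    moreover from this have "poly A \<alpha> = 0" using arg_cong[OF rep, of "\<lambda>p. poly p \<alpha>"] by simp
    ultimately show False using no_common_root[OF rep] by blast
  qed
  then obtain s t where st: "s \<in> PO" "t \<in> PO" "s * B + t * f = 1"
    by (rule PO_bezout[OF B(1) f_over])
  have "(A * s)\<^sup>2 - [:a, -1:] = f * (s\<^sup>2 + (2 * t - t\<^sup>2 * f) * [:- a, 1:])"
  proof -
    have sB: "s * B = 1 - t * f" using st(3) by (simp add: eq_diff_eq)
    have "(A * s)\<^sup>2 = (f - B\<^sup>2 * [:- a, 1:]) * s\<^sup>2"
      using rep by (metis add_diff_cancel_right' power_mult_distrib)
    also have "\<dots> = f * s\<^sup>2 - (s * B)\<^sup>2 * [:- a, 1:]"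
    proof -
      have "(f - B\<^sup>2 * l) * s\<^sup>2 = f * s\<^sup>2 - (s * B)\<^sup>2 * l" for l
        by (simp add: power2_eq_square algebra_simps)
      then show ?thesis by blast
    qed
    also have "\<dots> = f * s\<^sup>2 - (1 - t * f)\<^sup>2 * [:- a, 1:]" by (simp only: sB)
    also have "\<dots> = f * (s\<^sup>2 + (2 * t - t\<^sup>2 * f) * [:- a, 1:]) - [:- a, 1:]"
    proof -
      have "f * k - (1 - t * f)\<^sup>2 * l = f * (k + (2 * t - t\<^sup>2 * f) * l) - l" for k l :: "'k poly"
        by (simp add: power2_eq_square algebra_simps)
      then show ?thesis by blast
    qed
    finally have e: "(A * s)\<^sup>2 = f * (s\<^sup>2 + (2 * t - t\<^sup>2 * f) * [:- a, 1:]) - [:- a, 1:]" .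
    have "[:- a, 1:] = - [:a, -1:]" by simp
    then show ?thesis unfolding e by simp
  qed
  then have "f dvd (A * s)\<^sup>2 - [:a, -1:]" by simp
  then show ?thesis using that[of "A * s"] A st by (simp add: PO_mult)
qed

text \<open>
  Dividing \<open>f - p\<^sup>2\<close> by \<open>u\<close> gives \<open>2 c p + c\<^sup>2 u + (x - a) u\<close>, and hence \<open>2 c p + c\<^sup>2 u\<close> is a polynomial
  over \<open>K\<^sub>0\<close>. Its coefficient of index \<open>g\<close> is \<open>c\<^sup>2\<close>; so \<open>2 c p\<close> is over \<open>K\<^sub>0\<close> as well, which puts \<open>c\<close>
  into \<open>K\<^sub>0\<close> unless \<open>p = 0\<close>. In that case \<open>u\<^sup>2\<close> would divide \<open>f\<close>.
\<close>

lemma descend_coefficient: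
  assumes "u \<in> PO" "p \<in> PO" "a \<in> K0" and lead: "lead_coeff u = 1" and u_deg: "degree u = g" "g \<ge> 1"
    and p_deg: "p = 0 \<or> degree p < degree u" and dvd: "u dvd f - p\<^sup>2"
    and rep: "f = (p + Polynomial.smult c u)\<^sup>2 + u\<^sup>2 * [:- a, 1:]"
  shows "c \<in> K0"
proof -
  have u_nz: "u \<noteq> 0" using u_deg by auto
  have p: "p \<noteq> 0"
  proof
    assume p: "p = 0"
    obtain \<alpha> where \<alpha>: "poly u \<alpha> = 0" using alg_closed_imp_poly_has_root[of u] u_deg by auto
    show False using no_common_root[OF rep _ \<alpha>] \<alpha> p by simp
  qed
  define r where "r = (f - p\<^sup>2) div u - u * [:- a, 1:]"
  have "f - p\<^sup>2 = u * (smult (2 * c) p + smult (c\<^sup>2) u + u * [:- a, 1:])"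
  proof -
    have "(p + k * u)\<^sup>2 + u\<^sup>2 * l - p\<^sup>2 = u * (2 * k * p + k\<^sup>2 * u + u * l)" for k l :: "'k poly"
      by (simp add: power2_eq_square algebra_simps)
    note this[of "[:c:]" "[:- a, 1:]"]
    moreover have "[:2 * c:] = 2 * [:c:]" "[:c\<^sup>2:] = [:c:]\<^sup>2"
      by (simp_all add: numeral_poly power2_eq_square)
    moreover have "smult k q = [:k:] * q" for k and q :: "'k poly" by simp
    ultimately show ?thesis by (subst rep) (simp only:)
  qed
  then have r: "r = smult (2 * c) p + smult (c\<^sup>2) u" using u_nz by (simp add: r_def del: mult_pCons_right)
  have "r \<in> PO" unfolding r_def using assms(1-3) f_over
    by (intro PO_diff PO_mult PO_div PO_power) (simp_all add: PO_pCons one_in uminus_in)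
  have "Polynomial.coeff p g = 0" using p_deg u_deg p by (simp add: coeff_eq_0)
  then have "Polynomial.coeff r g = c\<^sup>2" using lead u_deg by (simp add: r)
  then have "c\<^sup>2 \<in> K0" using coeff_in[OF \<open>r \<in> PO\<close>, of g] by simp
  then have "r - smult (c\<^sup>2) u \<in> PO" using \<open>r \<in> PO\<close> assms(1) by (simp add: PO_diff PO_smult)
  then have "smult (2 * c) p \<in> PO" by (simp add: r)
  then have "2 * c * lead_coeff p \<in> K0" using coeff_in[of "smult (2 * c) p" "degree p"] by simp
  moreover have "lead_coeff p \<in> K0" "2 \<in> K0" using coeff_in[OF assms(2)] add_in[OF one_in one_in] by simp_all
  ultimately have "2 * c * lead_coeff p / lead_coeff p / 2 \<in> K0" by (intro divide_in)
  then show ?thesis using p two_nonzero by simp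
qed

text \<open>
  The norm of \<open>\<phi>\<close> has degree at most \<open>2 g + 1\<close>, which leaves only \<open>y - A\<close>, up to a constant, for \<open>\<phi>\<close>.
  Both \<open>y - A\<close> and \<open>y - p\<close> vanish on the divisor of \<open>(u, p)\<close>. So the polynomial \<open>A - p\<close> vanishes on it
  and on its conjugate and is divisible by \<open>u\<close>.
\<close>

lemma square_of_halved_point:
  assumes g: "degree f = 2 * g + 1" "g \<ge> 1" and a: "a \<in> K0" and on_curve: "b\<^sup>2 = poly f a"
    and u: "u \<in> PO" "lead_coeff u = 1" "degree u \<le> g" and p: "p \<in> PO" "p = 0 \<or> degree p < degree u"
    and dvd: "u dvd f - p\<^sup>2" and \<phi>: "\<phi> \<noteq> ff_zero"
    and ord: "\<And>Q. Q \<in> affine_points f \<Longrightarrow>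
      ord_at f Q \<phi> = 2 * mumford_value u p Q + (if Q = Affine_Point a b then 1 else 0)"
  obtains q where "q \<in> PO" "f dvd q\<^sup>2 - [:a, -1:]"
proof -
  have u_nz: "u \<noteq> 0" using u(2) by auto
  have m_nonneg: "mumford_value u p Q \<ge> 0" if Q: "Q \<in> affine_points f" for Q
  proof -
    obtain \<alpha> \<beta> where "affine_valuation f (ord_at f Q) \<alpha> \<beta>" using affine_pointE[OF Q] by blast
    then interpret affine_valuation f "ord_at f Q" \<alpha> \<beta> .
    show ?thesis by (simp add: mumford_value_def w_nonneg)
  qed
  obtain A B where AB: "\<phi> = ff_poly A B"
  proof (rule regular_imp_poly[OF \<phi>])
    fix Q assume "Q \<in> affine_points f"
    then show "0 \<le> ord_at f Q \<phi>" using ord[of Q] m_nonneg[of Q] by (simp split: if_splits)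
  qed blast
  then have AB_nz: "A \<noteq> 0 \<or> B \<noteq> 0" using \<phi> by (auto simp: ff_poly_eq_zero_iff)
  obtain c where c: "c \<noteq> 0" "norm_poly f A B = smult c (u\<^sup>2 * [:- a, 1:])"
    using norm_of_halved_function[OF on_curve dvd AB_nz] ord unfolding AB by blast
  have "degree (u\<^sup>2 * [:- a, 1:]) = 2 * degree u + 1"
    using u_nz by (simp add: degree_mult_eq degree_power_eq del: mult_pCons_right)
  then have deg: "degree (norm_poly f A B) = 2 * degree u + 1" using c by simp
  \<comment> \<open>The odd degree of the norm forces the term \<open>f B\<^sup>2\<close> to dominate.\<close>
  have B: "B \<noteq> 0" "degree f + 2 * degree B = 2 * degree u + 1" "A \<noteq> 0 \<Longrightarrow> degree A \<le> degree u"
    using deg degree_norm_poly[OF AB_nz] by (auto simp: max_def split: if_splits) presburger+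
  then have "degree B = 0" and u_deg: "degree u = g" using g(1) u(3) by simp_all
  then obtain \<beta> where \<beta>: "B = [:\<beta>:]" "\<beta> \<noteq> 0" using B(1) by (metis degree_eq_zeroE pCons_0_0)
  \<comment> \<open>\<open>A + \<beta> y = \<beta> (y - A1)\<close>\<close>
  define A1 where "A1 = smult (- inverse \<beta>) A"
  have AA1: "A = [:\<beta>:] * - A1" using \<beta>(2) by (simp add: A1_def)
  have ord1: "ord_at f Q (ff_poly (- A1) 1) = 2 * mumford_value u p Q + (if Q = Affine_Point a b then 1 else 0)"
    if Q: "Q \<in> affine_points f" for Q
  proof -
    interpret curve_valuation f "ord_at f Q" by (rule curve_valuation_ord_at[OF affine_in_curve[OF Q]])
    show ?thesis using ord[OF Q] w_scale[of "[:\<beta>:]" "- A1" 1] \<beta> unfolding AB AA1 by simp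
  qed
  obtain c' where c': "norm_poly f (- A1) 1 = smult c' (u\<^sup>2 * [:- a, 1:])"
    using norm_of_halved_function[OF on_curve dvd _ ord1] by auto
  have A1_deg: "degree A1 \<le> g" using B(3) u_deg by (cases "A = 0") (simp_all add: A1_def)
  \<comment> \<open>The constant is determined by the leading coefficients of \<open>f\<close> and \<open>u\<close>.\<close>
  have rep: "f = A1\<^sup>2 + u\<^sup>2 * [:- a, 1:]"
  proof -
    have eq: "A1\<^sup>2 - f = smult c' (u\<^sup>2 * [:- a, 1:])" using c' by (simp add: norm_poly_def)
    have dA: "degree (A1\<^sup>2) < 2 * g + 1"
      using A1_deg degree_power_le[of A1 2] by linarith
    have "Polynomial.coeff (A1\<^sup>2 - f) (2 * g + 1) = -1"
      using dA monic g by (simp add: coeff_eq_0)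
    moreover have "lead_coeff (u\<^sup>2 * [:- a, 1:]) = 1"
      unfolding lead_coeff_mult lead_coeff_power using u(2) by simp
    then have "Polynomial.coeff (u\<^sup>2 * [:- a, 1:]) (2 * g + 1) = 1"
      using u_deg \<open>degree (u\<^sup>2 * [:- a, 1:]) = 2 * degree u + 1\<close> by simp
    ultimately have "c' = -1" unfolding eq by simp
    then show ?thesis using eq by (simp add: algebra_simps del: mult_pCons_right)
  qed
  have "u dvd A1 - p"
  proof (cases "A1 = p")
    case False
    obtain u' where u': "u * u' = f - p\<^sup>2" using dvd by (metis dvdE)
    show ?thesis
    proof (rule poly_dvd_by_ord)
      fix Q assume Q: "Q \<in> affine_points f"
      then obtain \<alpha> \<beta> where \<alpha>\<beta>: "Q = Affine_Point \<alpha> \<beta>" "\<beta>\<^sup>2 = poly f \<alpha>" "affine_valuation f (ord_at f Q) \<alpha> \<beta>"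
        by (rule affine_pointE)
      interpret affine_valuation f "ord_at f Q" \<alpha> \<beta> by fact
      let ?Q' = "Affine_Point \<alpha> (- \<beta>)"
      have Q': "?Q' \<in> affine_points f" using \<alpha>\<beta>(2) by (simp add: affine_points_def)
      let ?m = "min (w u 0) (w (- p) 1)" and ?m' = "min (w u 0) (w p 1)"
      have m: "?m \<ge> 0" "?m' \<ge> 0" by (simp_all add: w_nonneg)
      have "w (- A1) 1 \<ge> ?m" using ord1[OF Q] m unfolding mumford_value_def by auto
      then have ge: "w (A1 - p) 0 \<ge> ?m" using w_diff[of "- p" 1 "- A1" 1] False by auto
      have "w A1 1 \<ge> ?m'"
      proof -
        have "w A1 1 = ord_at f ?Q' (ff_poly (- A1) 1)"
          using ord_at_conj[OF \<alpha>\<beta>(2), of "- A1" 1] w_uminus[of A1 1] by (simp add: \<alpha>\<beta>(1))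
        then show ?thesis using ord1[OF Q'] mumford_conj[OF \<alpha>\<beta>(2), of u p] m by (simp add: \<alpha>\<beta>(1))
      qed
      then have ge': "w (A1 - p) 0 \<ge> ?m'" using w_diff[of A1 1 p 1] False by auto
      have sum: "w u 0 = ?m + ?m'" using branch_factor(2)[OF u' f_minus_square_nonzero] by simp
      show "w u 0 \<le> w (A1 - p) 0"
      proof (cases "w (- p) 1 > 0 \<and> w p 1 > 0 \<and> w u 0 > 0")
        case True
        then have b: "\<beta> = 0" "w (- p) 1 = 1" "w p 1 = 1" using both_branches[of p] by auto
        obtain k where "w (A1 - p) 0 = 2 * k" using even_w_ramified[OF b(1), of "A1 - p"] by (auto elim: evenE)
        then show ?thesis using sum ge b True by auto
      next
        case False
        then have "?m = 0 \<or> ?m' = 0" using m by auto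
        then show ?thesis using sum ge ge' by auto
      qed
    qed (use False u_nz in auto)
  qed simp
  then obtain k where k: "A1 - p = u * k" by (auto elim: dvdE)
  have "degree (A1 - p) \<le> g" using degree_diff_le[OF A1_deg, of p] p(2) u_deg by auto
  then have "degree k = 0" using k u_deg u_nz by (cases "k = 0") (simp_all add: degree_mult_eq)
  then obtain c where "k = [:c:]" by (rule degree_eq_zeroE)
  then have A1: "A1 = p + smult c u" using k by (simp add: algebra_simps)
  have "c \<in> K0" by (rule descend_coefficient[OF u(1) p(1) a u(2) u_deg g(2) p(2) dvd rep[unfolded A1]])
  then have "A1 \<in> PO" by (simp add: A1 PO_add PO_smult p(1) u(1))
  then show ?thesis using square_of_representation[OF _ u(1) u_nz a rep] that by blast
qed

lemma rat_fun_overE: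
  assumes "\<phi> \<in> rat_fun_over K0"
  obtains A B C where "A \<in> PO" "B \<in> PO" "C \<in> PO" "C \<noteq> 0" "ff_mult f (ff_poly C 0) \<phi> = ff_poly A B"
proof -
  obtain A B C D where *: "A \<in> PO" "B \<in> PO" "C \<in> PO" "D \<in> PO" "C \<noteq> 0" "D \<noteq> 0" "\<phi> = (Fract A C, Fract B D)"
    using assms unfolding rat_fun_over_def by blast
  show ?thesis
  proof (rule that[of "A * D" "B * C" "C * D"])
    show "ff_mult f (ff_poly (C * D) 0) \<phi> = ff_poly (A * D) (B * C)"
      using *(5,6) unfolding *(7) by (simp add: ff_mult_def ff_poly_def eq_fract fract_collapse)
  qed (use * in \<open>simp_all add: PO_mult\<close>)
qed

lemma ff_poly_rat_fun_over: "A \<in> PO \<Longrightarrow> B \<in> PO \<Longrightarrow> ff_poly A B \<in> rat_fun_over K0"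
  unfolding rat_fun_over_def ff_poly_def using PO_one one_neq_zero by blast

text \<open>
  If \<open>D\<close> has a pole at \<open>Q\<close>, the function over \<open>K\<^sub>0\<close> which describes \<open>D\<close> at \<open>Q\<close> has a denominator over
  \<open>K\<^sub>0\<close> that compensates it. The product over the finitely many points of the support serves for all of
  them.
\<close>

lemma clear_denominators:
  assumes fin: "finite {P. D P \<noteq> 0}" and D: "divisor_defined_over f K0 D"
  obtains h where "h \<in> PO" "h \<noteq> 0" "\<And>Q. Q \<in> affine_points f \<Longrightarrow> D Q + ord_at f Q (ff_poly h 0) \<ge> 0"
proof -
  have one: "\<exists>h \<in> PO. h \<noteq> 0 \<and> D Q + ord_at f Q (ff_poly h 0) \<ge> 0" if Q: "Q \<in> affine_points f" for Q
  proof -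
    obtain \<phi> where \<phi>: "\<phi> \<in> rat_fun_over K0" "\<phi> \<noteq> ff_zero" "ord_at f Q \<phi> = D Q"
      using D Q unfolding divisor_defined_over_def by blast
    obtain A B C where ABC: "C \<in> PO" "C \<noteq> 0" "ff_mult f (ff_poly C 0) \<phi> = ff_poly A B"
      using rat_fun_overE[OF \<phi>(1)] by metis
    obtain \<alpha> \<beta> where "affine_valuation f (ord_at f Q) \<alpha> \<beta>" using affine_pointE[OF Q] by blast
    then interpret affine_valuation f "ord_at f Q" \<alpha> \<beta> .
    have "D Q + w C 0 \<ge> 0" using v_fraction[OF \<phi>(2) ABC(2,3)] \<phi>(3) w_nonneg[of A B] by simp
    then show ?thesis using ABC by blast
  qed
  have nonneg: "ord_at f Q (ff_poly p 0) \<ge> 0" and mult: "p \<noteq> 0 \<Longrightarrow> q \<noteq> 0 \<Longrightarrow>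
      ord_at f Q (ff_poly (p * q) 0) = ord_at f Q (ff_poly p 0) + ord_at f Q (ff_poly q 0)"
    if Q: "Q \<in> affine_points f" for Q p q
  proof -
    obtain \<alpha> \<beta> where "affine_valuation f (ord_at f Q) \<alpha> \<beta>" using affine_pointE[OF Q] by blast
    then interpret affine_valuation f "ord_at f Q" \<alpha> \<beta> .
    show "w p 0 \<ge> 0" by (rule w_nonneg)
    show "p \<noteq> 0 \<Longrightarrow> q \<noteq> 0 \<Longrightarrow> w (p * q) 0 = w p 0 + w q 0" by (rule w_poly_mult)
  qed
  have "\<exists>h \<in> PO. h \<noteq> 0 \<and> (\<forall>Q \<in> S. D Q + ord_at f Q (ff_poly h 0) \<ge> 0)"
    if "finite S" "S \<subseteq> affine_points f" for S
    using that
  proof (induction S rule: finite_induct)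
    case empty
    then show ?case using PO_one by (intro bexI[of _ 1]) simp_all
  next
    case (insert P S)
    then obtain h where h: "h \<in> PO" "h \<noteq> 0" "\<And>Q. Q \<in> S \<Longrightarrow> D Q + ord_at f Q (ff_poly h 0) \<ge> 0" by blast
    obtain k where k: "k \<in> PO" "k \<noteq> 0" "D P + ord_at f P (ff_poly k 0) \<ge> 0" using one[of P] insert.prems by blast
    have "D Q + ord_at f Q (ff_poly (k * h) 0) \<ge> 0" if Q: "Q \<in> insert P S" for Q
    proof -
      have Q': "Q \<in> affine_points f" using Q insert.prems by blast
      have "D Q + ord_at f Q (ff_poly k 0) \<ge> 0 \<or> D Q + ord_at f Q (ff_poly h 0) \<ge> 0" using Q h(3) k(3) by blast
      then show ?thesis using mult[OF Q' k(2) h(2)] nonneg[OF Q', of k] nonneg[OF Q', of h] by linarith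
    qed
    then show ?case using h k by (intro bexI[of _ "k * h"]) (simp_all add: PO_mult)
  qed
  from this[of "{P. D P \<noteq> 0} \<inter> affine_points f"] fin
  obtain h where h: "h \<in> PO" "h \<noteq> 0" "\<And>Q. Q \<in> {P. D P \<noteq> 0} \<inter> affine_points f \<Longrightarrow> D Q + ord_at f Q (ff_poly h 0) \<ge> 0"
    by blast
  show ?thesis
  proof (rule that[OF h(1,2)])
    fix Q assume "Q \<in> affine_points f"
    then show "D Q + ord_at f Q (ff_poly h 0) \<ge> 0" using h(3)[of Q] nonneg[of Q h] by (cases "D Q = 0") auto
  qed
qed

text \<open>
  The Mumford representation. By definition a divisor over \<open>K\<^sub>0\<close> is, on the affine curve, the
  pointwise minimum of the divisors of the functions in \<open>K\<^sub>0(C)\<close> that are bounded below by it. After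
  multiplication by a common denominator \<open>h\<close>, these functions lie in \<open>K\<^sub>0[x, y]\<close> and form an ideal, so
  the minimum is attained at one of the two functions of a Hermite basis \<open>d u\<close>, \<open>d (y - p)\<close>.
\<close>

lemma mumford_representation:
  assumes fin: "finite {P. D P \<noteq> 0}" and D: "divisor_defined_over f K0 D"
  obtains \<chi> u p where "\<chi> \<noteq> ff_zero" "u \<in> PO" "p \<in> PO" "u \<noteq> 0" "u dvd f - p\<^sup>2"
    "\<And>Q. Q \<in> affine_points f \<Longrightarrow> D Q = mumford_value u p Q + ord_at f Q \<chi>"
proof -
  obtain h where h: "h \<in> PO" "h \<noteq> 0" and D_h: "\<And>Q. Q \<in> affine_points f \<Longrightarrow> D Q + ord_at f Q (ff_poly h 0) \<ge> 0"
    by (rule clear_denominators[OF fin D]) blast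
  define E where "E Q = D Q + ord_at f Q (ff_poly h 0)" for Q
  have h_nz: "ff_poly h 0 \<noteq> ff_zero" using h by (simp add: ff_poly_eq_zero_iff)
  \<comment> \<open>The pair \<open>(0, 0)\<close> needs separate treatment because the value of the zero function is 0.\<close>
  define I where "I = {(A, B). A \<in> PO \<and> B \<in> PO \<and> ((A \<noteq> 0 \<or> B \<noteq> 0) \<longrightarrow>
    (\<forall>Q \<in> affine_points f. E Q \<le> ord_at f Q (ff_poly A B)))}"
  have attained: "\<exists>A B. (A, B) \<in> I \<and> (A \<noteq> 0 \<or> B \<noteq> 0) \<and> ord_at f Q (ff_poly A B) = E Q"
    if Q: "Q \<in> affine_points f" for Q
  proof -
    obtain \<phi> where \<phi>: "\<phi> \<in> rat_fun_over K0" "\<phi> \<noteq> ff_zero" "ord_at f Q \<phi> = D Q"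
      "\<And>R. R \<in> affine_points f \<Longrightarrow> ord_at f R \<phi> \<ge> D R"
      using D Q unfolding divisor_defined_over_def by blast
    define \<psi> where "\<psi> = ff_mult f (ff_poly h 0) \<phi>"
    have \<psi>_nz: "\<psi> \<noteq> ff_zero" unfolding \<psi>_def by (rule ff_mult_nonzero[OF h_nz \<phi>(2)])
    have ord_\<psi>: "ord_at f R \<psi> = ord_at f R (ff_poly h 0) + ord_at f R \<phi>" if "R \<in> affine_points f" for R
      using curve_valuation.v_mult[OF curve_valuation_ord_at[OF affine_in_curve[OF that]] h_nz \<phi>(2)] by (simp add: \<psi>_def)
    have ge: "ord_at f R \<psi> \<ge> E R" if "R \<in> affine_points f" for R
      using ord_\<psi>[OF that] \<phi>(4)[OF that] by (simp add: E_def)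
    have "ord_at f R \<psi> \<ge> 0" if "R \<in> affine_points f" for R
      using ge[OF that] D_h[OF that] by (simp add: E_def)
    then obtain A B where AB: "\<psi> = ff_poly A B" using regular_imp_poly[OF \<psi>_nz] by blast
    obtain A' B' C where C: "A' \<in> PO" "B' \<in> PO" "C \<in> PO" "C \<noteq> 0" "ff_mult f (ff_poly C 0) \<phi> = ff_poly A' B'"
      using rat_fun_overE[OF \<phi>(1)] by metis
    have "ff_poly (C * A) (C * B) = ff_mult f (ff_poly h 0) (ff_mult f (ff_poly C 0) \<phi>)"
      using AB by (simp add: \<psi>_def ff_mult_poly ff_mult_left_commute[of f "ff_poly h 0"])
    then have "C * A = h * A'" "C * B = h * B'" by (simp_all add: C(5) ff_mult_poly ff_poly_eq_iff)
    then have "C * A \<in> PO" "C * B \<in> PO" using C(1,2) h(1) by (simp_all add: PO_mult)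
    then have "A \<in> PO" "B \<in> PO" by (simp_all only: PO_mult_cancel[OF C(4,3)])
    then have "(A, B) \<in> I" using ge by (simp add: I_def AB)
    moreover have "A \<noteq> 0 \<or> B \<noteq> 0" using \<psi>_nz by (auto simp: AB ff_poly_eq_zero_iff)
    moreover have "ord_at f Q (ff_poly A B) = E Q" using ord_\<psi>[OF Q] \<phi>(3) by (simp add: AB E_def)
    ultimately show ?thesis by blast
  qed
  obtain \<beta>0 where "\<beta>0\<^sup>2 = poly f 0" using point_above by blast
  then obtain A0 B0 where AB0: "(A0, B0) \<in> I" "A0 \<noteq> 0 \<or> B0 \<noteq> 0"
    using attained[of "Affine_Point 0 \<beta>0"] by (auto simp: affine_points_def)
  have I_add: "(A + C, B + D) \<in> I" if "(A, B) \<in> I" "(C, D) \<in> I" for A B C D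
  proof -
    have "E Q \<le> ord_at f Q (ff_poly (A + C) (B + D))"
      if Q: "Q \<in> affine_points f" and nz: "A + C \<noteq> 0 \<or> B + D \<noteq> 0" for Q
    proof -
      interpret curve_valuation f "ord_at f Q" by (rule curve_valuation_ord_at[OF affine_in_curve[OF Q]])
      have AB: "A \<noteq> 0 \<or> B \<noteq> 0 \<Longrightarrow> E Q \<le> w A B" and CD: "C \<noteq> 0 \<or> D \<noteq> 0 \<Longrightarrow> E Q \<le> w C D"
        using \<open>(A, B) \<in> I\<close> \<open>(C, D) \<in> I\<close> Q by (auto simp: I_def)
      show ?thesis
      proof (cases "(A \<noteq> 0 \<or> B \<noteq> 0) \<and> (C \<noteq> 0 \<or> D \<noteq> 0)")
        case True
        then show ?thesis using w_add[of A B C D] AB CD nz by auto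
      next
        case False
        then show ?thesis using AB CD nz by auto
      qed
    qed
    then show ?thesis using that by (auto simp: I_def PO_add)
  qed
  have I_mult: "(C * A + f * D * B, C * B + D * A) \<in> I"
    if AB: "(A, B) \<in> I" and CD: "C \<in> PO" "D \<in> PO" for A B C D
  proof -
    have "E Q \<le> ord_at f Q (ff_poly (C * A + f * D * B) (C * B + D * A))"
      if Q: "Q \<in> affine_points f" and nz: "C * A + f * D * B \<noteq> 0 \<or> C * B + D * A \<noteq> 0" for Q
    proof -
      obtain \<alpha> \<beta> where "affine_valuation f (ord_at f Q) \<alpha> \<beta>" using affine_pointE[OF Q] by blast
      then interpret affine_valuation f "ord_at f Q" \<alpha> \<beta> .
      have nz': "A \<noteq> 0 \<or> B \<noteq> 0" "C \<noteq> 0 \<or> D \<noteq> 0" using nz by auto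
      have "E Q \<le> w A B" using AB nz'(1) Q by (auto simp: I_def)
      then show ?thesis using w_mult[OF nz'(2,1)] w_nonneg[of C D] by simp
    qed
    then show ?thesis using AB CD f_over by (auto simp: I_def PO_closed)
  qed
  obtain d u p where d: "d \<in> PO" "u \<in> PO" "p \<in> PO" "d \<noteq> 0" "u \<noteq> 0" "u dvd f - p\<^sup>2"
      "(d * u, 0) \<in> I" "(- (d * p), d) \<in> I"
      and gen: "\<And>A B. (A, B) \<in> I \<Longrightarrow> \<exists>s t. A = s * (d * u) - t * (d * p) \<and> B = t * d"
  proof (rule PO_hermite[OF f_over norm_poly_nonzero _ AB0])
    show "I \<subseteq> PO \<times> PO" by (auto simp: I_def)
    show "(C * A, C * B) \<in> I" if "C \<in> PO" "(A, B) \<in> I" for A B C using I_mult[OF that(2,1), of 0] by simp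
    show "(f * B, A) \<in> I" if "(A, B) \<in> I" for A B using I_mult[OF that, of 0 1] by simp
    show "(A + C, B + D) \<in> I" if "(A, B) \<in> I" "(C, D) \<in> I" for A B C D using I_add[OF that] .
  qed (assumption | blast)+
  have E_eq: "E Q = ord_at f Q (ff_poly d 0) + mumford_value u p Q" if Q: "Q \<in> affine_points f" for Q
  proof -
    obtain \<alpha> \<beta> where "affine_valuation f (ord_at f Q) \<alpha> \<beta>" using affine_pointE[OF Q] by blast
    then interpret affine_valuation f "ord_at f Q" \<alpha> \<beta> .
    have du: "w (d * u) 0 = w d 0 + w u 0" using w_poly_mult[OF d(4,5)] .
    have dp: "w (- (d * p)) d = w d 0 + w (- p) 1" using w_scale[OF d(4), of "- p" 1] by simp
    have "E Q \<le> w (d * u) 0" "E Q \<le> w (- (d * p)) d"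
      using d(4,5,7,8) Q by (auto simp: I_def)
    then have le: "E Q \<le> w d 0 + mumford_value u p Q" using du dp by (simp add: mumford_value_def)
    obtain A B where AB: "(A, B) \<in> I" "A \<noteq> 0 \<or> B \<noteq> 0" "w A B = E Q" using attained[OF Q] by blast
    obtain s t where st: "A = s * (d * u) - t * (d * p)" "B = t * d" using gen[OF AB(1)] by blast
    have s: "w (s * (d * u)) 0 \<ge> w (d * u) 0" if "s \<noteq> 0"
      using w_poly_mult[OF that, of "d * u"] d(4,5) w_nonneg[of s 0] by simp
    have t: "w (t * - (d * p)) (t * d) \<ge> w (- (d * p)) d" if "t \<noteq> 0"
      using w_scale[OF that, of "- (d * p)" d] d(4) w_nonneg[of t 0] by simp
    have "w A B \<ge> min (w (d * u) 0) (w (- (d * p)) d)"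
    proof (cases "s = 0 \<or> t = 0")
      case True
      then show ?thesis using s t AB(2) unfolding st by auto
    next
      case False
      have "min (w (s * (d * u)) 0) (w (t * - (d * p)) (t * d)) \<le> w (s * (d * u) + t * - (d * p)) (0 + t * d)"
        by (rule w_add) (use False d(4,5) AB(2) st in auto)
      moreover have "s * (d * u) + t * - (d * p) = A" "0 + t * d = B" using st by simp_all
      ultimately show ?thesis using s t False by auto
    qed
    then show ?thesis using le AB(3) du dp by (simp add: mumford_value_def)
  qed
  have "ff_poly d 0 \<noteq> ff_zero" using d(4) by (simp add: ff_poly_eq_zero_iff)
  then obtain \<chi> where \<chi>: "\<chi> \<noteq> ff_zero"
      "\<And>P. P \<in> curve_points f \<Longrightarrow> ord_at f P \<chi> = ord_at f P (ff_poly d 0) - ord_at f P (ff_poly h 0)"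
    by (rule ff_quotient[OF _ h_nz]) blast
  have "D Q = mumford_value u p Q + ord_at f Q \<chi>" if "Q \<in> affine_points f" for Q
    using E_eq[OF that] \<chi>(2)[OF affine_in_curve[OF that]] by (simp add: E_def)
  then show ?thesis using that \<chi>(1) d(2,3,5,6) by blast
qed

text \<open>
  If \<open>D\<close> is the divisor of \<open>(u1, p1)\<close> plus that of \<open>\<rho>\<close>, then \<open>(x - a) \<phi> / \<rho>\<^sup>2\<close> has twice the divisor of
  \<open>(u1, p1)\<close>. The factor \<open>x - a\<close> replaces the pole at \<open>(a, b)\<close> by a zero at \<open>(a, - b)\<close>.
\<close>

lemma square_of_halved_class:
  assumes g: "degree f = 2 * g + 1" "g \<ge> 1" and a: "a \<in> K0" and on_curve: "b\<^sup>2 = poly f a"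
    and fin: "finite {P. D P \<noteq> 0}" and D: "divisor_defined_over f K0 D" and \<phi>: "\<phi> \<noteq> ff_zero"
    and ord: "\<And>Q. Q \<in> affine_points f \<Longrightarrow> ord_at f Q \<phi> = 2 * D Q - (if Q = Affine_Point a b then 1 else 0)"
  obtains q where "q \<in> PO" "f dvd q\<^sup>2 - [:a, -1:]"
proof -
  obtain \<chi> u p where \<chi>: "\<chi> \<noteq> ff_zero" "u \<in> PO" "p \<in> PO" "u \<noteq> 0" "u dvd f - p\<^sup>2"
    and D_eq: "\<And>Q. Q \<in> affine_points f \<Longrightarrow> D Q = mumford_value u p Q + ord_at f Q \<chi>"
    by (rule mumford_representation[OF fin D]) blast
  obtain u1 p1 \<psi> where u1: "u1 \<in> PO" "p1 \<in> PO" "lead_coeff u1 = 1" "degree u1 \<le> g"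
    "p1 = 0 \<or> degree p1 < degree u1" "u1 dvd f - p1\<^sup>2" "\<psi> \<noteq> ff_zero"
    and red: "\<And>Q. Q \<in> affine_points f \<Longrightarrow> mumford_value u p Q = mumford_value u1 p1 Q + ord_at f Q \<psi>"
    using mumford_reduction[OF g(1) \<chi>(2-5)] by blast
  define \<rho> where "\<rho> = ff_mult f \<chi> \<psi>"
  define \<sigma> where "\<sigma> = ff_mult f \<phi> (ff_poly [:- a, 1:] 0)"
  have line: "ff_poly [:- a, 1:] 0 \<noteq> ff_zero" by (simp add: ff_poly_eq_zero_iff)
  have \<rho>: "\<rho> \<noteq> ff_zero" unfolding \<rho>_def by (rule ff_mult_nonzero[OF \<chi>(1) u1(7)])
  have \<sigma>: "\<sigma> \<noteq> ff_zero" unfolding \<sigma>_def by (rule ff_mult_nonzero[OF \<phi> line])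
  obtain \<tau> where \<tau>: "\<tau> \<noteq> ff_zero"
    "\<And>P. P \<in> curve_points f \<Longrightarrow> ord_at f P \<tau> = ord_at f P \<sigma> - ord_at f P (ff_mult f \<rho> \<rho>)"
    by (rule ff_quotient[OF \<sigma> ff_mult_nonzero[OF \<rho> \<rho>]]) blast
  have "ord_at f Q \<tau> = 2 * mumford_value u1 p1 Q + (if Q = Affine_Point a (- b) then 1 else 0)"
    if Q: "Q \<in> affine_points f" for Q
  proof -
    interpret curve_valuation f "ord_at f Q" by (rule curve_valuation_ord_at[OF affine_in_curve[OF Q]])
    show ?thesis
      using \<tau>(2)[OF affine_in_curve[OF Q]] v_mult[OF \<rho> \<rho>] v_mult[OF \<chi>(1) u1(7)] v_mult[OF \<phi> line]
        ord[OF Q] D_eq[OF Q] red[OF Q] ord_vertical_line[OF on_curve Q]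
      by (simp add: \<rho>_def \<sigma>_def)
  qed
  moreover have "(- b)\<^sup>2 = poly f a" using on_curve by simp
  ultimately show ?thesis
    using square_of_halved_point[OF g a _ u1(1,3,4,2,5,6) \<tau>(1)] that by blast
qed

section \<open>A square root of \<open>a - x\<close> halves the point\<close>

text \<open>
  The degrees of \<open>A\<^sup>2\<close> and \<open>(x - a) B\<^sup>2\<close> have different parity and are at most \<open>2 g + 1\<close>, so their sum
  is a non-zero constant multiple of \<open>f\<close> as soon as \<open>f\<close> divides it. Since \<open>A(a)\<^sup>2 = b\<^sup>2\<close>, the sign of
  \<open>A\<close> can be chosen.
\<close>

lemma representation_of_square:
  assumes g: "degree f = 2 * g + 1" and a: "a \<in> K0" and on_curve: "b\<^sup>2 = poly f a"
    and q: "q \<in> PO" "f dvd q\<^sup>2 - [:a, -1:]"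
  obtains A B where "A \<in> PO" "B \<in> PO" "degree A \<le> g" "degree B = g" "lead_coeff B = 1"
    "poly A a = - b" "f = A\<^sup>2 + B\<^sup>2 * [:- a, 1:]"
proof -
  define l where "l = [:- a, 1:]"
  have l: "l \<in> PO" "l \<noteq> 0" "degree l = 1" "[:a, -1:] = - l"
    using a by (simp_all add: l_def PO_pCons one_in uminus_in)
  define q' where "q' = q mod f"
  have q': "q' \<in> PO" "q' = 0 \<or> degree q' < degree f"
    using q(1) f_over degree_mod_less[OF f_nonzero, of q] by (simp_all add: q'_def PO_mod)
  obtain B C where BC: "B \<in> PO" "C \<in> PO" "B \<noteq> 0" "degree B \<le> degree f - (g + 1)" "degree (B * q' - C * f) < g + 1"
    using PO_reconstruction[OF f_over q', of "g + 1"] g by auto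
  define A where "A = B * q' - C * f"
  have A: "A \<in> PO" "degree A \<le> g" and B: "degree B \<le> g"
    using BC g q' f_over by (simp_all add: A_def PO_closed)
  \<comment> \<open>\<open>A \<equiv> B q\<close> modulo \<open>f\<close>, hence \<open>A\<^sup>2 \<equiv> (a - x) B\<^sup>2\<close>.\<close>
  have "f dvd A\<^sup>2 + B\<^sup>2 * l"
  proof -
    have "f dvd q - q'" by (simp add: q'_def minus_mod_eq_mult_div)
    then have "f dvd (q - q') * (q + q') * B\<^sup>2" by (simp add: dvd_mult2)
    moreover have "f dvd (q\<^sup>2 + l) * B\<^sup>2" using q(2) l(4) by (simp add: dvd_mult2)
    moreover have "A\<^sup>2 + B\<^sup>2 * l = (q\<^sup>2 + l) * B\<^sup>2 - (q - q') * (q + q') * B\<^sup>2 + f * (C * (C * f - 2 * B * q'))"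
      by (simp add: A_def power2_eq_square algebra_simps)
    ultimately show ?thesis by (simp add: dvd_add dvd_diff)
  qed
  then obtain k where k: "A\<^sup>2 + B\<^sup>2 * l = f * k" by (auto elim: dvdE)
  have dA: "degree (A\<^sup>2) < 2 * g + 1" using degree_power_le[of A 2] A(2) by linarith
  have dB: "degree (B\<^sup>2 * l) = 2 * degree B + 1"
    using BC(3) l by (simp add: degree_mult_eq degree_power_eq)
  have k_nz: "k \<noteq> 0"
  proof
    assume "k = 0"
    then have "A\<^sup>2 = - (B\<^sup>2 * l)" using k by (simp add: eq_neg_iff_add_eq_0)
    then have "degree (A\<^sup>2) = 2 * degree B + 1" using dB by simp
    then have "2 * degree A = 2 * degree B + 1" by (cases "A = 0") (simp_all add: degree_power_eq)
    then show False by presburger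
  qed
  have "degree (A\<^sup>2 + B\<^sup>2 * l) \<le> 2 * g + 1" using dA dB B by (intro degree_add_le) simp_all
  then have "degree k = 0" using k k_nz g by (simp add: degree_mult_eq)
  then obtain \<kappa> where \<kappa>: "k = [:\<kappa>:]" "\<kappa> \<noteq> 0" using k_nz by (metis degree_eq_zeroE pCons_0_0)
  have "Polynomial.coeff (A\<^sup>2 + B\<^sup>2 * l) (2 * g + 1) = \<kappa>"
    using monic g by (simp add: k \<kappa>)
  then have coeff: "Polynomial.coeff (B\<^sup>2 * l) (2 * g + 1) = \<kappa>" using dA by (simp add: coeff_eq_0)
  then have "\<not> degree (B\<^sup>2 * l) < 2 * g + 1" using \<kappa>(2) coeff_eq_0 by metis
  then have B_deg: "degree B = g" using dB B by simp
  define \<beta> where "\<beta> = lead_coeff B"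
  have "lead_coeff (B\<^sup>2 * l) = \<beta>\<^sup>2" unfolding lead_coeff_mult lead_coeff_power by (simp add: \<beta>_def l_def)
  moreover have "\<beta> \<noteq> 0" "\<beta> \<in> K0" using BC(1,3) by (simp_all add: \<beta>_def coeff_in)
  ultimately have \<beta>: "\<beta>\<^sup>2 = \<kappa>" "\<beta> \<noteq> 0" "\<beta> \<in> K0" using coeff dB B_deg by simp_all
  define A1 B1 where "A1 = smult (inverse \<beta>) A" and "B1 = smult (inverse \<beta>) B"
  have rep1: "f = A1\<^sup>2 + B1\<^sup>2 * l"
  proof -
    have "A1\<^sup>2 + B1\<^sup>2 * l = smult ((inverse \<beta>)\<^sup>2) (A\<^sup>2 + B\<^sup>2 * l)"
      by (simp add: A1_def B1_def power2_eq_square smult_add_right)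
    also have "\<dots> = f" using \<beta> \<kappa> by (simp add: k power_inverse)
    finally show ?thesis by simp
  qed
  have AB1: "A1 \<in> PO" "B1 \<in> PO" "degree A1 \<le> g" "degree B1 = g" "lead_coeff B1 = 1"
    using A BC(1) B_deg \<beta> by (simp_all add: A1_def B1_def PO_smult inverse_in \<beta>_def)
  have "b\<^sup>2 = (poly A1 a)\<^sup>2" using on_curve by (subst (asm) rep1) (simp add: l_def)
  then consider "poly A1 a = - b" | "poly (- A1) a = - b" by (auto simp: power2_eq_iff)
  then show ?thesis
  proof cases
    case 1
    then show ?thesis using that[of A1 B1] AB1 rep1 by (simp add: l_def)
  next
    case 2
    then show ?thesis using that[of "- A1" B1] AB1 rep1 by (simp add: l_def PO_uminus)
  qed
qed

text \<open>
  The half is \<open>E - g \<infinity>\<close>, where \<open>E\<close> is the divisor of \<open>(B, A)\<close>. Above a root \<open>\<alpha>\<close> of \<open>B\<close> it contains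
  only the point \<open>(\<alpha>, A(\<alpha>))\<close>, which is not a ramification point, with the multiplicity of \<open>\<alpha>\<close>; this
  explicit form shows that its degree is that of \<open>B\<close>.
\<close>

lemma halved_divisor:
  assumes g: "degree f = 2 * g + 1" and on_curve: "b\<^sup>2 = poly f a"
    and A: "A \<in> PO" "degree A \<le> g" "poly A a = - b" and B: "B \<in> PO" "degree B = g" "lead_coeff B = 1"
    and rep: "f = A\<^sup>2 + B\<^sup>2 * [:- a, 1:]"
  obtains D \<phi> where "D \<in> carrier (degree_zero_divisors f)" "divisor_defined_over f K0 D" "\<phi> \<noteq> ff_zero"
    "\<And>Q. Q \<in> curve_points f \<Longrightarrow>
      ord_at f Q \<phi> = 2 * D Q - (point_divisor (Affine_Point a b) Q - point_divisor Infinite_Point Q)"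
proof -
  define D :: "'k divisor" where "D Q = (case Q of Infinite_Point \<Rightarrow> - int g
    | Affine_Point \<alpha> \<beta> \<Rightarrow> if \<beta> = poly A \<alpha> then int (Polynomial.order \<alpha> B) else 0)" for Q
  have B_nz: "B \<noteq> 0" using B(3) by auto
  let ?S = "{\<alpha>. poly B \<alpha> = 0}"
  let ?p = "\<lambda>\<alpha>. Affine_Point \<alpha> (poly A \<alpha>)"
  have fin: "finite ?S" using poly_roots_finite[OF B_nz] .
  have supp: "{P. D P \<noteq> 0} \<subseteq> insert Infinite_Point (?p ` ?S)"
  proof
    fix P assume "P \<in> {P. D P \<noteq> 0}"
    then show "P \<in> insert Infinite_Point (?p ` ?S)"
      by (cases P) (auto simp: D_def order_root split: if_splits)
  qed
  have "divisor_degree D = (\<Sum>P \<in> insert Infinite_Point (?p ` ?S). D P)"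
    unfolding divisor_degree_def using supp fin by (intro sum.mono_neutral_left) auto
  also have "\<dots> = - int g + (\<Sum>P \<in> ?p ` ?S. D P)"
    using fin by (subst sum.insert) (auto simp: D_def)
  also have "(\<Sum>P \<in> ?p ` ?S. D P) = (\<Sum>\<alpha> \<in> ?S. D (?p \<alpha>))"
    by (subst sum.reindex) (auto simp: inj_on_def)
  also have "\<dots> = int (\<Sum>\<alpha> \<in> ?S. Polynomial.order \<alpha> B)" by (simp add: D_def)
  also have "\<dots> = int g" using alg_closed_sum_order[OF B_nz] B(2) by simp
  finally have deg: "divisor_degree D = 0" by simp
  have "?p \<alpha> \<in> curve_points f" if "poly B \<alpha> = 0" for \<alpha>
  proof -
    have "poly f \<alpha> = (poly A \<alpha>)\<^sup>2" by (subst rep) (simp add: that)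
    then show ?thesis by (simp add: curve_points_def affine_points_def)
  qed
  then have "{P. D P \<noteq> 0} \<subseteq> curve_points f" using supp by (auto simp: curve_points_def)
  moreover have "finite {P. D P \<noteq> 0}" using finite_subset[OF supp] fin by simp
  ultimately have carrier: "D \<in> carrier (degree_zero_divisors f)" using deg by (simp add: degree_zero_divisors_def)

  have f_A: "f - A\<^sup>2 = B\<^sup>2 * [:- a, 1:]" by (subst rep) simp
  \<comment> \<open>On the affine curve, the divisor of \<open>y - A\<close> is twice \<open>D\<close> plus the point \<open>(a, - b)\<close>.\<close>
  have local: "D Q = mumford_value B A Q \<and>
    ord_at f Q (ff_poly (- A) 1) = 2 * D Q + (if Q = Affine_Point a (- b) then 1 else 0)"
    if Q: "Q \<in> affine_points f" for Q
  proof -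
    from Q obtain \<alpha> \<beta> where \<alpha>\<beta>: "Q = Affine_Point \<alpha> \<beta>" "\<beta>\<^sup>2 = poly f \<alpha>" "affine_valuation f (ord_at f Q) \<alpha> \<beta>"
      by (rule affine_pointE)
    interpret affine_valuation f "ord_at f Q" \<alpha> \<beta> by fact
    have "w (B\<^sup>2 * [:- a, 1:]) 0 = 2 * w B 0 + w [:- a, 1:] 0"
      using w_poly_mult[of "B\<^sup>2" "[:- a, 1:]"] w_poly_power[OF B_nz, of 2] B_nz by (simp del: mult_pCons_right)
    then have sum: "w (- A) 1 + w A 1 = 2 * w B 0 + w [:- a, 1:] 0"
      using w_norm_branches[of A] f_A by simp
    have line: "w [:- a, 1:] 0 = (if Q = Affine_Point a b then 1 else 0) + (if Q = Affine_Point a (- b) then 1 else 0)"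
      by (rule ord_vertical_line[OF assms(2) Q])
    have nn: "w (- A) 1 \<ge> 0" "w A 1 \<ge> 0" by (simp_all add: w_nonneg)
    have two: "x + x = 0 \<Longrightarrow> x = 0" for x :: 'k using two_nonzero by (metis mult_2 mult_eq_0_iff)
    show ?thesis
    proof (cases "poly B \<alpha> = 0")
      case False
      then have wB: "w B 0 = 0" and DQ: "D Q = 0"
        using w_eq_0_iff[of B 0] B_nz by (simp_all add: D_def \<alpha>\<beta>(1) order_0I)
      have "w (- A) 1 = (if Q = Affine_Point a (- b) then 1 else 0)"
      proof (cases "\<alpha> = a")
        case False
        then show ?thesis using sum line wB nn \<alpha>\<beta>(1) by simp
      next
        case True
        have "\<beta>\<^sup>2 = b\<^sup>2" using \<alpha>\<beta>(2) True assms(2) by simp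
        then have "\<beta> = b \<or> \<beta> = - b" by (simp add: power2_eq_iff)
        then consider "b = 0" "\<beta> = 0" | "b \<noteq> 0" "\<beta> = b" | "b \<noteq> 0" "\<beta> = - b"
          by (cases "b = 0") auto
        then show ?thesis
        proof cases
          case 1
          then show ?thesis using w_ramified_branch[of "- A"] A(3) True \<alpha>\<beta>(1) by simp
        next
          case 2
          then have "ev (- A) 1 \<noteq> 0" using A(3) True two[of b] by auto
          then have "w (- A) 1 = 0" using w_eq_0_iff[of "- A" 1] by simp
          then show ?thesis using 2 \<alpha>\<beta>(1) two[of b] by (auto simp: eq_neg_iff_add_eq_0)
        next
          case 3
          then have "ev A 1 \<noteq> 0" using A(3) True two[of b] by (auto simp: algebra_simps neg_eq_iff_add_eq_0)
          then have "w A 1 = 0" using w_eq_0_iff[of A 1] by simp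
          then show ?thesis using 3 sum line wB True \<alpha>\<beta>(1) two[of b] by (auto simp: neg_eq_iff_add_eq_0)
        qed
      qed
      then show ?thesis using wB DQ nn by (simp add: mumford_value_def)
    next
      case True
      have A_nz: "poly A \<alpha> \<noteq> 0" using no_common_root[OF rep _ True] by blast
      have "\<beta>\<^sup>2 = (poly A \<alpha>)\<^sup>2" unfolding \<alpha>\<beta>(2) by (subst rep) (simp add: True)
      then have \<beta>: "\<beta> = poly A \<alpha> \<or> \<beta> = - poly A \<alpha>" by (auto simp: power2_eq_iff)
      then have \<beta>_nz: "\<beta> \<noteq> 0" using A_nz by auto
      have at_P: "Q = Affine_Point a b \<Longrightarrow> \<beta> = - poly A \<alpha>" "Q = Affine_Point a (- b) \<Longrightarrow> \<beta> = poly A \<alpha>"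
        using A(3) \<alpha>\<beta>(1) by auto
      have ne: "poly A \<alpha> \<noteq> - poly A \<alpha>" using two[of "poly A \<alpha>"] A_nz by (auto simp: eq_neg_iff_add_eq_0)
      have wB: "w B 0 = int (Polynomial.order \<alpha> B)" using w_poly_eq[OF B_nz] \<beta>_nz by simp
      show ?thesis
      proof (cases "\<beta> = poly A \<alpha>")
        case eq: True
        have "ev A 1 \<noteq> 0" using eq two[of "poly A \<alpha>"] A_nz by auto
        then have "w A 1 = 0" using w_eq_0_iff[of A 1] by simp
        moreover have "Q \<noteq> Affine_Point a b" using at_P(1) eq ne by auto
        ultimately have "w (- A) 1 = 2 * w B 0 + (if Q = Affine_Point a (- b) then 1 else 0)" using sum line by simp
        moreover have "D Q = w B 0" using eq wB by (simp add: D_def \<alpha>\<beta>(1))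
        ultimately show ?thesis using w_nonneg[of B 0] by (simp add: mumford_value_def)
      next
        case neq: False
        then have "ev (- A) 1 \<noteq> 0" by simp
        then have "w (- A) 1 = 0" using w_eq_0_iff[of "- A" 1] by simp
        moreover have "Q \<noteq> Affine_Point a (- b)" using at_P(2) neq by auto
        moreover have "D Q = 0" using neq by (simp add: D_def \<alpha>\<beta>(1))
        ultimately show ?thesis using w_nonneg[of B 0] by (simp add: mumford_value_def)
      qed
    qed
  qed

  have defined: "divisor_defined_over f K0 D"
    unfolding divisor_defined_over_def
  proof
    fix Q assume Q: "Q \<in> affine_points f"
    have "ff_poly B 0 \<in> rat_fun_over K0" "ff_poly (- A) 1 \<in> rat_fun_over K0"
      using A(1) B(1) by (auto intro: ff_poly_rat_fun_over PO_uminus)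
    moreover have "ff_poly B 0 \<noteq> ff_zero" "ff_poly (- A) 1 \<noteq> ff_zero" using B_nz by (simp_all add: ff_poly_eq_zero_iff)
    moreover have D_min: "D R = min (ord_at f R (ff_poly B 0)) (ord_at f R (ff_poly (- A) 1))"
      if "R \<in> affine_points f" for R
      using local[OF that] unfolding mumford_value_def by (rule conjunct1)
    moreover have "D R \<le> ord_at f R (ff_poly B 0)" "D R \<le> ord_at f R (ff_poly (- A) 1)"
      if "R \<in> affine_points f" for R
      unfolding D_min[OF that] by (rule min.cobounded1 min.cobounded2)+
    moreover have "ord_at f Q (ff_poly B 0) = D Q \<or> ord_at f Q (ff_poly (- A) 1) = D Q"
      unfolding D_min[OF Q] by (simp add: min_def)
    ultimately show "\<exists>\<phi> \<in> rat_fun_over K0. \<phi> \<noteq> ff_zero \<and> ord_at f Q \<phi> = D Q \<and>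
      (\<forall>R \<in> affine_points f. D R \<le> ord_at f R \<phi>)" by blast
  qed

  have nz: "ff_poly (- A) 1 \<noteq> ff_zero" "ff_poly [:- a, 1:] 0 \<noteq> ff_zero" by (simp_all add: ff_poly_eq_zero_iff)
  obtain \<phi> where \<phi>: "\<phi> \<noteq> ff_zero" "\<And>P. P \<in> curve_points f \<Longrightarrow>
      ord_at f P \<phi> = ord_at f P (ff_poly (- A) 1) - ord_at f P (ff_poly [:- a, 1:] 0)"
    by (rule ff_quotient[OF nz]) blast
  have "ord_at f Q \<phi> = 2 * D Q - (point_divisor (Affine_Point a b) Q - point_divisor Infinite_Point Q)"
    if Q: "Q \<in> curve_points f" for Q
  proof (cases "Q = Infinite_Point")
    case True
    interpret infinite_valuation f "ord_at f Q" unfolding True by (rule infinite_valuation_ord_at)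
    have "degree (norm_poly f (- A) 1) = 2 * g + 1"
      using degree_norm_poly[of "- A" 1] A(2) g by simp
    moreover have "degree (norm_poly f [:- a, 1:] 0) = 2"
      by (simp add: degree_norm_poly)
    ultimately show ?thesis
      using \<phi>(2)[OF Q] w_eq_degree[of "- A" 1] w_eq_degree[of "[:- a, 1:]" 0] True
      by (simp add: D_def point_divisor_def)
  next
    case False
    then have Q': "Q \<in> affine_points f" using Q by (simp add: curve_points_def)
    show ?thesis
      using \<phi>(2)[OF Q] local[OF Q'] ord_vertical_line[OF on_curve Q'] False by (simp add: point_divisor_def)
  qed
  then show ?thesis using that carrier defined \<phi>(1) by blast
qed

lemma half_exists_iff_square:
  assumes g: "degree f = 2 * g + 1" "g \<ge> 1" and a: "a \<in> K0" and on_curve: "b\<^sup>2 = poly f a"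
  shows "(\<exists>D \<phi>. D \<in> carrier (degree_zero_divisors f) \<and> divisor_defined_over f K0 D \<and> \<phi> \<noteq> ff_zero \<and>
      (\<forall>Q \<in> curve_points f. ord_at f Q \<phi> =
        2 * D Q - (point_divisor (Affine_Point a b) Q - point_divisor Infinite_Point Q)))
    \<longleftrightarrow> (\<exists>q \<in> PO. f dvd q\<^sup>2 - [:a, -1:])" (is "?L \<longleftrightarrow> ?R")
proof
  assume ?L
  then obtain D \<phi> where D: "D \<in> carrier (degree_zero_divisors f)" "divisor_defined_over f K0 D" "\<phi> \<noteq> ff_zero"
    and ord: "\<And>Q. Q \<in> curve_points f \<Longrightarrow> ord_at f Q \<phi> =
        2 * D Q - (point_divisor (Affine_Point a b) Q - point_divisor Infinite_Point Q)" by blast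
  have "finite {P. D P \<noteq> 0}" using D(1) by (simp add: degree_zero_divisors_def)
  moreover have "ord_at f Q \<phi> = 2 * D Q - (if Q = Affine_Point a b then 1 else 0)" if "Q \<in> affine_points f" for Q
    using ord[OF affine_in_curve[OF that]] that by (auto simp: point_divisor_def affine_points_def)
  ultimately show ?R using square_of_halved_class[OF g a on_curve _ D(2,3)] by blast
next
  assume ?R
  then obtain q where q: "q \<in> PO" "f dvd q\<^sup>2 - [:a, -1:]" by blast
  obtain A B where "A \<in> PO" "B \<in> PO" "degree A \<le> g" "degree B = g" "lead_coeff B = 1"
    "poly A a = - b" "f = A\<^sup>2 + B\<^sup>2 * [:- a, 1:]"
    by (rule representation_of_square[OF g(1) a on_curve q]) blast
  from halved_divisor[OF g(1) on_curve this(1,3,6,2,4,5,7)] show ?L by metis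
qed

end

section \<open>The jacobian and the quotient algebra\<close>

context odd_hyperelliptic
begin

lemma principal_divisor_mult:
  assumes "\<phi> \<noteq> ff_zero" "\<psi> \<noteq> ff_zero"
  shows "principal_divisor f (ff_mult f \<phi> \<psi>) = (\<lambda>P. principal_divisor f \<phi> P + principal_divisor f \<psi> P)"
proof
  fix P
  show "principal_divisor f (ff_mult f \<phi> \<psi>) P = principal_divisor f \<phi> P + principal_divisor f \<psi> P"
  proof (cases "P \<in> curve_points f")
    case True
    then interpret curve_valuation f "ord_at f P" by (rule curve_valuation_ord_at)
    show ?thesis using v_mult[OF assms] True by (simp add: principal_divisor_def)
  qed (simp add: principal_divisor_def)
qed

lemma principal_divisors_add:
  assumes "h \<in> principal_divisors f" "h' \<in> principal_divisors f"
  shows "(\<lambda>P. h P + h' P) \<in> principal_divisors f"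
proof -
  obtain \<phi> \<psi> where "\<phi> \<noteq> ff_zero" "h = principal_divisor f \<phi>" "\<psi> \<noteq> ff_zero" "h' = principal_divisor f \<psi>"
    using assms unfolding principal_divisors_def by blast
  then have "(\<lambda>P. h P + h' P) = principal_divisor f (ff_mult f \<phi> \<psi>)" "ff_mult f \<phi> \<psi> \<noteq> ff_zero"
    by (simp_all add: principal_divisor_mult ff_mult_nonzero)
  then show ?thesis unfolding principal_divisors_def by blast
qed

lemma principal_divisors_zero: "(\<lambda>P. 0) \<in> principal_divisors f"
proof -
  have "principal_divisor f (ff_poly 1 0) = (\<lambda>P. 0)"
    using curve_valuation.w_one[OF curve_valuation_ord_at] by (auto simp: principal_divisor_def)
  then show ?thesis unfolding principal_divisors_def
    by (metis (mono_tags, lifting) ff_poly_eq_zero_iff mem_Collect_eq one_neq_zero)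
qed

lemma principal_divisors_uminus:
  assumes "h \<in> principal_divisors f" shows "(\<lambda>P. - h P) \<in> principal_divisors f"
proof -
  obtain \<phi> where \<phi>: "\<phi> \<noteq> ff_zero" "h = principal_divisor f \<phi>" using assms unfolding principal_divisors_def by blast
  obtain \<psi> where \<psi>: "\<psi> \<noteq> ff_zero" "ff_mult f \<phi> \<psi> = ff_poly 1 0" using ff_inverse[OF \<phi>(1)] by blast
  have "- h P = principal_divisor f \<psi> P" for P
  proof (cases "P \<in> curve_points f")
    case True
    then interpret curve_valuation f "ord_at f P" by (rule curve_valuation_ord_at)
    show ?thesis using v_mult[OF \<phi>(1) \<psi>(1)] \<psi>(2) w_one True by (simp add: \<phi>(2) principal_divisor_def)
  qed (simp add: \<phi>(2) principal_divisor_def)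
  then have "(\<lambda>P. - h P) = principal_divisor f \<psi>" by auto
  then show ?thesis using \<psi>(1) unfolding principal_divisors_def by blast
qed

lemma mem_divisor_class: "x \<in> divisor_class f D \<longleftrightarrow> (\<lambda>P. x P - D P) \<in> principal_divisors f"
proof -
  have "x \<in> divisor_class f D \<longleftrightarrow> (\<exists>h \<in> principal_divisors f. x = (\<lambda>P. h P + D P))"
    by (auto simp: divisor_class_def r_coset_def degree_zero_divisors_def)
  also have "\<dots> \<longleftrightarrow> (\<exists>h \<in> principal_divisors f. h = (\<lambda>P. x P - D P))"
    by (intro bex_cong refl) (auto simp: fun_eq_iff)
  finally show ?thesis by simp
qed

lemma divisor_class_eq_iff:
  "divisor_class f D = divisor_class f E \<longleftrightarrow> (\<lambda>P. D P - E P) \<in> principal_divisors f"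
proof
  assume "divisor_class f D = divisor_class f E"
  moreover have "D \<in> divisor_class f D" by (simp add: mem_divisor_class principal_divisors_zero)
  ultimately show "(\<lambda>P. D P - E P) \<in> principal_divisors f" by (simp add: mem_divisor_class)
next
  have sub: "divisor_class f D \<subseteq> divisor_class f E" if d: "(\<lambda>P. D P - E P) \<in> principal_divisors f" for D E
  proof
    fix x assume "x \<in> divisor_class f D"
    then have "(\<lambda>P. (x P - D P) + (D P - E P)) \<in> principal_divisors f"
      using d unfolding mem_divisor_class by (rule principal_divisors_add)
    then show "x \<in> divisor_class f E" by (simp add: mem_divisor_class)
  qed
  assume d: "(\<lambda>P. D P - E P) \<in> principal_divisors f"
  then have "(\<lambda>P. - (D P - E P)) \<in> principal_divisors f" by (rule principal_divisors_uminus)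
  then have "(\<lambda>P. E P - D P) \<in> principal_divisors f" by simp
  then show "divisor_class f D = divisor_class f E" using sub[OF d] sub[of E D] by blast
qed

text \<open>
  The product in the quotient group is the sum of cosets, and the principal divisors are closed under
  sums.
\<close>

lemma double_divisor_class:
  "divisor_class f D \<otimes>\<^bsub>jacobian_over f K0\<^esub> divisor_class f D = divisor_class f (\<lambda>P. 2 * D P)"
proof -
  have mult: "divisor_class f D \<otimes>\<^bsub>jacobian_over f K0\<^esub> divisor_class f D =
      (\<Union>x \<in> divisor_class f D. \<Union>y \<in> divisor_class f D. {\<lambda>P. x P + y P})"
    by (simp add: jacobian_over_def jacobian_def FactGroup_def set_mult_def degree_zero_divisors_def)
  show ?thesis
    unfolding mult
  proof (intro equalityI subsetI)
    fix z assume "z \<in> (\<Union>x \<in> divisor_class f D. \<Union>y \<in> divisor_class f D. {\<lambda>P. x P + y P})"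
    then obtain x y where xy: "(\<lambda>P. x P - D P) \<in> principal_divisors f" "(\<lambda>P. y P - D P) \<in> principal_divisors f"
      "z = (\<lambda>P. x P + y P)" by (auto simp: mem_divisor_class)
    have "(\<lambda>P. z P - 2 * D P) = (\<lambda>P. (x P - D P) + (y P - D P))" by (auto simp: xy(3))
    then show "z \<in> divisor_class f (\<lambda>P. 2 * D P)"
      using principal_divisors_add[OF xy(1,2)] by (simp add: mem_divisor_class)
  next
    fix z assume "z \<in> divisor_class f (\<lambda>P. 2 * D P)"
    then have "(\<lambda>P. z P - 2 * D P) \<in> principal_divisors f" unfolding mem_divisor_class .
    also have "(\<lambda>P. z P - 2 * D P) = (\<lambda>P. (z P - D P) - D P)" by auto
    finally have "(\<lambda>P. z P - D P) \<in> divisor_class f D" unfolding mem_divisor_class .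
    moreover have "D \<in> divisor_class f D" by (simp add: mem_divisor_class principal_divisors_zero)
    moreover have "z = (\<lambda>P. (z P - D P) + D P)" by auto
    ultimately show "z \<in> (\<Union>x \<in> divisor_class f D. \<Union>y \<in> divisor_class f D. {\<lambda>P. x P + y P})" by blast
  qed
qed

text \<open>
  Outside the curve all divisors involved are 0, so an equation of divisors amounts to equations
  between orders at the points of the curve.
\<close>

lemma divisible_by_two_iff:
  assumes P: "P \<in> curve_points f"
  shows "(\<exists>Q \<in> carrier (jacobian_over f K0). Q \<otimes>\<^bsub>jacobian_over f K0\<^esub> Q = jacobian_embedding f P) \<longleftrightarrow>
    (\<exists>D \<phi>. D \<in> carrier (degree_zero_divisors f) \<and> divisor_defined_over f K0 D \<and> \<phi> \<noteq> ff_zero \<and>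
      (\<forall>Q \<in> curve_points f. ord_at f Q \<phi> = 2 * D Q - (point_divisor P Q - point_divisor Infinite_Point Q)))"
proof -
  have "(divisor_class f (\<lambda>Q. 2 * D Q) = jacobian_embedding f P) \<longleftrightarrow>
      (\<exists>\<phi>. \<phi> \<noteq> ff_zero \<and>
        (\<forall>Q \<in> curve_points f. ord_at f Q \<phi> = 2 * D Q - (point_divisor P Q - point_divisor Infinite_Point Q)))"
    if D: "D \<in> carrier (degree_zero_divisors f)" for D
  proof -
    have off: "2 * D Q - (point_divisor P Q - point_divisor Infinite_Point Q) = 0" if "Q \<notin> curve_points f" for Q
    proof -
      have "D Q = 0" using D that by (auto simp: degree_zero_divisors_def)
      moreover have "Q \<noteq> P" "Q \<noteq> Infinite_Point" using P that by (auto simp: curve_points_def)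
      ultimately show ?thesis by (simp add: point_divisor_def)
    qed
    have "(\<lambda>Q. 2 * D Q - (point_divisor P Q - point_divisor Infinite_Point Q)) = principal_divisor f \<phi> \<longleftrightarrow>
      (\<forall>Q \<in> curve_points f. ord_at f Q \<phi> = 2 * D Q - (point_divisor P Q - point_divisor Infinite_Point Q))" for \<phi>
      using off by (auto simp: principal_divisor_def fun_eq_iff)
    then show ?thesis
      unfolding jacobian_embedding_def divisor_class_eq_iff principal_divisors_def by blast
  qed
  moreover have "(\<exists>Q \<in> carrier (jacobian_over f K0). Q \<otimes>\<^bsub>jacobian_over f K0\<^esub> Q = jacobian_embedding f P) \<longleftrightarrow>
      (\<exists>D. D \<in> carrier (degree_zero_divisors f) \<and> divisor_defined_over f K0 D \<and>
        divisor_class f (\<lambda>Q. 2 * D Q) = jacobian_embedding f P)"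
  proof -
    have "carrier (jacobian_over f K0) =
        {divisor_class f D | D. D \<in> carrier (degree_zero_divisors f) \<and> divisor_defined_over f K0 D}"
      by (simp add: jacobian_over_def)
    then show ?thesis using double_divisor_class by auto
  qed
  ultimately show ?thesis by blast
qed

end

context coefficient_field
begin

lemma poly_ring_over_simps [simp]:
  "carrier (poly_ring_over K0) = PO" "monoid.mult (poly_ring_over K0) = (*)" "add (poly_ring_over K0) = (+)"
  "\<one>\<^bsub>poly_ring_over K0\<^esub> = 1" "\<zero>\<^bsub>poly_ring_over K0\<^esub> = 0"
  unfolding poly_ring_over_def ring_of_type_algebra_def by (simp_all only: partial_object.simps monoid.simps ring.simps)

lemma cring_poly_ring_over: "cring (poly_ring_over K0)"
proof (rule cringI)
  show "abelian_group (poly_ring_over K0)"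
  proof (rule abelian_groupI)
    show "\<exists>y \<in> carrier (poly_ring_over K0). y \<oplus>\<^bsub>poly_ring_over K0\<^esub> x = \<zero>\<^bsub>poly_ring_over K0\<^esub>"
      if "x \<in> carrier (poly_ring_over K0)" for x
      using that PO_uminus by (intro bexI[of _ "- x"]) simp_all
  qed (simp_all add: PO_add algebra_simps)
  show "Group.comm_monoid (poly_ring_over K0)"
    by (rule comm_monoidI) (simp_all add: PO_mult algebra_simps)
qed (simp_all add: algebra_simps)

text \<open>
  If \<open>f\<close> divides a polynomial over \<open>K\<^sub>0\<close>, then the quotient is over \<open>K\<^sub>0\<close> too. So membership in the
  ideal of \<open>K\<^sub>0[x]\<close> generated by \<open>f\<close> is divisibility in \<open>K[x]\<close>.
\<close>

lemma square_in_quotient_iff: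
  assumes f: "f \<in> PO" "f \<noteq> 0" and p: "p \<in> PO"
  shows "(\<exists>r \<in> carrier (quotient_algebra K0 f). r \<otimes>\<^bsub>quotient_algebra K0 f\<^esub> r = residue_class K0 f p) \<longleftrightarrow>
    (\<exists>q \<in> PO. f dvd q\<^sup>2 - p)"
proof -
  let ?R = "poly_ring_over K0"
  let ?I = "PIdl\<^bsub>?R\<^esub> f"
  interpret cring ?R by (rule cring_poly_ring_over)
  interpret I: ideal ?I ?R using cgenideal_ideal[of f] f by simp
  have I_iff: "x \<in> ?I \<longleftrightarrow> f dvd x" if x: "x \<in> PO" for x
  proof
    assume "f dvd x"
    then obtain k where k: "x = f * k" by (auto elim: dvdE)
    then have "k \<in> PO" using PO_mult_cancel[OF f(2,1), of k] x by simp
    then show "x \<in> ?I" using k by (auto simp: cgenideal_def mult.commute)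
  qed (auto simp: cgenideal_def)
  have class_eq: "residue_class K0 f x = residue_class K0 f y \<longleftrightarrow> f dvd x - y" if xy: "x \<in> PO" "y \<in> PO" for x y
  proof -
    have mem: "z \<in> residue_class K0 f y \<longleftrightarrow> f dvd z - y" if "z \<in> PO" "y \<in> PO" for z y
    proof -
      have "z \<in> residue_class K0 f y \<longleftrightarrow> (\<exists>i \<in> ?I. z = i + y)"
        by (simp add: residue_class_def a_r_coset_def r_coset_def)
      also have "\<dots> \<longleftrightarrow> z - y \<in> ?I" by (metis add_diff_cancel_right' diff_add_cancel)
      also have "\<dots> \<longleftrightarrow> f dvd z - y" using I_iff PO_diff[OF that] by blast
      finally show ?thesis .
    qed
    have PO: "z \<in> PO" if "z \<in> residue_class K0 f y" "y \<in> PO" for z y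
      using that I.Icarr by (auto simp: residue_class_def a_r_coset_def r_coset_def PO_add)
    show ?thesis
    proof
      assume "residue_class K0 f x = residue_class K0 f y"
      moreover have "x \<in> residue_class K0 f x" using mem[OF xy(1,1)] by simp
      ultimately show "f dvd x - y" using mem[OF xy] by simp
    next
      assume d: "f dvd x - y"
      have "z \<in> residue_class K0 f x \<longleftrightarrow> z \<in> residue_class K0 f y" if z: "z \<in> PO" for z
      proof -
        have "z - y = (z - x) + (x - y)" by simp
        then show ?thesis using mem[OF z xy(1)] mem[OF z xy(2)] d by (metis dvd_add_left_iff)
      qed
      then show "residue_class K0 f x = residue_class K0 f y" using PO xy by blast
    qed
  qed
  have carrier: "carrier (quotient_algebra K0 f) = residue_class K0 f ` PO"
    by (auto simp: quotient_algebra_def FactRing_def A_RCOSETS_def' residue_class_def)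
  have mult: "residue_class K0 f q \<otimes>\<^bsub>quotient_algebra K0 f\<^esub> residue_class K0 f q = residue_class K0 f (q\<^sup>2)"
    if "q \<in> PO" for q
    using I.rcoset_mult_add[of q q] that by (simp add: quotient_algebra_def FactRing_def residue_class_def power2_eq_square)
  show ?thesis using class_eq[OF PO_power p] by (auto simp: carrier mult)
qed

end

theorem theorem4p7:
  fixes \<alpha> :: "nat \<Rightarrow> 'k::alg_closed_field"
    and f :: "'k poly"
    and K0 :: "'k set"
    and g :: nat
    and a b :: 'k
  assumes char: "CHAR('k) \<noteq> 2"
    and genus: "g \<ge> 1"
    and distinct: "inj_on \<alpha> {1..2 * g + 1}"
    and f: "f = (\<Prod>i = 1..2 * g + 1. [:- \<alpha> i, 1:])"
    and K0: "subfield K0 (ring_of_type_algebra :: 'k ring)"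
    and f_over: "f \<in> poly_over K0"
    and P: "a \<in> K0" "b \<in> K0" "b\<^sup>2 = poly f a"
  shows "(\<exists>Q \<in> carrier (jacobian_over f K0).
            Q \<otimes>\<^bsub>jacobian_over f K0\<^esub> Q = jacobian_embedding f (Affine_Point a b))
         \<longleftrightarrow>
         (\<exists>r \<in> carrier (quotient_algebra K0 f).
            r \<otimes>\<^bsub>quotient_algebra K0 f\<^esub> r = residue_class K0 f [:a, -1:])"
proof -
  have f_deg: "degree f = 2 * g + 1" unfolding f by (subst degree_prod_eq_sum_degree) auto
  have f_nz: "f \<noteq> 0" using f_deg by auto
  interpret coefficient_field K0 by (rule subfield_coefficient_field[OF K0])
  interpret hyperelliptic_over f K0
  proof
    show "(2 :: 'k) \<noteq> 0"
    proof
      assume "(2 :: 'k) = 0"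
      then have "of_nat 2 = (0 :: 'k)" by simp
      then have "CHAR('k) dvd 2" by (simp only: of_nat_eq_0_iff_char_dvd)
      then have "CHAR('k) = 1 \<or> CHAR('k) = 2" using prime_nat_iff two_is_prime_nat by blast
      then show False using char by simp
    qed
    show "odd (degree f)" by (simp add: f_deg)
    show "lead_coeff f = 1" unfolding f lead_coeff_prod by simp
    show "f \<in> PO" by (rule f_over)
    fix x assume x: "poly f x = 0"
    then have "\<exists>i \<in> {1..2 * g + 1}. poly [:- \<alpha> i, 1:] x = 0"
      unfolding f poly_prod by (subst (asm) prod_zero_iff) blast+
    then obtain i where i: "i \<in> {1..2 * g + 1}" "x = \<alpha> i" by auto
    define h where "h = (\<Prod>j \<in> {1..2 * g + 1} - {i}. [:- \<alpha> j, 1:])"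
    have f_eq: "f = [:- x, 1:] * h" unfolding f h_def i(2) by (rule prod.remove[OF _ i(1)]) simp
    have "poly h x \<noteq> 0"
    proof -
      have "poly [:- \<alpha> j, 1:] x \<noteq> 0" if "j \<in> {1..2 * g + 1} - {i}" for j
        using distinct i that by (auto simp: inj_on_def)
      then show ?thesis unfolding h_def poly_prod by (subst prod_zero_iff) blast+
    qed
    then have "Polynomial.order x h = 0" by (rule order_0I)
    moreover have "Polynomial.order x [:- x, 1:] = 1" using order_power_n_n[of x 1] by simp
    ultimately show "Polynomial.order x f = 1"
      using f_nz unfolding f_eq by (subst order_mult) auto
  qed
  have "Affine_Point a b \<in> curve_points f" using P(3) by (simp add: curve_points_def affine_points_def)
  then have "(\<exists>Q \<in> carrier (jacobian_over f K0).
      Q \<otimes>\<^bsub>jacobian_over f K0\<^esub> Q = jacobian_embedding f (Affine_Point a b)) \<longleftrightarrow> (\<exists>q \<in> PO. f dvd q\<^sup>2 - [:a, -1:])"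
    unfolding divisible_by_two_iff[OF \<open>Affine_Point a b \<in> curve_points f\<close>]
    by (intro half_exists_iff_square[OF f_deg genus P(1,3)])
  moreover have "[:a, -1:] \<in> PO" using P(1) by (simp add: PO_pCons one_in uminus_in)
  ultimately show ?thesis using square_in_quotient_iff[OF f_over f_nz] by blast
qed

end
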